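(* Let $f$ be a meromorphic function and $g$ be a transcendental entire function such that $\rho_f(p,q)$ and $\rho_g^{[l]}$ are finite, where $p,q,l$ are positive integers with $p>q$ and $l\ge 2$. Let $G=g^{\alpha}Q[g]$, where $Q[g]$ is a differential polynomial in $g$. Then for any integer $\alpha\ge 1$: (i) if $q\ge l-1>1$, $$\liminf_{r\to\infty}\frac{\log^{[p-1]}T_{f\circ g}(r)}{\log^{[l-2]}T_G(r)}\le\rho_f(p,q)\cdot 2^{\rho_g^{[l]}};$$ (ii) if $q<l-1$, $$\liminf_{r\to\infty}\frac{\log^{[p+l-q-2]}T_{f\circ g}(r)}{\log^{[l-2]}T_G(r)}\le 2^{\rho_g^{[l]}};$$ (iii) if $q\ge l-1=1$, then for every real $\beta>1$, $$\liminf_{r\to\infty}\frac{\log^{[p-1]}T_{f\circ g}(r)}{T_G(r)}\le 3\beta\cdot\rho_f(p,q)\cdot 2^{\rho_g}.$$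
   Context: All functions are defined on the complex plane $\mathbb{C}$. Iterated logarithms: $\log^{[0]}x=x$, and for positive integers $k$, $\log^{[k]}x=\log(\log^{[k-1]}x)$ (for $x$ large enough that this is defined). $T_h(r)$ is the Nevanlinna characteristic function of a meromorphic function $h$, and $M_g(r)=\max_{|z|=r}|g(z)|$ for an entire function $g$. For positive integers $p\ge q$, the $(p,q)$-th order of a meromorphic function $f$ is $\rho_f(p,q)=\limsup_{r\to\infty}\frac{\log^{[p-1]}T_f(r)}{\log^{[q]}r}$. For an integer $l\ge 2$, the generalized order of an entire function $g$ is $\rho_g^{[l]}=\limsup_{r\to\infty}\frac{\log^{[l]}M_g(r)}{\log r}$, and $\rho_g=\rho_g^{[2]}$ is the order. A monomial generated by a transcendental meromorphic function $g$ is an expression $M[g]=g^{n_0}(g^{(1)})^{n_1}\cdots(g^{(k)})^{n_k}$ with non-negative integers $n_0,\dots,n_k$. A differential polynomial generated by (in) $g$ is an expression $Q[g]=a_1M_1[g]+\cdots+a_sM_s[g]$, where $M_1[g],\dots,M_s[g]$ are monomials in $g$ and $a_1,\dots,a_s$ are nonzero constants. *)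

theory Defs
  imports "HOL-Complex_Analysis.Complex_Analysis"
begin

text \<open>
  As the real logarithm is total, so is the iterated one. The values outside the natural domain
  are irrelevant below, where it is only used as its argument tends to infinity; the exceptions are
  the characteristics of constant functions, whose iterated logarithms are fixed real numbers.
\<close>

definition iter_ln :: "nat \<Rightarrow> real \<Rightarrow> real" where
  "iter_ln k = ln ^^ k"

definition ln_plus :: "real \<Rightarrow> real" where
  "ln_plus x = max 0 (ln x)"

text \<open>
  Nevanlinna theory of functions meromorphic on the complex plane. Poles and their multiplicities
  are determined by the behaviour on punctured neighbourhoods, so none of these notions depends on
  the values \<open>f\<close> happens to take at its poles (or on any other discrete set).
\<close>

definition proximity :: "(complex \<Rightarrow> complex) \<Rightarrow> real \<Rightarrow> real" where
  "proximity f r = integral {0..2 * pi} (\<lambda>t. ln_plus (norm (f (of_real r * cis t)))) / (2 * pi)"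

definition pole_count :: "(complex \<Rightarrow> complex) \<Rightarrow> real \<Rightarrow> nat" where
  "pole_count f t = (\<Sum>z | norm z \<le> t \<and> is_pole f z. nat (- zorder f z))"

definition integrated_count :: "(complex \<Rightarrow> complex) \<Rightarrow> real \<Rightarrow> real" where
  "integrated_count f r =
     integral {0..r} (\<lambda>t. (real (pole_count f t) - real (pole_count f 0)) / t) +
     real (pole_count f 0) * ln r"

definition nevanlinna_T :: "(complex \<Rightarrow> complex) \<Rightarrow> real \<Rightarrow> real" where
  "nevanlinna_T f r = proximity f r + integrated_count f r"

definition max_modulus :: "(complex \<Rightarrow> complex) \<Rightarrow> real \<Rightarrow> real" where
  "max_modulus g r = (SUP z\<in>sphere 0 r. norm (g z))"

definition pq_order :: "nat \<Rightarrow> nat \<Rightarrow> (complex \<Rightarrow> complex) \<Rightarrow> ereal" where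
  "pq_order p q f =
     Limsup at_top (\<lambda>r::real. ereal (iter_ln (p - 1) (nevanlinna_T f r) / iter_ln q r))"

definition gen_order :: "nat \<Rightarrow> (complex \<Rightarrow> complex) \<Rightarrow> ereal" where
  "gen_order l g = Limsup at_top (\<lambda>r::real. ereal (iter_ln l (max_modulus g r) / ln r))"

definition transcendental_entire :: "(complex \<Rightarrow> complex) \<Rightarrow> bool" where
  "transcendental_entire g \<longleftrightarrow> g holomorphic_on UNIV \<and> \<not> (\<exists>P. \<forall>z. g z = poly P z)"

definition diff_monomial :: "nat \<Rightarrow> (nat \<Rightarrow> nat) \<Rightarrow> (complex \<Rightarrow> complex) \<Rightarrow> complex \<Rightarrow> complex" where
  "diff_monomial k n g z = (\<Prod>j\<le>k. ((deriv ^^ j) g z) ^ n j)"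

definition is_diff_polynomial :: "(complex \<Rightarrow> complex) \<Rightarrow> (complex \<Rightarrow> complex) \<Rightarrow> bool" where
  "is_diff_polynomial g Q \<longleftrightarrow>
     (\<exists>s (a :: nat \<Rightarrow> complex) k n. 1 \<le> s \<and> (\<forall>i\<in>{1..s}. a i \<noteq> 0) \<and>
        Q = (\<lambda>z. \<Sum>i=1..s. a i * diff_monomial (k i) (n i) g z))"

end

theory Submission
  imports Defs "HOL-Real_Asymp.Real_Asymp"
begin

text \<open>
  Write \<open>f = h1 / h2\<close> with entire functions without common zeros. By Jensen's formula the
  characteristic of \<open>f\<close> is, up to a constant, the circle mean of the subharmonic function
  \<open>u = ln (max \<bar>h1\<bar> \<bar>h2\<bar>)\<close>, and that of \<open>f \<circ> g\<close> is the circle mean of \<open>u \<circ> g\<close>. Composing \<open>g\<close> with the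
  harmonic majorant of \<open>u\<close> on a disc of radius \<open>R\<close> between two and four times the maximum modulus \<open>M(r, g)\<close>,
  Harnack's inequality yields \<open>T(r, f \<circ> g) \<le> 3 T(R, f) + O(1)\<close>. In the other direction the lemma on the
  logarithmic derivative gives \<open>T(r, G) \<ge> T(r, g) - O(1 + log log M(7 r, g))\<close>, and the Poisson formula gives
  \<open>log M(r, g) \<le> 3 T(2 r, g)\<close>. Both bounds are compared along radii \<open>2^n * r0\<close> at which the iterated
  logarithm of \<open>M(r, g)\<close>, divided by a power of \<open>r\<close>, dominates all its later values; there the passage from
  \<open>r\<close> to \<open>2 r\<close> costs at most the factor \<open>2 powr \<sigma>\<close>, and the error term is negligible. The number \<open>r0\<close> is chosen
  so that all these circles avoid a countable set of exceptional radii.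
\<close>

subsection \<open>Circle means and the Poisson formula\<close>

text \<open>The mean value identities are applied only on circles free of zeros, poles and altered
  values. Bad circles have countably many radii, and bounding a limit inferior from above takes only
  arbitrarily large good radii, so bad ones are dodged rather than treated. The obstacle is the
  error term of the lower bound: it involves \<open>M\<close> at seven times the radius, and for
  irregular growth \<open>log log M(7 r, g)\<close> need not be small against
  \<open>log M(r, g)\<close>. At a peak the iterated logarithms at \<open>t\<close> and
  \<open>16 * t\<close> differ by a bounded factor, which forces \<open>log log M(16 t, g)\<close>
  to be \<open>o(log M(t, g))\<close>. The 3 in case (iii) is the Poisson kernel bound
  \<open>(2 s + s) / (2 s - s)\<close> behind \<open>log M(s, g) \<le> 3 T(2 s, g)\<close>. For
  \<open>l > 2\<close> the denominator takes at least one logarithm of \<open>T(r, G)\<close>, which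
  turns this factor into an additive constant; for \<open>l = 2\<close> it survives. The 3 from
  Harnack's inequality always vanishes, since \<open>p > q \<ge> 1\<close> puts
  \<open>T(r, f \<circ> g)\<close> under a logarithm. All bounds are proved for numbers strictly
  above the two orders, which then decrease to them.\<close>

definition circle_mean :: "(complex \<Rightarrow> real) \<Rightarrow> real \<Rightarrow> real" where
  "circle_mean u R = integral {0..2*pi} (\<lambda>t. u (of_real R * cis t)) / (2 * pi)"

lemma proximity_eq_circle_mean: "proximity f r = circle_mean (\<lambda>z. ln_plus (norm (f z))) r"
  by (simp add: proximity_def circle_mean_def)

lemma continuous_on_circle:
  assumes "continuous_on (sphere 0 R) u" "0 \<le> R"
  shows "continuous_on A (\<lambda>t. u (of_real R * cis t))"
  by (rule continuous_on_compose2[OF assms(1)])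
     (use assms(2) in \<open>auto intro!: continuous_intros simp: norm_mult\<close>)

lemma circle_integrable:
  fixes u :: "complex \<Rightarrow> 'a :: banach"
  assumes "continuous_on (sphere 0 R) u" "0 \<le> R"
  shows "(\<lambda>t. u (of_real R * cis t)) integrable_on {0..2*pi}"
  by (rule integrable_continuous_real) (rule continuous_on_circle[OF assms])

lemma circle_mean_cong:
  assumes "\<And>z. norm z = R \<Longrightarrow> u z = v z" "0 \<le> R"
  shows "circle_mean u R = circle_mean v R"
  unfolding circle_mean_def by (simp add: assms norm_mult)

lemma circle_mean_mono:
  assumes "continuous_on (sphere 0 R) u" "continuous_on (sphere 0 R) v" "0 \<le> R"
    and "\<And>z. norm z = R \<Longrightarrow> u z \<le> v z"
  shows "circle_mean u R \<le> circle_mean v R"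
  unfolding circle_mean_def
  by (intro divide_right_mono integral_le circle_integrable assms) (use assms(3) in \<open>auto simp: norm_mult\<close>)

lemma circle_mean_const [simp]: "circle_mean (\<lambda>_. c) R = c"
  by (simp add: circle_mean_def)

lemma circle_mean_add:
  assumes "continuous_on (sphere 0 R) u" "continuous_on (sphere 0 R) v" "0 \<le> R"
  shows "circle_mean (\<lambda>z. u z + v z) R = circle_mean u R + circle_mean v R"
  unfolding circle_mean_def
  by (subst integral_add) (auto intro!: circle_integrable assms simp: add_divide_distrib)

lemma circle_mean_cmult: "circle_mean (\<lambda>z. c * u z) R = c * circle_mean u R"
  by (simp add: circle_mean_def)

lemma circle_mean_diff:
  assumes "continuous_on (sphere 0 R) u" "continuous_on (sphere 0 R) v" "0 \<le> R"
  shows "circle_mean (\<lambda>z. u z - v z) R = circle_mean u R - circle_mean v R"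
  unfolding circle_mean_def
  by (subst integral_diff) (auto intro!: circle_integrable assms simp: diff_divide_distrib)

lemma circle_mean_sum:
  assumes "\<And>i. i \<in> I \<Longrightarrow> continuous_on (sphere 0 R) (u i)" "0 \<le> R" "finite I"
  shows "circle_mean (\<lambda>z. \<Sum>i\<in>I. u i z) R = (\<Sum>i\<in>I. circle_mean (u i) R)"
  unfolding circle_mean_def
  by (subst integral_sum) (auto intro!: circle_integrable assms simp: sum_divide_distrib)

text \<open>Without the factor \<open>1 / (2 * pi)\<close>, because \<open>circle_mean\<close> is
  already normalised.\<close>

definition poisson_kernel :: "real \<Rightarrow> complex \<Rightarrow> complex \<Rightarrow> real" where
  "poisson_kernel R w z = (R\<^sup>2 - (norm w)\<^sup>2) / (norm (z - w))\<^sup>2"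

lemma poisson_kernel_nonneg: "norm w \<le> R \<Longrightarrow> 0 \<le> poisson_kernel R w z"
  by (auto simp: poisson_kernel_def intro!: divide_nonneg_nonneg power_mono)

lemma poisson_kernel_0: "0 < R \<Longrightarrow> norm z = R \<Longrightarrow> poisson_kernel R 0 z = 1"
  by (simp add: poisson_kernel_def)

lemma poisson_kernel_le:
  assumes "norm w < R" "norm z = R"
  shows "poisson_kernel R w z \<le> (R + norm w) / (R - norm w)"
proof -
  have "R - norm w \<le> norm (z - w)"
    using assms norm_triangle_ineq2[of z w] by simp
  hence "(R - norm w)\<^sup>2 \<le> (norm (z - w))\<^sup>2"
    using assms by (intro power_mono) auto
  hence "poisson_kernel R w z \<le> (R\<^sup>2 - (norm w)\<^sup>2) / (R - norm w)\<^sup>2"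
    unfolding poisson_kernel_def using assms
    by (intro divide_left_mono mult_pos_pos zero_less_power) (auto intro: power_mono)
  also have "\<dots> = (R + norm w) / (R - norm w)"
  proof -
    have "R\<^sup>2 - (norm w)\<^sup>2 = (R + norm w) * (R - norm w)"
      by (simp add: power2_eq_square algebra_simps)
    thus ?thesis using assms by (simp add: power2_eq_square)
  qed
  finally show ?thesis .
qed

lemma continuous_on_poisson_kernel:
  "norm w < R \<Longrightarrow> continuous_on (sphere 0 R) (poisson_kernel R w)"
  unfolding poisson_kernel_def by (intro continuous_intros) auto

text \<open>The Schwarz kernel on the right is holomorphic in \<open>w\<close>; through it Poisson
  integrals become real parts of holomorphic functions.\<close>

lemma poisson_kernel_conv_Re:
  assumes "norm w < R" "norm z = R"
  shows "poisson_kernel R w z = Re ((z + w) / (z - w))"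
proof -
  have "(z + w) / (z - w) = (z + w) * cnj (z - w) / of_real ((norm (z - w))\<^sup>2)"
    using complex_div_cnj by blast
  also have "Re \<dots> = Re ((z + w) * cnj (z - w)) / (norm (z - w))\<^sup>2"
    by (simp only: Re_divide_of_real)
  also have "Re ((z + w) * cnj (z - w)) = (norm z)\<^sup>2 - (norm w)\<^sup>2"
    by (simp only: cmod_power2) (simp add: algebra_simps power2_eq_square)
  finally show ?thesis
    by (simp add: poisson_kernel_def assms)
qed

lemma has_integral_circle_contour:
  assumes "(F has_contour_integral I) (circlepath 0 R)"
  shows "((\<lambda>t. F (of_real R * cis t) * (of_real R * cis t)) has_integral (I / \<i>)) {0..2*pi}"
proof -
  have "((\<lambda>t. F (0 + of_real R * cis t) * of_real R * \<i> * cis t) has_integral I) {0..2*pi}"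
    using assms unfolding circlepath_def
    by (subst (asm) has_contour_integral_part_circlepath_iff) auto
  from has_integral_divide[OF this, of \<i>] show ?thesis
    by (simp add: mult_ac)
qed

text \<open>Cauchy's formula at \<open>w\<close> is added to Cauchy's theorem for a kernel whose
  pole is the reflected point \<open>R^2 / cnj w\<close> outside the circle; multiplied by
  \<open>z\<close>, the two kernels add up to the Poisson kernel.\<close>

theorem poisson_formula:
  fixes k :: "complex \<Rightarrow> complex"
  assumes holo: "k holomorphic_on ball 0 R'" and R: "0 < R" "R < R'" and w: "norm w < R"
  shows "((\<lambda>t. k (of_real R * cis t) * of_real (poisson_kernel R w (of_real R * cis t)))
           has_integral (2 * of_real pi * k w)) {0..2*pi}"
proof -
  \<comment> \<open>The third condition keeps the reflected point outside the disc of radius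
    \<open>R1\<close>.\<close>
  obtain R1 where R1: "R < R1" "R1 < R'" "norm w * R1 < R\<^sup>2"
  proof -
    have "\<exists>R1>R. R1 < R' \<and> norm w * R1 < R\<^sup>2"
    proof (cases "w = 0")
      case True
      thus ?thesis using R dense[of R R'] by auto
    next
      case False
      have "R < min R' (R\<^sup>2 / norm w)"
        using R w False by (simp add: power2_eq_square field_simps)
      then obtain R1 where "R < R1" "R1 < min R' (R\<^sup>2 / norm w)"
        using dense by blast
      thus ?thesis using False by (auto simp: field_simps)
    qed
    thus ?thesis using that by blast
  qed
  have nz: "of_real (R\<^sup>2) - cnj w * z \<noteq> 0" if "norm z < R1" for z
  proof
    assume "of_real (R\<^sup>2) - cnj w * z = 0"
    hence "cnj w * z = of_real (R\<^sup>2)" by simp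
    hence "norm (cnj w * z) = R\<^sup>2" by (metis abs_of_nonneg norm_of_real zero_le_power2)
    hence "norm w * norm z = R\<^sup>2" by (simp add: norm_mult)
    moreover have "norm w * norm z \<le> norm w * R1" using that by (intro mult_left_mono) auto
    ultimately show False using R1 by simp
  qed
  have holo1: "k holomorphic_on ball 0 R1"
    by (rule holomorphic_on_subset[OF holo]) (use R1 in auto)
  have 1: "((\<lambda>z. k z / (z - w)) has_contour_integral (2 * of_real pi * \<i> * k w)) (circlepath 0 R)"
    by (rule Cauchy_integral_circlepath_simple)
       (use w R1 R in \<open>auto intro!: holomorphic_on_subset[OF holo1]\<close>)
  have 2: "((\<lambda>z. k z * cnj w / (of_real (R\<^sup>2) - cnj w * z)) has_contour_integral 0) (circlepath 0 R)"
  proof (rule Cauchy_theorem_convex_simple[where S = "ball 0 R1"])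
    show "(\<lambda>z. k z * cnj w / (of_real (R\<^sup>2) - cnj w * z)) holomorphic_on ball 0 R1"
      using nz by (intro holomorphic_intros holo1) auto
  qed (use R R1 in auto)
  from has_integral_circle_contour[OF has_contour_integral_add[OF 1 2]]
  have "((\<lambda>t. (k (of_real R * cis t) / (of_real R * cis t - w) +
           k (of_real R * cis t) * cnj w / (of_real (R\<^sup>2) - cnj w * (of_real R * cis t))) * (of_real R * cis t))
          has_integral (2 * of_real pi * k w)) {0..2*pi}"
    by (simp add: mult_ac)
  also have "?this \<longleftrightarrow> ?thesis"
  proof (rule has_integral_cong)
    fix t :: real
    define z where "z = of_real R * cis t"
    have nz1: "z \<noteq> w" using w R by (auto simp: z_def norm_mult)
    \<comment> \<open>On the circle \<open>R^2\<close> is \<open>z * cnj z\<close>, which makes both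
      kernels rational in \<open>z\<close>, \<open>w\<close> and their conjugates.\<close>
    have zz: "of_real (R\<^sup>2) = z * cnj z"
      using R by (simp add: z_def power2_eq_square cis_cnj cis_divide flip: cis_inverse)
    have nz3: "z \<noteq> 0" "cnj z - cnj w \<noteq> 0"
      using nz1 R by (simp add: z_def, metis complex_cnj_cancel_iff right_minus_eq)
    have nz2: "z * cnj z - cnj w * z \<noteq> 0"
      using nz3 by (simp add: algebra_simps)
    have pk: "of_real (poisson_kernel R w z) = (z * cnj z - w * cnj w) / ((z - w) * (cnj z - cnj w))"
      unfolding poisson_kernel_def of_real_divide of_real_diff
      by (simp only: zz complex_norm_square[symmetric] flip: complex_cnj_diff)
    have "(k z / (z - w) + k z * cnj w / (of_real (R\<^sup>2) - cnj w * z)) * z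
         = k z * (z / (z - w) + cnj w * z / (z * cnj z - cnj w * z))"
      unfolding zz by (simp add: algebra_simps)
    also have "cnj w * z / (z * cnj z - cnj w * z) = cnj w / (cnj z - cnj w)"
      using nz3 by (simp add: field_simps)
    also have "z / (z - w) + cnj w / (cnj z - cnj w) = of_real (poisson_kernel R w z)"
      unfolding pk using nz1 nz3 by (simp add: field_simps)
    finally show "(k z / (z - w) + k z * cnj w / (of_real (R\<^sup>2) - cnj w * z)) * z =
      k z * of_real (poisson_kernel R w z)" .
  qed
  finally show ?thesis .
qed

lemma poisson_formula_Re:
  assumes "k holomorphic_on ball 0 R'" "0 < R" "R < R'" "norm w < R"
  shows "Re (k w) = circle_mean (\<lambda>z. Re (k z) * poisson_kernel R w z) R"
proof -
  from has_integral_Re[OF poisson_formula[OF assms]]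
  have "((\<lambda>t. Re (k (of_real R * cis t)) * poisson_kernel R w (of_real R * cis t))
           has_integral (2 * pi * Re (k w))) {0..2*pi}"
    by (simp add: mult_ac)
  thus ?thesis
    by (simp add: circle_mean_def integral_unique)
qed

lemma mean_value_Re:
  assumes "k holomorphic_on ball 0 R'" "0 < R" "R < R'"
  shows "Re (k 0) = circle_mean (\<lambda>z. Re (k z)) R"
proof -
  have "Re (k 0) = circle_mean (\<lambda>z. Re (k z) * poisson_kernel R 0 z) R"
    by (rule poisson_formula_Re[OF assms]) (use assms in auto)
  also have "\<dots> = circle_mean (\<lambda>z. Re (k z)) R"
    using assms(2) by (intro circle_mean_cong) (auto simp: poisson_kernel_0)
  finally show ?thesis .
qed

subsection \<open>Entire functions and their zeros\<close>

definition nonzero_entire :: "(complex \<Rightarrow> complex) \<Rightarrow> bool" where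
  "nonzero_entire h \<longleftrightarrow> h holomorphic_on UNIV \<and> (\<exists>z. h z \<noteq> 0)"

lemma nonzero_entire_holomorphic: "nonzero_entire h \<Longrightarrow> h holomorphic_on A"
  unfolding nonzero_entire_def using holomorphic_on_subset by blast

lemma nonzero_entire_continuous: "nonzero_entire h \<Longrightarrow> continuous_on A h"
  using nonzero_entire_holomorphic holomorphic_on_imp_continuous_on by blast

lemma nonzero_entire_analytic: "nonzero_entire h \<Longrightarrow> h analytic_on A"
  unfolding nonzero_entire_def using analytic_on_open analytic_on_subset open_UNIV by blast

lemma nonzero_entire_eventually:
  assumes "nonzero_entire h"
  shows "eventually (\<lambda>w. h w \<noteq> 0) (at z)"
proof -
  from assms obtain z0 where "h z0 \<noteq> 0" by (auto simp: nonzero_entire_def)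
  hence "eventually (\<lambda>w. h w \<noteq> 0 \<and> w \<in> UNIV) (at z)"
    using assms by (intro non_zero_neighbour_alt[where ?\<beta> = z0]) (auto simp: nonzero_entire_def)
  thus ?thesis by simp
qed

lemma nonzero_entire_frequently: "nonzero_entire h \<Longrightarrow> frequently (\<lambda>w. h w \<noteq> 0) (at z)"
  using nonzero_entire_eventually eventually_frequently by (metis trivial_limit_at)

lemma zorder_entire:
  assumes "nonzero_entire h"
  shows "zorder h z \<ge> 0" "zorder h z > 0 \<longleftrightarrow> h z = 0"
proof -
  show 1: "zorder h z > 0 \<longleftrightarrow> h z = 0"
    using assms nonzero_entire_frequently[OF assms]
    by (intro zorder_pos_iff[of _ UNIV]) (auto simp: nonzero_entire_def)
  show "zorder h z \<ge> 0"
    by (intro zorder_ge_0 nonzero_entire_analytic nonzero_entire_frequently assms)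
qed

lemma finite_zeros_cball:
  assumes "nonzero_entire h"
  shows "finite {z. norm z \<le> R \<and> h z = 0}"
proof (rule ccontr)
  assume inf: "infinite {z. norm z \<le> R \<and> h z = 0}"
  have "\<exists>z\<in>cball 0 R. z islimpt {z. norm z \<le> R \<and> h z = 0}"
    by (rule Heine_Borel_imp_Bolzano_Weierstrass) (use inf in auto)
  then obtain z where "z islimpt {z. norm z \<le> R \<and> h z = 0}" by blast
  hence "\<not> eventually (\<lambda>w. w \<notin> {z. norm z \<le> R \<and> h z = 0}) (at z)"
    by (simp only: islimpt_iff_eventually not_not simp_thms)
  moreover have "eventually (\<lambda>w. w \<notin> {z. norm z \<le> R \<and> h z = 0}) (at z)"
    using nonzero_entire_eventually[OF assms, of z] by eventually_elim auto
  ultimately show False by blast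
qed

lemma countable_zeros:
  assumes "nonzero_entire h"
  shows "countable {z. h z = 0}"
proof -
  have "{z. h z = 0} = (\<Union>n. {z. norm z \<le> real n \<and> h z = 0})"
    using real_arch_simple by fastforce
  also have "countable \<dots>"
    by (intro countable_UN ballI countable_finite[OF finite_zeros_cball[OF assms]]) auto
  finally show ?thesis .
qed

text \<open>The cofactor is glued from the local factor near \<open>b\<close> and the quotient away
  from \<open>b\<close>; they agree on the overlap of two open sets covering the plane.\<close>

lemma entire_factor_zero:
  assumes "nonzero_entire h"
  obtains k where "nonzero_entire k" "\<And>z. h z = (z - b) ^ nat (zorder h b) * k z" "k b \<noteq> 0"
proof -
  define n where "n = nat (zorder h b)"
  have "\<exists>r>0. cball b r \<subseteq> UNIV \<and> zor_poly h b holomorphic_on cball b r \<and>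
      (\<forall>w\<in>cball b r. h w = zor_poly h b w * (w - b) ^ nat (zorder h b) \<and> zor_poly h b w \<noteq> 0)"
    using assms by (intro conjunct2[OF zorder_exist_zero]) (auto simp: nonzero_entire_def connected_UNIV)
  then obtain g r where
    r: "r > 0" "g holomorphic_on cball b r" "\<And>w. w \<in> cball b r \<Longrightarrow> h w = g w * (w - b) ^ n \<and> g w \<noteq> 0"
    unfolding n_def by blast
  define k where "k z = (if z \<in> ball b r then g z else h z / (z - b) ^ n)" for z
  have kk: "k z = h z / (z - b) ^ n" if "z \<noteq> b" for z
    using that r(3)[of z] by (auto simp: k_def)
  have "k holomorphic_on ball b r \<union> (- {b})"
  proof (rule holomorphic_on_Un)
    have "g holomorphic_on ball b r"
      using r(2) by (rule holomorphic_on_subset) auto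
    thus "k holomorphic_on ball b r"
      by (rule holomorphic_transform) (auto simp: k_def)
    have "(\<lambda>z. h z / (z - b) ^ n) holomorphic_on - {b}"
      by (intro holomorphic_intros nonzero_entire_holomorphic assms) auto
    thus "k holomorphic_on - {b}"
      by (rule holomorphic_transform) (auto simp: kk)
  qed auto
  also have "ball b r \<union> (- {b}) = UNIV"
    using r(1) by auto
  finally have holo: "k holomorphic_on UNIV" .
  have kb: "k b \<noteq> 0"
    using r by (auto simp: k_def)
  have "h z = (z - b) ^ n * k z" for z
  proof (cases "z = b")
    case True
    thus ?thesis using r(3)[of b] r(1) by (auto simp: k_def)
  qed (auto simp: kk)
  thus ?thesis
    using that[of k] holo kb by (auto simp: nonzero_entire_def n_def)
qed

lemma entire_factor_zeros:
  assumes "nonzero_entire h" "finite Z"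
  obtains k where "nonzero_entire k" "\<And>z. h z = (\<Prod>b\<in>Z. (z - b) ^ nat (zorder h b)) * k z"
    "\<And>b. b \<in> Z \<Longrightarrow> k b \<noteq> 0"
proof -
  have "\<exists>k. nonzero_entire k \<and> (\<forall>z. h z = (\<Prod>b\<in>Z. (z - b) ^ nat (zorder h b)) * k z) \<and>
          (\<forall>b\<in>Z. k b \<noteq> 0)"
    using assms(2)
  proof induction
    case empty
    show ?case using assms(1) by (intro exI[of _ h]) auto
  next
    case (insert a Z)
    then obtain k where k: "nonzero_entire k" "\<And>z. h z = (\<Prod>b\<in>Z. (z - b) ^ nat (zorder h b)) * k z"
      "\<And>b. b \<in> Z \<Longrightarrow> k b \<noteq> 0"
      by blast
    obtain k' where k': "nonzero_entire k'" "\<And>z. k z = (z - a) ^ nat (zorder k a) * k' z" "k' a \<noteq> 0"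
      using entire_factor_zero[OF k(1)] by blast
    \<comment> \<open>The factors already split off do not vanish at the new point \<open>a\<close>,
      so they leave the order there unchanged.\<close>
    have "zorder h a = zorder k a"
    proof -
      have "zorder (\<lambda>z. (\<Prod>b\<in>Z. (z - b) ^ nat (zorder h b)) * k z) a = zorder k a"
      proof (rule zorder_eqI[of UNIV _ "\<lambda>z. (\<Prod>b\<in>Z. (z - b) ^ nat (zorder h b)) * k' z"])
        show "(\<lambda>z. (\<Prod>b\<in>Z. (z - b) ^ nat (zorder h b)) * k' z) holomorphic_on UNIV"
          by (intro holomorphic_intros nonzero_entire_holomorphic k')
        show "(\<Prod>b\<in>Z. (a - b) ^ nat (zorder h b)) * k' a \<noteq> 0"
          using k' insert by auto
        show "(\<Prod>b\<in>Z. (w - b) ^ nat (zorder h b)) * k w =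
          (\<Prod>b\<in>Z. (w - b) ^ nat (zorder h b)) * k' w * (w - a) powi zorder k a" for w
          using zorder_entire[OF k(1)]
          by (subst k'(2)) (auto simp: power_int_def)
      qed auto
      also have "(\<lambda>z. (\<Prod>b\<in>Z. (z - b) ^ nat (zorder h b)) * k z) = h"
        by (rule ext) (metis k(2))
      finally show ?thesis .
    qed
    hence "h z = (\<Prod>b\<in>insert a Z. (z - b) ^ nat (zorder h b)) * k' z" for z
      using insert by (subst k(2)) (simp add: k'(2)[of z])
    moreover have "k' b \<noteq> 0" if "b \<in> insert a Z" for b
      using that k(3)[of b] k'(2)[of b] k'(3) by auto
    ultimately show ?case
      using k'(1) by blast
  qed
  thus ?thesis using that by blast
qed

text \<open>Only finitely many zeros lie within \<open>R + 1\<close>; the least of their moduli,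
  capped at \<open>R + 1\<close>, serves as \<open>R'\<close>.\<close>

lemma nonvanishing_cball_bigger:
  assumes "nonzero_entire h" "\<And>z. norm z \<le> R \<Longrightarrow> h z \<noteq> 0" "0 < R"
  obtains R' where "R < R'" "\<And>z. norm z < R' \<Longrightarrow> h z \<noteq> 0"
proof -
  define Z where "Z = {z. norm z \<le> R + 1 \<and> h z = 0}"
  have fin: "finite (insert (R + 1) (norm ` Z))"
    using finite_zeros_cball[OF assms(1)] by (auto simp: Z_def)
  define R' where "R' = Min (insert (R + 1) (norm ` Z))"
  have "R < R'"
  proof -
    have "R < x" if "x \<in> insert (R + 1) (norm ` Z)" for x
      using that assms(2) by (force simp: Z_def not_le[symmetric])
    thus ?thesis unfolding R'_def using fin Min_in by blast
  qed
  moreover have "h z \<noteq> 0" if "norm z < R'" for z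
  proof
    assume "h z = 0"
    moreover have "R' \<le> R + 1"
      unfolding R'_def using fin by (intro Min_le) auto
    ultimately have "z \<in> Z" using that by (auto simp: Z_def)
    hence "R' \<le> norm z"
      unfolding R'_def using fin by (intro Min_le) auto
    thus False using that by simp
  qed
  ultimately show ?thesis by (rule that)
qed

lemma holomorphic_log_ball:
  assumes "k holomorphic_on ball 0 R" "\<And>z. norm z < R \<Longrightarrow> k z \<noteq> 0"
  obtains L where "L holomorphic_on ball 0 R" "\<And>z. norm z < R \<Longrightarrow> k z = exp (L z)"
proof -
  have "contractible (ball (0::complex) R)"
    by (intro convex_imp_contractible convex_ball)
  from contractible_imp_holomorphic_log[OF assms(1) this] assms(2)
  obtain L where "L holomorphic_on ball 0 R" "\<And>z. z \<in> ball 0 R \<Longrightarrow> k z = exp (L z)"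
    by (metis mem_ball_0)
  thus ?thesis using that by (metis mem_ball_0)
qed

text \<open>Replacing each factor \<open>z - b\<close> by \<open>(R\<^sup>2 - cnj b * z) / R\<close> moves the zeros out of the
  disc without changing the modulus on its boundary; this is division by a Blaschke product.\<close>

lemma blaschke_factor:
  assumes "norm b < R" "norm z \<le> R"
  shows "norm (z - b) \<le> norm (of_real R - cnj b * z / of_real R)"
    and "norm z = R \<Longrightarrow> norm (z - b) = norm (of_real R - cnj b * z / of_real R)"
proof -
  have R: "R > 0" using assms norm_ge_zero[of b] by linarith
  have eq: "(norm (of_real R - cnj b * z / of_real R))\<^sup>2 - (norm (z - b))\<^sup>2 =
        (R\<^sup>2 - (norm b)\<^sup>2) * (R\<^sup>2 - (norm z)\<^sup>2) / R\<^sup>2"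
  proof -
    have "of_real ((norm (of_real R - cnj b * z / of_real R))\<^sup>2 - (norm (z - b))\<^sup>2) =
      (of_real ((R\<^sup>2 - (norm b)\<^sup>2) * (R\<^sup>2 - (norm z)\<^sup>2) / R\<^sup>2) :: complex)"
      using R unfolding of_real_diff of_real_mult of_real_divide complex_norm_square
      by (simp add: field_simps power2_eq_square)
    thus ?thesis by (simp only: of_real_eq_iff)
  qed
  have "0 \<le> (R\<^sup>2 - (norm b)\<^sup>2) * (R\<^sup>2 - (norm z)\<^sup>2) / R\<^sup>2"
    using assms by (intro divide_nonneg_nonneg mult_nonneg_nonneg) (auto intro: power_mono)
  hence "(norm (z - b))\<^sup>2 \<le> (norm (of_real R - cnj b * z / of_real R))\<^sup>2"
    using eq by linarith
  thus "norm (z - b) \<le> norm (of_real R - cnj b * z / of_real R)"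
    by (rule power2_le_imp_le) auto
  show "norm (z - b) = norm (of_real R - cnj b * z / of_real R)" if "norm z = R"
  proof -
    have "(norm (z - b))\<^sup>2 = (norm (of_real R - cnj b * z / of_real R))\<^sup>2"
      using eq that by simp
    thus ?thesis by (simp add: power2_eq_iff_nonneg)
  qed
qed

lemma blaschke_factor_nonzero:
  assumes "norm b < R" "norm z \<le> R"
  shows "of_real R - cnj b * z / of_real R \<noteq> 0"
proof
  have R: "R > 0" using assms norm_ge_zero[of b] by linarith
  assume "of_real R - cnj b * z / of_real R = 0"
  hence "cnj b * z = of_real (R * R)"
    using R by (simp add: field_simps)
  hence "norm (cnj b * z) = R * R"
    using R by (metis abs_of_nonneg norm_of_real mult_nonneg_nonneg less_imp_le)
  hence "norm b * norm z = R * R"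
    by (simp add: norm_mult)
  moreover have "norm b * norm z \<le> norm b * R"
    using assms by (intro mult_left_mono) auto
  moreover have "norm b * R < R * R"
    using assms R by simp
  ultimately show False by simp
qed

text \<open>Once the zeros are reflected out of the disc, the resulting function is zero-free and
  has a holomorphic logarithm \<open>L\<close>. Thus \<open>Re L\<close> is the harmonic extension
  of \<open>ln (norm (h z))\<close> from the circle and dominates it inside. The last conclusion
  carries Jensen's formula: reflecting a zero \<open>b\<close> raises the value at the origin by
  \<open>ln (R / norm b)\<close> for each unit of multiplicity.\<close>

theorem outer_function:
  assumes h: "nonzero_entire h" and R: "0 < R" and nz: "\<And>z. norm z = R \<Longrightarrow> h z \<noteq> 0"
  obtains R' L where "R < R'" "L holomorphic_on ball 0 R'"
    "\<And>z. norm z \<le> R \<Longrightarrow> norm (h z) \<le> exp (Re (L z))"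
    "\<And>z. norm z = R \<Longrightarrow> norm (h z) = exp (Re (L z))"
    "h 0 \<noteq> 0 \<Longrightarrow> Re (L 0) = ln (norm (h 0)) +
       (\<Sum>b | norm b \<le> R \<and> h b = 0. of_int (zorder h b) * ln (R / norm b))"
proof -
  define Z where "Z = {b. norm b \<le> R \<and> h b = 0}"
  have fin: "finite Z" unfolding Z_def by (rule finite_zeros_cball[OF h])
  have Zlt: "norm b < R" if "b \<in> Z" for b
    using that nz[of b] by (auto simp: Z_def less_le)
  obtain k where k: "nonzero_entire k" "\<And>z. h z = (\<Prod>b\<in>Z. (z - b) ^ nat (zorder h b)) * k z"
    "\<And>b. b \<in> Z \<Longrightarrow> k b \<noteq> 0"
    using entire_factor_zeros[OF h fin] by blast
  define m where "m b = nat (zorder h b)" for b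
  define B where "B = (\<lambda>z. \<Prod>b\<in>Z. (of_real R - cnj b * z / of_real R) ^ m b)"
  define K where "K = (\<lambda>z. B z * k z)"
  have knz: "k z \<noteq> 0" if "norm z \<le> R" for z
  proof
    assume "k z = 0"
    hence "h z = 0" using k(2)[of z] by simp
    hence "z \<in> Z" using that by (auto simp: Z_def)
    thus False using k(3)[of z] \<open>k z = 0\<close> by simp
  qed
  have Bnz: "B z \<noteq> 0" if "norm z \<le> R" for z
    unfolding B_def using fin Zlt blaschke_factor_nonzero that by auto
  have K: "nonzero_entire K"
  proof -
    have "K holomorphic_on UNIV"
      unfolding K_def B_def using R by (intro holomorphic_intros nonzero_entire_holomorphic k) auto
    moreover have "K 0 \<noteq> 0" unfolding K_def using Bnz knz R by auto
    ultimately show ?thesis by (auto simp: nonzero_entire_def)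
  qed
  have Knz: "K z \<noteq> 0" if "norm z \<le> R" for z
    unfolding K_def using Bnz knz that by auto
  obtain R' where R': "R < R'" "\<And>z. norm z < R' \<Longrightarrow> K z \<noteq> 0"
    using nonvanishing_cball_bigger[OF K Knz R] by blast
  obtain L where L: "L holomorphic_on ball 0 R'" "\<And>z. norm z < R' \<Longrightarrow> K z = exp (L z)"
    using holomorphic_log_ball[OF nonzero_entire_holomorphic[OF K] R'(2)] by blast
  have norm_K: "norm (K z) = exp (Re (L z))" if "norm z \<le> R" for z
    using L(2)[of z] R'(1) that by (simp add: norm_exp_eq_Re)
  show ?thesis
  proof (rule that[OF R'(1) L(1)])
    fix z :: complex assume z: "norm z \<le> R"
    have "norm (h z) = (\<Prod>b\<in>Z. norm (z - b) ^ m b) * norm (k z)"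
      by (subst k(2)) (simp add: norm_mult prod_norm[symmetric] norm_power m_def)
    also have "\<dots> \<le> norm (K z)"
      unfolding K_def B_def norm_mult prod_norm[symmetric] norm_power
      using z Zlt by (intro mult_right_mono prod_mono conjI power_mono blaschke_factor) auto
    finally show "norm (h z) \<le> exp (Re (L z))" using norm_K[OF z] by simp
  next
    fix z :: complex assume z: "norm z = R"
    have "norm (h z) = (\<Prod>b\<in>Z. norm (z - b) ^ m b) * norm (k z)"
      by (subst k(2)) (simp add: norm_mult prod_norm[symmetric] norm_power m_def)
    also have "(\<Prod>b\<in>Z. norm (z - b) ^ m b) = norm (B z)"
      unfolding B_def prod_norm[symmetric] norm_power
      by (intro prod.cong refl arg_cong[of _ _ "\<lambda>x. x ^ _"] blaschke_factor(2)) (use z Zlt in auto)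
    finally show "norm (h z) = exp (Re (L z))" using norm_K[of z] z by (simp add: K_def norm_mult)
  next
    assume h0: "h 0 \<noteq> 0"
    hence Z0: "b \<noteq> 0" if "b \<in> Z" for b using that by (auto simp: Z_def)
    have "exp (Re (L 0)) = norm (K 0)" using norm_K[of 0] R by simp
    also have "\<dots> = (\<Prod>b\<in>Z. R ^ m b) * norm (k 0)"
      using R by (simp add: K_def B_def norm_mult prod_norm[symmetric] norm_power)
    finally have e1: "exp (Re (L 0)) = (\<Prod>b\<in>Z. R ^ m b) * norm (k 0)" .
    have e2: "norm (h 0) = (\<Prod>b\<in>Z. norm b ^ m b) * norm (k 0)"
      by (subst k(2)) (simp add: norm_mult prod_norm[symmetric] norm_power m_def)
    have k0: "norm (k 0) > 0" using knz[of 0] R by simp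
    have "Re (L 0) = ln ((\<Prod>b\<in>Z. R ^ m b) * norm (k 0))"
      by (simp flip: e1)
    also have "\<dots> = (\<Sum>b\<in>Z. m b * ln R) + ln (norm (k 0))"
      using k0 R fin by (subst ln_mult) (auto intro!: prod_pos simp: ln_prod ln_realpow)
    finally have f1: "Re (L 0) = (\<Sum>b\<in>Z. m b * ln R) + ln (norm (k 0))" .
    have f2: "ln (norm (h 0)) = (\<Sum>b\<in>Z. m b * ln (norm b)) + ln (norm (k 0))"
      unfolding e2 using k0 Z0 fin
      by (subst ln_mult) (auto intro!: prod_pos simp: ln_prod ln_realpow)
    have "(\<Sum>b\<in>Z. of_int (zorder h b) * ln (R / norm b)) = (\<Sum>b\<in>Z. m b * ln R - m b * ln (norm b))"
      using R Z0 zorder_entire[OF h] by (intro sum.cong) (auto simp: m_def ln_div algebra_simps)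
    thus "Re (L 0) = ln (norm (h 0)) +
       (\<Sum>b | norm b \<le> R \<and> h b = 0. of_int (zorder h b) * ln (R / norm b))"
      unfolding f1 f2 Z_def[symmetric] by (simp add: sum_subtractf)
  qed
qed

subsection \<open>Harmonic majorants\<close>

text \<open>Differentiation under the integral of the Schwarz kernel gives a holomorphic function,
  whose real part is the Poisson integral of \<open>u\<close>.\<close>

lemma schwarz_integral:
  assumes u: "continuous_on (sphere 0 R) u" and R: "0 < R"
  obtains S where "S holomorphic_on ball 0 R"
    "\<And>w. norm w < R \<Longrightarrow> Re (S w) = circle_mean (\<lambda>z. u z * poisson_kernel R w z) R"
proof -
  define \<zeta> where "\<zeta> t = of_real R * cis t" for t
  have norm_zeta: "norm (\<zeta> t) = R" for t using R by (simp add: \<zeta>_def norm_mult)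
  have zeta_ne: "\<zeta> t \<noteq> w" if "norm w < R" for t w using that norm_zeta[of t] by auto
  have cont_zeta: "continuous_on A \<zeta>" for A unfolding \<zeta>_def by (intro continuous_intros)
  have cont_u: "continuous_on A (\<lambda>t. u (\<zeta> t))" for A
    unfolding \<zeta>_def by (rule continuous_on_circle[OF u]) (use R in auto)
  define f where "f w t = of_real (u (\<zeta> t)) * ((\<zeta> t + w) / (\<zeta> t - w))" for w t
  define f' where "f' w t = of_real (u (\<zeta> t)) * (2 * \<zeta> t / (\<zeta> t - w)\<^sup>2)" for w t
  define S where "S w = integral (cbox 0 (2*pi)) (f w) / (2 * pi)" for w
  have int: "f w integrable_on cbox 0 (2*pi)" if "w \<in> ball 0 R" for w
    unfolding f_def by (rule integrable_continuous)
      (use that zeta_ne in \<open>auto intro!: continuous_intros cont_zeta cont_u\<close>)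
  have "(\<lambda>w. integral (cbox 0 (2*pi)) (f w)) holomorphic_on ball 0 R"
  proof (rule leibniz_rule_holomorphic[where fx = f'])
    fix w t assume w: "w \<in> ball (0 :: complex) R"
    show "((\<lambda>w. f w t) has_field_derivative f' w t) (at w within ball 0 R)"
      unfolding f_def f'_def using zeta_ne[of w t] w
      by (auto intro!: derivative_eq_intros simp: field_simps power2_eq_square)
  next
    have cu: "continuous_on (ball 0 R \<times> cbox 0 (2*pi)) (\<lambda>x. u (\<zeta> (snd x)))"
      by (rule continuous_on_compose2[OF cont_u[of UNIV]]) (auto intro!: continuous_intros)
    have cz: "continuous_on (ball 0 R \<times> cbox 0 (2*pi)) (\<lambda>x. \<zeta> (snd x))"
      by (rule continuous_on_compose2[OF cont_zeta[of UNIV]]) (auto intro!: continuous_intros)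
    show "continuous_on (ball 0 R \<times> cbox 0 (2 * pi)) (\<lambda>(w, t). f' w t)"
      unfolding f'_def case_prod_beta
      by (intro continuous_intros cu cz) (use zeta_ne in auto)
  qed (use int in auto)
  hence S: "S holomorphic_on ball 0 R"
    unfolding S_def by (intro holomorphic_intros) auto
  have "Re (S w) = circle_mean (\<lambda>z. u z * poisson_kernel R w z) R" if w: "norm w < R" for w
  proof -
    have "(f w has_integral integral (cbox 0 (2*pi)) (f w)) (cbox 0 (2*pi))"
      using int w by (simp add: integrable_integral)
    from has_integral_Re[OF this]
    have "((\<lambda>t. Re (f w t)) has_integral Re (integral (cbox 0 (2*pi)) (f w))) {0..2*pi}"
      by simp
    moreover have "Re (f w t) = u (\<zeta> t) * poisson_kernel R w (\<zeta> t)" for t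
    proof -
      have "Re (of_real c * x) = c * Re x" for c x by simp
      thus ?thesis unfolding f_def poisson_kernel_conv_Re[OF w norm_zeta] .
    qed
    ultimately have "circle_mean (\<lambda>z. u z * poisson_kernel R w z) R =
        Re (integral (cbox 0 (2*pi)) (f w)) / (2 * pi)"
      by (simp add: circle_mean_def \<zeta>_def integral_unique)
    moreover have "S w = integral (cbox 0 (2*pi)) (f w) / of_real (2 * pi)"
      by (simp add: S_def)
    ultimately show ?thesis by (simp only: Re_divide_of_real)
  qed
  with S show ?thesis using that by blast
qed

text \<open>The boundary values \<open>Re (S z) + C\<close> are nonnegative, so the Poisson kernel
  at \<open>a\<close> may be replaced by its upper bound on the circle; the mean value property
  evaluates what remains.\<close>

lemma harnack:
  assumes S: "S holomorphic_on ball 0 R'" and \<rho>: "0 < \<rho>" "\<rho> < R'" "norm a < \<rho>"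
    and nn: "\<And>z. norm z = \<rho> \<Longrightarrow> 0 \<le> Re (S z) + C"
  shows "Re (S a) + C \<le> (\<rho> + norm a) / (\<rho> - norm a) * (Re (S 0) + C)"
proof -
  define T where "T z = S z + of_real C" for z
  have T: "T holomorphic_on ball 0 R'" unfolding T_def by (intro holomorphic_intros S)
  have cT: "continuous_on (sphere 0 \<rho>) (\<lambda>z. Re (T z))"
    by (intro continuous_intros holomorphic_on_imp_continuous_on holomorphic_on_subset[OF T])
       (use \<rho> in auto)
  have "Re (T a) = circle_mean (\<lambda>z. Re (T z) * poisson_kernel \<rho> a z) \<rho>"
    by (rule poisson_formula_Re[OF T]) (use \<rho> in auto)
  also have "\<dots> \<le> circle_mean (\<lambda>z. (\<rho> + norm a) / (\<rho> - norm a) * Re (T z)) \<rho>"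
  proof (rule circle_mean_mono)
    fix z :: complex assume z: "norm z = \<rho>"
    have "poisson_kernel \<rho> a z * Re (T z) \<le> (\<rho> + norm a) / (\<rho> - norm a) * Re (T z)"
      by (rule mult_right_mono[OF poisson_kernel_le]) (use nn z \<rho> in \<open>auto simp: T_def\<close>)
    thus "Re (T z) * poisson_kernel \<rho> a z \<le> (\<rho> + norm a) / (\<rho> - norm a) * Re (T z)"
      by (simp add: mult_ac)
  qed (use \<rho> in \<open>auto intro!: continuous_on_mult continuous_on_poisson_kernel cT continuous_intros\<close>)
  also have "\<dots> = (\<rho> + norm a) / (\<rho> - norm a) * Re (T 0)"
    unfolding circle_mean_cmult by (subst mean_value_Re[OF T]) (use \<rho> in auto)
  finally show ?thesis by (simp add: T_def)
qed

lemma continuous_on_ln_norm: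
  assumes "nonzero_entire h" "\<And>z. z \<in> A \<Longrightarrow> h z \<noteq> 0"
  shows "continuous_on A (\<lambda>z. ln (norm (h z)))"
  by (intro continuous_intros nonzero_entire_continuous assms) (use assms in auto)

text \<open>The subharmonicity of \<open>ln (norm (h w))\<close>: the outer function dominates
  \<open>h\<close> inside, agrees with it in modulus on the circle, and obeys the Poisson
  formula.\<close>

lemma ln_norm_le_poisson:
  assumes h: "nonzero_entire h" and R: "0 < R" and nz: "\<And>z. norm z = R \<Longrightarrow> h z \<noteq> 0"
    and w: "norm w < R" "h w \<noteq> 0"
  shows "ln (norm (h w)) \<le> circle_mean (\<lambda>z. ln (norm (h z)) * poisson_kernel R w z) R"
proof -
  obtain R' L where L: "R < R'" "L holomorphic_on ball 0 R'"
    "\<And>z. norm z \<le> R \<Longrightarrow> norm (h z) \<le> exp (Re (L z))"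
    "\<And>z. norm z = R \<Longrightarrow> norm (h z) = exp (Re (L z))"
    by (rule outer_function[OF h R nz]) auto
  have "norm (h w) \<le> exp (Re (L w))" using L(3) w by simp
  hence "ln (norm (h w)) \<le> Re (L w)"
    using w by (metis ln_exp ln_mono zero_less_norm_iff)
  also have "\<dots> = circle_mean (\<lambda>z. Re (L z) * poisson_kernel R w z) R"
    by (rule poisson_formula_Re[OF L(2)]) (use R L w in auto)
  also have "\<dots> = circle_mean (\<lambda>z. ln (norm (h z)) * poisson_kernel R w z) R"
    by (intro circle_mean_cong) (use L(4) R in auto)
  finally show ?thesis .
qed

definition log_max :: "(complex \<Rightarrow> complex) \<Rightarrow> (complex \<Rightarrow> complex) \<Rightarrow> complex \<Rightarrow> real" where
  "log_max h1 h2 z = ln (max (norm (h1 z)) (norm (h2 z)))"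

lemma continuous_on_log_max:
  assumes "nonzero_entire h1" "nonzero_entire h2" "\<And>z. h1 z \<noteq> 0 \<or> h2 z \<noteq> 0"
  shows "continuous_on A (log_max h1 h2)"
proof -
  have "max (norm (h1 z)) (norm (h2 z)) \<noteq> 0" for z
    using assms(3)[of z] by (auto simp: max_def)
  thus ?thesis unfolding log_max_def
    by (intro continuous_intros nonzero_entire_continuous assms) auto
qed

text \<open>Serves compositions \<open>S \<circ> g\<close>: the mean value property on a circle asks
  for holomorphy on a slightly larger disc than the one that \<open>g\<close> is known to map into
  the domain of \<open>S\<close>.\<close>

lemma cball_bigger:
  assumes "open A" "cball (0::complex) r \<subseteq> A" "0 \<le> r"
  obtains R' where "r < R'" "ball 0 R' \<subseteq> A"
proof -
  obtain e where e: "e > 0" "(\<Union>x\<in>cball 0 r. ball x e) \<subseteq> A"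
    using compact_subset_open_imp_ball_epsilon_subset[OF compact_cball assms(1,2)] by blast
  have "ball 0 (r + e) \<subseteq> A"
  proof
    fix z :: complex assume z: "z \<in> ball 0 (r + e)"
    show "z \<in> A"
    proof (cases "norm z \<le> r")
      case True
      thus ?thesis using assms(2) by auto
    next
      case False
      \<comment> \<open>The radial projection of \<open>z\<close> to the sphere of radius
        \<open>r\<close>.\<close>
      define x where "x = of_real (r / norm z) * z"
      have nx: "norm x = r" using False assms(3) by (auto simp: x_def norm_mult norm_divide)
      have "z - x = of_real (1 - r / norm z) * z" by (simp add: x_def algebra_simps)
      hence "norm (z - x) = \<bar>1 - r / norm z\<bar> * norm z" by (simp only: norm_mult norm_of_real)
      also have "\<dots> = norm z - r" using False assms(3) by (auto simp: field_simps abs_if)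
      finally have "dist x z < e" using z by (simp add: dist_norm norm_minus_commute)
      moreover have "x \<in> cball 0 r" using nx by simp
      ultimately show ?thesis using e(2) by (meson UN_I mem_ball subsetD)
    qed
  qed
  thus ?thesis using that[of "r + e"] e by auto
qed

text \<open>The mean of the majorant composed with \<open>g\<close> is its value at
  \<open>g 0\<close>, whereas the mean of \<open>log_max h1 h2\<close> over the large circle is its
  value at 0. Harnack's inequality on a fixed disc passes from one point to the other at a cost
  independent of \<open>r\<close> and \<open>R\<close>.\<close>

theorem circle_mean_log_max_comp_le:
  assumes h: "nonzero_entire h1" "nonzero_entire h2" "\<And>z. h1 z \<noteq> 0 \<or> h2 z \<noteq> 0"
    and g: "g holomorphic_on UNIV"
  shows "\<exists>C. \<forall>r>0. \<forall>R. (\<forall>z. norm z \<le> r \<longrightarrow> norm (g z) < R) \<longrightarrow> 2 * norm (g 0) + 1 < R \<longrightarrow>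
           (\<forall>z. norm z = R \<longrightarrow> h1 z \<noteq> 0 \<and> h2 z \<noteq> 0) \<longrightarrow>
           circle_mean (\<lambda>z. log_max h1 h2 (g z)) r \<le> 3 * circle_mean (log_max h1 h2) R + C"
proof -
  define a where "a = g 0"
  \<comment> \<open>Makes the Harnack quotient \<open>(3 * norm a + 1) / (norm a + 1)\<close>, which
    is at most 3, and keeps the radius positive when \<open>a = 0\<close>.\<close>
  define \<rho> where "\<rho> = 2 * norm a + 1"
  note cont = continuous_on_log_max[OF h]
  have "bounded (log_max h1 h2 ` cball 0 \<rho>)"
    by (intro compact_imp_bounded compact_continuous_image cont) auto
  then obtain C where C: "\<And>z. norm z \<le> \<rho> \<Longrightarrow> - C \<le> log_max h1 h2 z"
    unfolding bounded_real by (metis abs_le_D2 image_eqI mem_cball_0 minus_le_iff)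
  have "circle_mean (\<lambda>z. log_max h1 h2 (g z)) r \<le> 3 * circle_mean (log_max h1 h2) R + 2 * C"
    if r: "r > 0" and gR: "\<And>z. norm z \<le> r \<Longrightarrow> norm (g z) < R" and R: "2 * norm (g 0) + 1 < R"
      and nz: "\<And>z. norm z = R \<Longrightarrow> h1 z \<noteq> 0 \<and> h2 z \<noteq> 0" for r R
  proof -
    have R0: "R > 0" using R norm_ge_zero[of "g 0"] by linarith
    obtain S where S: "S holomorphic_on ball 0 R"
      "\<And>w. norm w < R \<Longrightarrow> Re (S w) = circle_mean (\<lambda>z. log_max h1 h2 z * poisson_kernel R w z) R"
      using schwarz_integral[OF cont R0] by blast
    have S0: "Re (S 0) = circle_mean (log_max h1 h2) R"
      unfolding S(2)[of 0, simplified, OF R0]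
      by (intro circle_mean_cong) (use R0 in \<open>auto simp: poisson_kernel_0\<close>)
    \<comment> \<open>Each of the two functions lies below its own Poisson integral, which lies
      below that of the maximum; hence the maximum lies below it too.\<close>
    have le1: "ln (norm (h w)) \<le> Re (S w)"
      if w: "norm w < R" and hh: "h = h1 \<or> h = h2" and "h w \<noteq> 0" for w h
    proof -
      have ne: "nonzero_entire h" and nzh: "\<And>z. norm z = R \<Longrightarrow> h z \<noteq> 0"
        using hh h nz by auto
      have "ln (norm (h w)) \<le> circle_mean (\<lambda>z. ln (norm (h z)) * poisson_kernel R w z) R"
        by (rule ln_norm_le_poisson) (use ne nzh R0 that in auto)
      also have "\<dots> \<le> circle_mean (\<lambda>z. log_max h1 h2 z * poisson_kernel R w z) R"
      proof (rule circle_mean_mono)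
        fix z :: complex assume z: "norm z = R"
        have "ln (norm (h z)) \<le> log_max h1 h2 z"
          unfolding log_max_def using hh nzh[OF z] by (intro ln_mono) (auto simp: max_def)
        thus "ln (norm (h z)) * poisson_kernel R w z \<le> log_max h1 h2 z * poisson_kernel R w z"
          by (intro mult_right_mono poisson_kernel_nonneg) (use w in auto)
      qed (use R0 w nzh in \<open>auto intro!: continuous_on_mult continuous_on_poisson_kernel cont
                                  continuous_on_ln_norm ne\<close>)
      also have "\<dots> = Re (S w)" using S(2) w by simp
      finally show ?thesis .
    qed
    have le: "log_max h1 h2 w \<le> Re (S w)" if w: "norm w < R" for w
    proof (cases "norm (h1 w) \<ge> norm (h2 w)")
      case True
      hence "h1 w \<noteq> 0" using h(3)[of w] by auto
      thus ?thesis using le1[OF w, of h1] True by (simp add: log_max_def)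
    next
      case False
      hence "h2 w \<noteq> 0" by auto
      thus ?thesis using le1[OF w, of h2] False by (simp add: log_max_def)
    qed
    have gc: "continuous_on UNIV g" using g holomorphic_on_imp_continuous_on by blast
    obtain r' where r': "r < r'" "ball 0 r' \<subseteq> g -` ball 0 R"
    proof (rule cball_bigger[of "g -` ball 0 R" r])
      show "open (g -` ball 0 R)" using gc open_ball by (metis continuous_on_open_vimage open_UNIV Int_UNIV_right)
    qed (use gR r in auto)
    have Sg: "(\<lambda>z. S (g z)) holomorphic_on ball 0 r'"
      using r' g by (intro holomorphic_on_compose_gen[unfolded o_def, OF _ S(1)])
        (auto intro: holomorphic_on_subset)
    have "circle_mean (\<lambda>z. log_max h1 h2 (g z)) r \<le> circle_mean (\<lambda>z. Re (S (g z))) r"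
    proof (rule circle_mean_mono)
      show "continuous_on (sphere 0 r) (\<lambda>z. log_max h1 h2 (g z))"
        by (rule continuous_on_compose2[OF cont[of UNIV]]) (auto intro: continuous_on_subset[OF gc])
      show "continuous_on (sphere 0 r) (\<lambda>z. Re (S (g z)))"
        by (intro continuous_intros holomorphic_on_imp_continuous_on holomorphic_on_subset[OF Sg])
           (use r' in auto)
    qed (use r gR le in auto)
    also have "\<dots> = Re (S (g 0))" by (rule mean_value_Re[OF Sg, symmetric]) (use r r' in auto)
    also have "Re (S (g 0)) + C \<le> (\<rho> + norm a) / (\<rho> - norm a) * (Re (S 0) + C)"
      unfolding a_def[symmetric]
    proof (rule harnack[OF S(1)])
      fix z :: complex assume z: "norm z = \<rho>"
      hence "- C \<le> log_max h1 h2 z" using C by simp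
      also have "\<dots> \<le> Re (S z)" by (rule le) (use z R in \<open>auto simp: \<rho>_def a_def\<close>)
      finally show "0 \<le> Re (S z) + C" by simp
    qed (use R in \<open>auto simp: \<rho>_def a_def add_pos_nonneg add_nonneg_pos\<close>)
    also have "\<dots> \<le> 3 * (Re (S 0) + C)"
    proof (rule mult_right_mono)
      show "(\<rho> + norm a) / (\<rho> - norm a) \<le> 3"
        unfolding \<rho>_def by (simp add: field_simps add_pos_nonneg)
      have "- C \<le> log_max h1 h2 0" using C[of 0] by (simp add: \<rho>_def)
      also have "\<dots> \<le> Re (S 0)" using le[of 0] R0 by simp
      finally show "0 \<le> Re (S 0) + C" by simp
    qed
    finally show ?thesis using S0 by simp
  qed
  thus ?thesis by blast
qed

text \<open>The zero at the origin is divided out and the Poisson inequality at 0 is applied to the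
  cofactor. A zero at the origin contributes at least \<open>ln r\<close>, the source of all lower
  bounds on characteristics of quotients below.\<close>

lemma circle_mean_ln_norm_ge:
  assumes h: "nonzero_entire h"
  shows "\<exists>C. \<forall>r\<ge>1. (\<forall>z. norm z = r \<longrightarrow> h z \<noteq> 0) \<longrightarrow>
           (if h 0 = 0 then ln r else 0) - C \<le> circle_mean (\<lambda>z. ln (norm (h z))) r"
proof -
  define n where "n = nat (zorder h 0)"
  obtain k where k: "nonzero_entire k" "\<And>z. h z = (z - 0) ^ n * k z" "k 0 \<noteq> 0"
    using entire_factor_zero[OF h, of 0] unfolding n_def by blast
  have "(if h 0 = 0 then ln r else 0) - (- ln (norm (k 0))) \<le> circle_mean (\<lambda>z. ln (norm (h z))) r"
    if r: "r \<ge> 1" and nz: "\<And>z. norm z = r \<Longrightarrow> h z \<noteq> 0" for r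
  proof -
    have knz: "k z \<noteq> 0" if "norm z = r" for z using nz[OF that] k(2)[of z] by auto
    have "ln (norm (k 0)) \<le> circle_mean (\<lambda>z. ln (norm (k z)) * poisson_kernel r 0 z) r"
      by (rule ln_norm_le_poisson) (use r k knz in auto)
    also have "\<dots> = circle_mean (\<lambda>z. ln (norm (h z)) - n * ln r) r"
    proof (rule circle_mean_cong)
      fix z :: complex assume z: "norm z = r"
      show "ln (norm (k z)) * poisson_kernel r 0 z = ln (norm (h z)) - n * ln r"
        using z r knz[OF z] by (subst k(2)) (simp add: poisson_kernel_0 norm_mult norm_power ln_mult ln_realpow)
    qed (use r in auto)
    also have "\<dots> = circle_mean (\<lambda>z. ln (norm (h z))) r - n * ln r"
      using r by (subst circle_mean_diff) (auto intro!: continuous_on_ln_norm h nz)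
    finally have 1: "ln (norm (k 0)) + n * ln r \<le> circle_mean (\<lambda>z. ln (norm (h z))) r" by simp
    have "(if h 0 = 0 then ln r else 0) \<le> n * ln r"
    proof (cases "h 0 = 0")
      case True
      hence "n \<ge> 1" using zorder_entire(2)[OF h, of 0] by (simp add: n_def)
      hence "1 * ln r \<le> n * ln r" using r by (intro mult_right_mono) auto
      thus ?thesis using True by simp
    qed (use r in auto)
    with 1 show ?thesis by simp
  qed
  thus ?thesis by blast
qed

subsection \<open>The characteristic function of a quotient of entire functions\<close>

text \<open>Equality is asked on punctured neighbourhoods only, because the values of
  \<open>F\<close> at its poles, or on any other discrete set, are arbitrary.\<close>

definition quotient_rep :: "(complex \<Rightarrow> complex) \<Rightarrow> (complex \<Rightarrow> complex) \<Rightarrow> (complex \<Rightarrow> complex) \<Rightarrow> bool" where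
  "quotient_rep F h1 h2 \<longleftrightarrow> nonzero_entire h1 \<and> nonzero_entire h2 \<and> (\<forall>z. h1 z \<noteq> 0 \<or> h2 z \<noteq> 0) \<and>
     (\<forall>z. eventually (\<lambda>w. F w = h1 w / h2 w) (at z))"

text \<open>The exceptions have no accumulation point, so every disc contains finitely many; only
  countably many radii are affected.\<close>

lemma countable_exceptions:
  fixes P :: "complex \<Rightarrow> bool"
  assumes "\<And>z. eventually P (at z)"
  shows "countable {z. \<not> P z}"
proof -
  have "finite {z. norm z \<le> R \<and> \<not> P z}" for R
  proof (rule ccontr)
    assume inf: "infinite {z. norm z \<le> R \<and> \<not> P z}"
    have "\<exists>z\<in>cball 0 R. z islimpt {z. norm z \<le> R \<and> \<not> P z}"
      by (rule Heine_Borel_imp_Bolzano_Weierstrass) (use inf in auto)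
    then obtain z where "z islimpt {z. norm z \<le> R \<and> \<not> P z}" by blast
    hence "\<not> eventually (\<lambda>w. w \<notin> {z. norm z \<le> R \<and> \<not> P z}) (at z)"
      by (simp only: islimpt_iff_eventually not_not simp_thms)
    moreover have "eventually (\<lambda>w. w \<notin> {z. norm z \<le> R \<and> \<not> P z}) (at z)"
      using assms[of z] by eventually_elim auto
    ultimately show False by blast
  qed
  hence "countable (\<Union>n. {z. norm z \<le> real n \<and> \<not> P z})"
    by (intro countable_UN) (auto intro: countable_finite)
  also have "(\<Union>n. {z. norm z \<le> real n \<and> \<not> P z}) = {z. \<not> P z}"
    using real_arch_simple by fastforce
  finally show ?thesis .
qed

text \<open>Without common zeros nothing cancels, so a zero of \<open>h2\<close> keeps its
  multiplicity as a pole.\<close>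

lemma quotient_rep_pole:
  assumes "quotient_rep F h1 h2"
  shows "is_pole F z \<longleftrightarrow> h2 z = 0" "h2 z = 0 \<Longrightarrow> zorder F z = - zorder h2 z"
proof -
  have h: "nonzero_entire h1" "nonzero_entire h2" "h1 z \<noteq> 0 \<or> h2 z \<noteq> 0"
    and ev: "eventually (\<lambda>w. F w = h1 w / h2 w) (at z)"
    using assms by (auto simp: quotient_rep_def)
  have "is_pole F z \<longleftrightarrow> is_pole (\<lambda>w. h1 w / h2 w) z"
    by (rule is_pole_cong[OF ev refl])
  also have "\<dots> \<longleftrightarrow> h2 z = 0"
  proof
    assume "h2 z = 0"
    have "isCont h1 z" "isCont h2 z"
      using nonzero_entire_continuous[OF h(1), of UNIV] nonzero_entire_continuous[OF h(2), of UNIV]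
      by (auto simp: continuous_on_eq_continuous_at)
    hence "filterlim h2 (at 0) (at z)"
      using \<open>h2 z = 0\<close> nonzero_entire_eventually[OF h(2), of z] by (auto simp: filterlim_at isCont_def)
    thus "is_pole (\<lambda>w. h1 w / h2 w) z"
      using \<open>isCont h1 z\<close> \<open>h2 z = 0\<close> h(3) by (intro is_pole_divide) auto
  next
    assume p: "is_pole (\<lambda>w. h1 w / h2 w) z"
    show "h2 z = 0"
    proof (rule ccontr)
      assume "h2 z \<noteq> 0"
      hence "(\<lambda>w. h1 w / h2 w) analytic_on {z}"
        by (intro analytic_intros nonzero_entire_analytic h) auto
      with p show False using analytic_at_imp_no_pole by blast
    qed
  qed
  finally show "is_pole F z \<longleftrightarrow> h2 z = 0" .
  assume z: "h2 z = 0"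
  have "zorder F z = zorder (\<lambda>w. h1 w / h2 w) z"
    by (rule zorder_cong[OF ev refl])
  also have "\<dots> = zorder h1 z - zorder h2 z"
    by (intro Meromorphic.zorder_divide analytic_on_imp_meromorphic_on nonzero_entire_analytic
        nonzero_entire_frequently h)
  also have "zorder h1 z = 0"
    using z h(3) by (intro zorder_eq_0I nonzero_entire_analytic h) auto
  finally show "zorder F z = - zorder h2 z" by simp
qed

text \<open>The count is a finite sum of step functions, one per zero \<open>b \<noteq> 0\<close>;
  the step from \<open>norm b\<close> to \<open>r\<close>, divided by \<open>t\<close>, integrates
  to a logarithm. A pole at the origin enters through the separate term with
  \<open>ln r\<close>.\<close>

lemma integrated_count_eq:
  assumes h: "nonzero_entire h" and r: "r > 0"
    and pole: "\<And>z. is_pole F z \<longleftrightarrow> h z = 0" "\<And>z. h z = 0 \<Longrightarrow> zorder F z = - zorder h z"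
  shows "integrated_count F r =
    (\<Sum>b | norm b \<le> r \<and> h b = 0 \<and> b \<noteq> 0. of_int (zorder h b) * ln (r / norm b)) + of_int (zorder h 0) * ln r"
proof -
  define Z where "Z = {b. norm b \<le> r \<and> h b = 0 \<and> b \<noteq> 0}"
  define m where "m b = nat (zorder h b)" for b
  have fin: "finite {b. norm b \<le> t \<and> h b = 0}" for t by (rule finite_zeros_cball[OF h])
  have finZ: "finite Z" unfolding Z_def by (rule finite_subset[OF _ fin[of r]]) auto
  have m: "real (m b) = of_int (zorder h b)" for b using zorder_entire(1)[OF h] by (simp add: m_def)
  have pc: "pole_count F t = (\<Sum>z | norm z \<le> t \<and> h z = 0. m z)" for t
    unfolding pole_count_def pole(1) by (intro sum.cong) (auto simp: pole(2) m_def)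
  have m0: "m 0 = 0" if "h 0 \<noteq> 0"
    using that zorder_entire(2)[OF h, of 0] by (auto simp: m_def)
  have pc0: "pole_count F 0 = m 0"
  proof -
    have "{z. norm z \<le> 0 \<and> h z = 0} = (if h 0 = 0 then {0} else {})" by auto
    thus ?thesis using m0 by (auto simp: pc)
  qed
  have diff: "real (pole_count F t) - real (pole_count F 0) = (\<Sum>b\<in>Z. if norm b \<le> t then real (m b) else 0)"
    if t: "t \<in> {0..r}" for t
  proof -
    have "{z. norm z \<le> t \<and> h z = 0} = (if h 0 = 0 then {0} else {}) \<union> {b\<in>Z. norm b \<le> t}"
      using t by (auto simp: Z_def)
    hence "pole_count F t = (\<Sum>b\<in>(if h 0 = 0 then {0} else {}). m b) + (\<Sum>b\<in>{b\<in>Z. norm b \<le> t}. m b)"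
      unfolding pc using finite_subset[OF _ finZ, of "{b\<in>Z. norm b \<le> t}"]
      by (subst sum.union_disjoint[symmetric]) (auto simp: Z_def)
    also have "(\<Sum>b\<in>(if h 0 = 0 then {0} else {}). m b) = m 0" using m0 by auto
    finally have "real (pole_count F t) - real (pole_count F 0) = (\<Sum>b\<in>{b\<in>Z. norm b \<le> t}. real (m b))"
      by (simp add: pc0)
    also have "\<dots> = (\<Sum>b\<in>Z. if norm b \<le> t then real (m b) else 0)"
      using finZ by (rule sum.inter_filter)
    finally show ?thesis .
  qed
  have int1: "((\<lambda>t. (if norm b \<le> t then real (m b) else 0) / t) has_integral (m b * ln (r / norm b))) {0..r}"
    if b: "b \<in> Z" for b
  proof -
    have b': "0 < norm b" "norm b \<le> r" using b by (auto simp: Z_def)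
    have "((\<lambda>t. real (m b) / t) has_integral (real (m b) * ln r - real (m b) * ln (norm b))) {norm b..r}"
    proof (rule fundamental_theorem_of_calculus)
      show "((\<lambda>t. real (m b) * ln t) has_vector_derivative real (m b) / x) (at x within {norm b..r})"
        if "x \<in> {norm b..r}" for x
        unfolding has_real_derivative_iff_has_vector_derivative[symmetric]
        using less_le_trans[OF b'(1), of x] that by (auto intro!: derivative_eq_intros)
    qed (use b' in auto)
    also have "real (m b) * ln r - real (m b) * ln (norm b) = m b * ln (r / norm b)"
      using b' r by (simp add: ln_div algebra_simps)
    finally have "((\<lambda>t. if t \<in> {norm b..r} then real (m b) / t else 0) has_integral (m b * ln (r / norm b))) {0..r}"
      by (subst has_integral_restrict) auto
    thus ?thesis by (rule has_integral_eq[rotated]) (use b' in auto)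
  qed
  have "((\<lambda>t. \<Sum>b\<in>Z. (if norm b \<le> t then real (m b) else 0) / t) has_integral (\<Sum>b\<in>Z. m b * ln (r / norm b))) {0..r}"
    using finZ int1 by (rule has_integral_sum)
  hence "((\<lambda>t. (real (pole_count F t) - real (pole_count F 0)) / t) has_integral (\<Sum>b\<in>Z. m b * ln (r / norm b))) {0..r}"
    by (rule has_integral_eq[rotated]) (simp add: diff sum_divide_distrib)
  thus ?thesis
    unfolding integrated_count_def Z_def[symmetric] by (simp add: integral_unique pc0 m)
qed

lemma zorder_mult_nonzero:
  assumes "p analytic_on {z}" "p z \<noteq> 0" "nonzero_entire q"
  shows "zorder (\<lambda>w. p w * q w) z = zorder q z"
proof -
  have pnz: "eventually (\<lambda>w. p w \<noteq> 0) (at z)"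
    using assms(1,2) by (intro tendsto_imp_eventually_ne[of _ "p z"])
      (auto simp: analytic_at_imp_isCont isContD)
  have "eventually (\<lambda>w. p w * q w \<noteq> 0) (at z)"
    using pnz nonzero_entire_eventually[OF assms(3), of z] by eventually_elim auto
  hence "zorder (\<lambda>w. p w * q w) z = zorder p z + zorder q z"
    by (intro zorder_times_analytic assms(1) nonzero_entire_analytic[OF assms(3)])
  also have "zorder p z = 0" by (rule zorder_eq_0I) (use assms in auto)
  finally show ?thesis by simp
qed

text \<open>With the zero at the origin divided out, the mean over the circle is the value at 0 of
  the real part of the logarithm from \<open>outer_function\<close>. The constant is the logarithm
  of the modulus of the first nonzero Taylor coefficient, hence independent of
  \<open>r\<close>.\<close>

lemma jensen_formula:
  assumes h: "nonzero_entire h"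
  shows "\<exists>c. \<forall>r>0. (\<forall>z. norm z = r \<longrightarrow> h z \<noteq> 0) \<longrightarrow> circle_mean (\<lambda>z. ln (norm (h z))) r = c +
    ((\<Sum>b | norm b \<le> r \<and> h b = 0 \<and> b \<noteq> 0. of_int (zorder h b) * ln (r / norm b)) + of_int (zorder h 0) * ln r)"
proof -
  define n where "n = nat (zorder h 0)"
  obtain q where q: "nonzero_entire q" "\<And>z. h z = (z - 0) ^ n * q z" "q 0 \<noteq> 0"
    using entire_factor_zero[OF h, of 0] unfolding n_def by blast
  have n: "of_int (zorder h 0) = real n" using zorder_entire(1)[OF h] by (simp add: n_def)
  have zo: "zorder h b = zorder q b" if "b \<noteq> 0" for b
  proof -
    have "zorder (\<lambda>z. (z - 0) ^ n * q z) b = zorder q b"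
      by (rule zorder_mult_nonzero) (use that q in \<open>auto intro!: analytic_intros\<close>)
    thus ?thesis using q(2) by presburger
  qed
  have "circle_mean (\<lambda>z. ln (norm (h z))) r = ln (norm (q 0)) +
    ((\<Sum>b | norm b \<le> r \<and> h b = 0 \<and> b \<noteq> 0. of_int (zorder h b) * ln (r / norm b)) + of_int (zorder h 0) * ln r)"
    if r: "r > 0" and nz: "\<And>z. norm z = r \<Longrightarrow> h z \<noteq> 0" for r
  proof -
    have qnz: "q z \<noteq> 0" if "norm z = r" for z using nz[OF that] q(2)[of z] by auto
    obtain R' L where L: "r < R'" "L holomorphic_on ball 0 R'"
      "\<And>z. norm z = r \<Longrightarrow> norm (q z) = exp (Re (L z))"
      "q 0 \<noteq> 0 \<Longrightarrow> Re (L 0) = ln (norm (q 0)) +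
         (\<Sum>b | norm b \<le> r \<and> q b = 0. of_int (zorder q b) * ln (r / norm b))"
      by (rule outer_function[OF q(1) r qnz]) auto
    have Zeq: "{b. norm b \<le> r \<and> q b = 0} = {b. norm b \<le> r \<and> h b = 0 \<and> b \<noteq> 0}"
      using q(2,3) by auto
    have "circle_mean (\<lambda>z. ln (norm (h z))) r = circle_mean (\<lambda>z. n * ln r + Re (L z)) r"
    proof (rule circle_mean_cong)
      fix z :: complex assume z: "norm z = r"
      show "ln (norm (h z)) = n * ln r + Re (L z)"
        using z r qnz[OF z] L(3)[OF z]
        by (subst q(2)) (simp add: norm_mult norm_power ln_mult ln_realpow)
    qed (use r in auto)
    also have "\<dots> = n * ln r + circle_mean (\<lambda>z. Re (L z)) r"
      using r L(1) by (subst circle_mean_add)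
        (auto intro!: continuous_intros holomorphic_on_imp_continuous_on holomorphic_on_subset[OF L(2)])
    also have "circle_mean (\<lambda>z. Re (L z)) r = Re (L 0)"
      by (rule mean_value_Re[OF L(2), symmetric]) (use r L in auto)
    also have "\<dots> = ln (norm (q 0)) + (\<Sum>b | norm b \<le> r \<and> q b = 0. of_int (zorder q b) * ln (r / norm b))"
      using L(4) q(3) by blast
    also have "(\<Sum>b | norm b \<le> r \<and> q b = 0. of_int (zorder q b) * ln (r / norm b)) =
       (\<Sum>b | norm b \<le> r \<and> h b = 0 \<and> b \<noteq> 0. of_int (zorder h b) * ln (r / norm b))"
      unfolding Zeq by (intro sum.cong) (auto simp: zo)
    finally show ?thesis by (simp add: n)
  qed
  thus ?thesis by blast
qed

lemma ln_plus_eq: "0 \<le> x \<Longrightarrow> ln_plus x = ln (max 1 x)"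
proof -
  assume "0 \<le> x"
  thus ?thesis
    by (cases "x = 0"; cases "x \<le> 1") (auto simp: ln_plus_def max_def ln_ge_zero_iff)
qed

text \<open>On the circle the integrand of the proximity function is
  \<open>log_max h1 h2 z - ln (norm (h2 z))\<close>, and by Jensen's formula the mean of the
  subtracted term is the integrated count of poles plus a constant. The two cancel.\<close>

theorem nevanlinna_T_quotient:
  assumes rep: "quotient_rep F h1 h2"
  shows "\<exists>c. \<forall>r>0. (\<forall>z. norm z = r \<longrightarrow> h2 z \<noteq> 0 \<and> F z = h1 z / h2 z) \<longrightarrow>
           nevanlinna_T F r = circle_mean (log_max h1 h2) r - c"
proof -
  have h: "nonzero_entire h1" "nonzero_entire h2" "\<And>z. h1 z \<noteq> 0 \<or> h2 z \<noteq> 0"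
    using rep by (auto simp: quotient_rep_def)
  obtain c where c: "\<And>r. r > 0 \<Longrightarrow> (\<And>z. norm z = r \<Longrightarrow> h2 z \<noteq> 0) \<Longrightarrow>
     circle_mean (\<lambda>z. ln (norm (h2 z))) r = c +
      ((\<Sum>b | norm b \<le> r \<and> h2 b = 0 \<and> b \<noteq> 0. of_int (zorder h2 b) * ln (r / norm b)) + of_int (zorder h2 0) * ln r)"
    using jensen_formula[OF h(2)] by blast
  have "nevanlinna_T F r = circle_mean (log_max h1 h2) r - c"
    if r: "r > 0" and nz: "\<And>z. norm z = r \<Longrightarrow> h2 z \<noteq> 0 \<and> F z = h1 z / h2 z" for r
  proof -
    have "integrated_count F r = circle_mean (\<lambda>z. ln (norm (h2 z))) r - c"
      using c[OF r] nz integrated_count_eq[OF h(2) r quotient_rep_pole[OF rep]] by auto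
    moreover have "proximity F r = circle_mean (\<lambda>z. log_max h1 h2 z - ln (norm (h2 z))) r"
      unfolding proximity_eq_circle_mean
    proof (rule circle_mean_cong)
      fix z :: complex assume z: "norm z = r"
      have pos: "norm (h2 z) > 0" using nz[OF z] by simp
      have "ln_plus (norm (F z)) = ln (max 1 (norm (h1 z) / norm (h2 z)))"
        using nz[OF z] by (simp add: ln_plus_eq norm_divide)
      also have "max 1 (norm (h1 z) / norm (h2 z)) = max (norm (h1 z)) (norm (h2 z)) / norm (h2 z)"
        using pos by (auto simp: max_def field_simps)
      also have "ln \<dots> = log_max h1 h2 z - ln (norm (h2 z))"
        unfolding log_max_def using pos by (subst ln_div) (auto simp: max_def)
      finally show "ln_plus (norm (F z)) = log_max h1 h2 z - ln (norm (h2 z))" .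
    qed (use r in auto)
    moreover have "\<dots> = circle_mean (log_max h1 h2) r - circle_mean (\<lambda>z. ln (norm (h2 z))) r"
      using r nz by (intro circle_mean_diff continuous_on_log_max h continuous_on_ln_norm) auto
    ultimately show ?thesis by (simp add: nevanlinna_T_def)
  qed
  thus ?thesis by blast
qed

lemma nonzero_entire_diff_cmult:
  assumes "nonzero_entire h1" "nonzero_entire h2" "\<exists>z. h1 z \<noteq> c * h2 z"
  shows "nonzero_entire (\<lambda>z. h1 z - c * h2 z)"
proof -
  have "(\<lambda>z. h1 z - c * h2 z) holomorphic_on UNIV"
    by (intro holomorphic_intros nonzero_entire_holomorphic assms)
  thus ?thesis using assms(3) by (auto simp: nonzero_entire_def)
qed

text \<open>Some linear combination of \<open>h1\<close> and \<open>h2\<close> vanishes at the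
  origin without vanishing identically, as they are not proportional. It is at most a constant times
  the maximum, and its zero at 0 forces the growth \<open>ln r\<close>.\<close>

lemma circle_mean_log_max_ge:
  assumes h: "nonzero_entire h1" "nonzero_entire h2" "\<And>z. h1 z \<noteq> 0 \<or> h2 z \<noteq> 0"
    and nc: "\<And>c. \<exists>z. h1 z \<noteq> c * h2 z"
  shows "\<exists>B C. countable B \<and> (\<forall>r\<ge>1. r \<notin> B \<longrightarrow> ln r - C \<le> circle_mean (log_max h1 h2) r)"
proof -
  define h3 where "h3 z = (if h2 0 = 0 then h2 z else h1 z - (h1 0 / h2 0) * h2 z)" for z
  have "h3 = (if h2 0 = 0 then h2 else (\<lambda>z. h1 z - (h1 0 / h2 0) * h2 z))"
    by (auto simp: h3_def)
  hence h3: "nonzero_entire h3" "h3 0 = 0"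
    using h(2) nonzero_entire_diff_cmult[OF h(1,2) nc, of "h1 0 / h2 0"] by (auto split: if_splits)
  define K where "K = 1 + norm (h1 0 / h2 0)"
  have K: "K \<ge> 1" by (simp add: K_def)
  have bd: "norm (h3 z) \<le> K * max (norm (h1 z)) (norm (h2 z))" for z
  proof (cases "h2 0 = 0")
    case True
    have "1 * norm (h2 z) \<le> K * max (norm (h1 z)) (norm (h2 z))"
      using K by (intro mult_mono) auto
    thus ?thesis using True by (simp add: h3_def)
  next
    case False
    have "norm (h3 z) \<le> norm (h1 z) + norm (h1 0 / h2 0) * norm (h2 z)"
      using False norm_triangle_ineq4[of "h1 z" "(h1 0 / h2 0) * h2 z"] by (simp add: h3_def norm_mult norm_divide)
    also have "\<dots> \<le> max (norm (h1 z)) (norm (h2 z)) + norm (h1 0 / h2 0) * max (norm (h1 z)) (norm (h2 z))"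
      by (intro add_mono mult_left_mono) auto
    also have "\<dots> = K * max (norm (h1 z)) (norm (h2 z))" by (simp add: K_def algebra_simps)
    finally show ?thesis .
  qed
  obtain C where C: "\<And>r. r \<ge> 1 \<Longrightarrow> (\<And>z. norm z = r \<Longrightarrow> h3 z \<noteq> 0) \<Longrightarrow>
     ln r - C \<le> circle_mean (\<lambda>z. ln (norm (h3 z))) r"
    using circle_mean_ln_norm_ge[OF h3(1)] h3(2) by auto
  have "ln r - (C + ln K) \<le> circle_mean (log_max h1 h2) r"
    if r: "r \<ge> 1" and nz: "r \<notin> norm ` {z. h3 z = 0}" for r
  proof -
    have nz': "h3 z \<noteq> 0" if "norm z = r" for z using that nz by auto
    have "ln r - C \<le> circle_mean (\<lambda>z. ln (norm (h3 z))) r" using C r nz' by blast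
    also have "\<dots> \<le> circle_mean (\<lambda>z. ln K + log_max h1 h2 z) r"
    proof (rule circle_mean_mono)
      fix z :: complex assume z: "norm z = r"
      have pos: "max (norm (h1 z)) (norm (h2 z)) > 0" using h(3)[of z] by (auto simp: less_max_iff_disj)
      have "ln (norm (h3 z)) \<le> ln (K * max (norm (h1 z)) (norm (h2 z)))"
        using bd[of z] nz'[OF z] K pos by (intro ln_mono) auto
      also have "\<dots> = ln K + log_max h1 h2 z"
        unfolding log_max_def using K pos by (intro ln_mult_pos) auto
      finally show "ln (norm (h3 z)) \<le> ln K + log_max h1 h2 z" .
    qed (use r nz' in \<open>auto intro!: continuous_intros continuous_on_log_max h continuous_on_ln_norm h3\<close>)
    also have "\<dots> = ln K + circle_mean (log_max h1 h2) r"
      using r by (subst circle_mean_add) (auto intro!: continuous_on_log_max h)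
    finally show ?thesis by simp
  qed
  moreover have "countable (norm ` {z. h3 z = 0})"
    by (intro countable_image countable_zeros h3)
  ultimately show ?thesis by blast
qed

text \<open>Gathers all conditions on circles in one countable set of radii, so that later arguments
  have only \<open>B\<close> to avoid.\<close>

lemma quotient_rep_growth:
  assumes rep: "quotient_rep F h1 h2" and nc: "\<And>c. \<exists>z. h1 z \<noteq> c * h2 z"
  obtains B c C where "countable B"
    "\<And>r. r \<ge> 1 \<Longrightarrow> r \<notin> B \<Longrightarrow> nevanlinna_T F r = circle_mean (log_max h1 h2) r - c"
    "\<And>r. r \<ge> 1 \<Longrightarrow> r \<notin> B \<Longrightarrow> ln r - C \<le> nevanlinna_T F r"
    "\<And>z. norm z \<notin> B \<Longrightarrow> h1 z \<noteq> 0 \<and> h2 z \<noteq> 0"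
proof -
  have h: "nonzero_entire h1" "nonzero_entire h2" "\<And>z. h1 z \<noteq> 0 \<or> h2 z \<noteq> 0"
    and ev: "\<And>z. eventually (\<lambda>w. F w = h1 w / h2 w) (at z)"
    using rep by (auto simp: quotient_rep_def)
  obtain B0 C where BC: "countable B0" "\<And>r. r \<ge> 1 \<Longrightarrow> r \<notin> B0 \<Longrightarrow> ln r - C \<le> circle_mean (log_max h1 h2) r"
    using circle_mean_log_max_ge[OF h nc] by blast
  obtain c where c: "\<And>r. r > 0 \<Longrightarrow> (\<And>z. norm z = r \<Longrightarrow> h2 z \<noteq> 0 \<and> F z = h1 z / h2 z) \<Longrightarrow>
           nevanlinna_T F r = circle_mean (log_max h1 h2) r - c"
    using nevanlinna_T_quotient[OF rep] by blast
  define B where "B = B0 \<union> norm ` ({z. F z \<noteq> h1 z / h2 z} \<union> {z. h1 z = 0} \<union> {z. h2 z = 0})"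
  have B: "countable B"
    unfolding B_def
    by (intro countable_Un countable_image BC countable_zeros h countable_exceptions[OF ev])
  have *: "h1 z \<noteq> 0 \<and> h2 z \<noteq> 0 \<and> F z = h1 z / h2 z" if "norm z \<notin> B" for z
    using that by (auto simp: B_def)
  have T: "nevanlinna_T F r = circle_mean (log_max h1 h2) r - c" if "r \<ge> 1" "r \<notin> B" for r
    using that * by (intro c) auto
  show ?thesis
  proof (rule that[OF B, of c "C + c"])
    show "ln r - (C + c) \<le> nevanlinna_T F r" if "r \<ge> 1" "r \<notin> B" for r
      using T[OF that] BC(2)[of r] that by (auto simp: B_def)
  qed (use T * in auto)
qed

section \<open>Composition with a nonconstant entire function\<close>

lemma entire_isCont: "g holomorphic_on UNIV \<Longrightarrow> isCont g a"
  using continuous_on_eq_continuous_at[OF open_UNIV] holomorphic_on_imp_continuous_on by blast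

text \<open>By isolation of values, \<open>g\<close> maps small punctured neighbourhoods into
  punctured neighbourhoods; this transports statements that hold eventually near a point through the
  composition.\<close>

lemma entire_filterlim_at:
  assumes g: "g holomorphic_on UNIV" "\<exists>z. g z \<noteq> g a"
  shows "filterlim g (at (g a)) (at a)"
proof -
  have "nonzero_entire (\<lambda>z. g z - g a)"
    unfolding nonzero_entire_def using g by (auto intro!: holomorphic_intros)
  thus ?thesis
    using entire_isCont[OF g(1), of a] nonzero_entire_eventually[of "\<lambda>z. g z - g a" a]
    by (auto simp: filterlim_at isCont_def)
qed

lemma nonzero_entire_compose:
  assumes h: "nonzero_entire h" and g: "g holomorphic_on UNIV" "\<And>a. \<exists>z. g z \<noteq> g a"
  shows "nonzero_entire (\<lambda>z. h (g z))"
proof -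
  have "filterlim g (at (g 0)) (at 0)" by (rule entire_filterlim_at[OF g])
  hence "eventually (\<lambda>z. h (g z) \<noteq> 0) (at 0)"
    by (rule eventually_compose_filterlim[OF nonzero_entire_eventually[OF h]])
  hence "\<exists>z. h (g z) \<noteq> 0" using eventually_happens trivial_limit_at by blast
  moreover have "(\<lambda>z. h (g z)) holomorphic_on UNIV"
    using holomorphic_on_compose[OF g(1), of h] nonzero_entire_holomorphic[OF h]
    by (simp add: o_def)
  ultimately show ?thesis by (simp add: nonzero_entire_def)
qed

lemma quotient_rep_compose:
  assumes rep: "quotient_rep F h1 h2" and g: "g holomorphic_on UNIV" "\<And>a. \<exists>z. g z \<noteq> g a"
  shows "quotient_rep (F \<circ> g) (\<lambda>z. h1 (g z)) (\<lambda>z. h2 (g z))"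
proof -
  have "eventually (\<lambda>w. F w = h1 w / h2 w) (at z)" for z
    using rep by (auto simp: quotient_rep_def)
  hence "eventually (\<lambda>w. (F \<circ> g) w = h1 (g w) / h2 (g w)) (at z)" for z
    unfolding o_def by (rule eventually_compose_filterlim[OF _ entire_filterlim_at[OF g]])
  thus ?thesis
    using rep nonzero_entire_compose g by (auto simp: quotient_rep_def)
qed

text \<open>Weierstrass factorisation writes \<open>f\<close> as a quotient without common zeros.
  Functions constant up to a discrete set form a case of their own, because their characteristic
  does not tend to infinity.\<close>

lemma meromorphic_quotient_rep:
  assumes "f meromorphic_on UNIV"
  obtains (const) c where "\<And>z. eventually (\<lambda>w. f w = c) (at z)"
  | (rep) h1 h2 where "quotient_rep f h1 h2" "\<And>c. \<exists>z. h1 z \<noteq> c * h2 z"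
proof -
  define F where "F = remove_sings f"
  have nice: "F nicely_meromorphic_on UNIV"
    unfolding F_def by (rule remove_sings_nicely_meromorphic[OF assms])
  have evF: "eventually (\<lambda>w. f w = F w) (at z)" for z
  proof -
    have "f meromorphic_on {z}" using assms by (rule meromorphic_on_subset) auto
    hence "isolated_singularity_at f z" by (simp add: meromorphic_at_iff)
    from eventually_remove_sings_eq_at[OF this] show ?thesis
      unfolding F_def by eventually_elim auto
  qed
  obtain h f1 f2 where w:
    "h holomorphic_on UNIV" "f1 holomorphic_on UNIV" "f2 holomorphic_on UNIV"
    "\<forall>z. f1 z = 0 \<longleftrightarrow> \<not>is_pole F z \<and> F z = 0"
    "\<forall>z. f2 z = 0 \<longleftrightarrow> is_pole F z" "\<forall>z. h z \<noteq> 0" "\<forall>z. F z = h z * f1 z / f2 z"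
    using weierstrass_factorization_meromorphic_UNIV[OF nice] by metis
  define h1 where "h1 z = h z * f1 z" for z
  have hol1: "h1 holomorphic_on UNIV" unfolding h1_def by (intro holomorphic_intros w)
  \<comment> \<open>If \<open>f2\<close> vanished identically, division by zero would make
    \<open>F\<close> the zero function, which has no poles.\<close>
  have ex2: "\<exists>z. f2 z \<noteq> 0"
  proof (rule ccontr)
    assume "\<not> (\<exists>z. f2 z \<noteq> 0)"
    hence all: "is_pole F z" for z using w(5) by auto
    hence "F z = 0" for z using w(7,5) by simp
    hence "F = (\<lambda>_. 0)" by auto
    with all[of 0] show False by simp
  qed
  have ne2: "nonzero_entire f2" using w ex2 by (auto simp: nonzero_entire_def)
  show ?thesis
  proof (cases "\<exists>c. \<forall>z. h1 z = c * f2 z")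
    case True
    then obtain c where c: "\<And>z. h1 z = c * f2 z" by blast
    have "eventually (\<lambda>w. f w = c) (at z)" for z
      using evF[of z] nonzero_entire_eventually[OF ne2, of z]
      by eventually_elim (use w(7) c in \<open>auto simp: h1_def\<close>)
    thus ?thesis by (rule const)
  next
    case False
    hence nc: "\<exists>z. h1 z \<noteq> c * f2 z" for c by auto
    have "nonzero_entire h1" using nc[of 0] hol1 by (auto simp: nonzero_entire_def)
    moreover have "h1 z \<noteq> 0 \<or> f2 z \<noteq> 0" for z using w by (auto simp: h1_def)
    moreover have "eventually (\<lambda>w. f w = h1 w / f2 w) (at z)" for z
      using evF[of z] by eventually_elim (use w in \<open>auto simp: h1_def\<close>)
    ultimately have "quotient_rep f h1 f2" using ne2 by (auto simp: quotient_rep_def)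
    thus ?thesis using nc by (rule rep)
  qed
qed

text \<open>The formula for characteristics of quotients, used for \<open>f\<close> at radius
  \<open>R\<close> and for \<open>f \<circ> g\<close> at radius \<open>r\<close>, turns the
  inequality between circle means into one between characteristics. Hence both radii have to avoid
  \<open>B\<close>.\<close>

theorem nevanlinna_T_compose_le:
  assumes rep: "quotient_rep f h1 h2" and nc: "\<And>c. \<exists>z. h1 z \<noteq> c * h2 z"
    and g: "g holomorphic_on UNIV" "\<And>a. \<exists>z. g z \<noteq> g a"
  obtains B C where "countable B"
    "\<And>r R. r \<ge> 1 \<Longrightarrow> r \<notin> B \<Longrightarrow> R \<notin> B \<Longrightarrow> \<forall>z. norm z \<le> r \<longrightarrow> norm (g z) < R \<Longrightarrow>
       2 * norm (g 0) + 1 < R \<Longrightarrow> nevanlinna_T (f \<circ> g) r \<le> 3 * nevanlinna_T f R + C"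
    "\<And>r. r \<ge> 1 \<Longrightarrow> r \<notin> B \<Longrightarrow> ln r - C \<le> nevanlinna_T (f \<circ> g) r"
    "\<And>r. r \<ge> 1 \<Longrightarrow> r \<notin> B \<Longrightarrow> ln r - C \<le> nevanlinna_T f r"
proof -
  have h: "nonzero_entire h1" "nonzero_entire h2" "\<And>z. h1 z \<noteq> 0 \<or> h2 z \<noteq> 0"
    using rep by (auto simp: quotient_rep_def)
  have nc': "\<exists>z. h1 (g z) \<noteq> c * h2 (g z)" for c
    using nonzero_entire_compose[OF nonzero_entire_diff_cmult[OF h(1,2) nc] g, of c]
    by (auto simp: nonzero_entire_def)
  obtain B1 c1 C1 where 1: "countable B1"
    "\<And>r. r \<ge> 1 \<Longrightarrow> r \<notin> B1 \<Longrightarrow> nevanlinna_T f r = circle_mean (log_max h1 h2) r - c1"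
    "\<And>r. r \<ge> 1 \<Longrightarrow> r \<notin> B1 \<Longrightarrow> ln r - C1 \<le> nevanlinna_T f r"
    "\<And>z. norm z \<notin> B1 \<Longrightarrow> h1 z \<noteq> 0 \<and> h2 z \<noteq> 0"
    by (rule quotient_rep_growth[OF rep nc]) (rule that; assumption)
  obtain B2 c2 C2 where 2: "countable B2"
    "\<And>r. r \<ge> 1 \<Longrightarrow> r \<notin> B2 \<Longrightarrow> nevanlinna_T (f \<circ> g) r =
       circle_mean (log_max (\<lambda>z. h1 (g z)) (\<lambda>z. h2 (g z))) r - c2"
    "\<And>r. r \<ge> 1 \<Longrightarrow> r \<notin> B2 \<Longrightarrow> ln r - C2 \<le> nevanlinna_T (f \<circ> g) r"
    "\<And>z. norm z \<notin> B2 \<Longrightarrow> h1 (g z) \<noteq> 0 \<and> h2 (g z) \<noteq> 0"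
    by (rule quotient_rep_growth[OF quotient_rep_compose[OF rep g] nc']) (rule that; assumption)
  obtain C where C: "\<And>r R. r > 0 \<Longrightarrow> (\<And>z. norm z \<le> r \<Longrightarrow> norm (g z) < R) \<Longrightarrow> 2 * norm (g 0) + 1 < R \<Longrightarrow>
           (\<And>z. norm z = R \<Longrightarrow> h1 z \<noteq> 0 \<and> h2 z \<noteq> 0) \<Longrightarrow>
           circle_mean (\<lambda>z. log_max h1 h2 (g z)) r \<le> 3 * circle_mean (log_max h1 h2) R + C"
    using circle_mean_log_max_comp_le[OF h g(1)] by blast
  define C' where "C' = max (C + 3 * c1 - c2) (max C1 C2)"
  have lm: "log_max (\<lambda>z. h1 (g z)) (\<lambda>z. h2 (g z)) = (\<lambda>z. log_max h1 h2 (g z))"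
    by (auto simp: log_max_def)
  show ?thesis
  proof (rule that[of "B1 \<union> B2" C'])
    fix r R assume r: "r \<ge> 1" "r \<notin> B1 \<union> B2" and R: "R \<notin> B1 \<union> B2"
      and gR: "\<forall>z. norm z \<le> r \<longrightarrow> norm (g z) < R" and R': "2 * norm (g 0) + 1 < R"
    have R1: "R \<ge> 1" using R' norm_ge_zero[of "g 0"] by linarith
    have "circle_mean (\<lambda>z. log_max h1 h2 (g z)) r \<le> 3 * circle_mean (log_max h1 h2) R + C"
      by (rule C) (use r gR R' R 1(4) in auto)
    hence "nevanlinna_T (f \<circ> g) r \<le> 3 * nevanlinna_T f R + (C + 3 * c1 - c2)"
      using 1(2)[of R] 2(2)[of r] r R R1 by (simp add: lm)
    thus "nevanlinna_T (f \<circ> g) r \<le> 3 * nevanlinna_T f R + C'" by (simp add: C'_def)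
  next
    fix r :: real assume "r \<ge> 1" "r \<notin> B1 \<union> B2"
    thus "ln r - C' \<le> nevanlinna_T (f \<circ> g) r" "ln r - C' \<le> nevanlinna_T f r"
      using 1(3)[of r] 2(3)[of r] by (auto simp: C'_def)
  qed (use 1 2 in auto)
qed

text \<open>For \<open>norm z \<le> s\<close> the Poisson kernel of the circle of radius
  \<open>2 * s\<close> is at most \<open>(2 * s + s) / (2 * s - s) = 3\<close>, the constant of case
  (iii).\<close>

lemma ln_norm_le_mean_ln_plus:
  assumes g: "nonzero_entire g" and s: "s > 0" and nz: "\<And>z. norm z = 2 * s \<Longrightarrow> g z \<noteq> 0"
    and z: "norm z \<le> s"
  shows "norm (g z) \<le> exp (3 * circle_mean (\<lambda>z. ln_plus (norm (g z))) (2 * s))"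
proof (cases "g z = 0")
  case False
  have cont: "continuous_on (sphere 0 (2 * s)) (\<lambda>z. ln_plus (norm (g z)))"
    unfolding ln_plus_def by (intro continuous_intros nonzero_entire_continuous g) (use nz in auto)
  have "ln (norm (g z)) \<le> circle_mean (\<lambda>w. ln (norm (g w)) * poisson_kernel (2 * s) z w) (2 * s)"
    by (rule ln_norm_le_poisson) (use False s z nz g in auto)
  also have "\<dots> \<le> circle_mean (\<lambda>w. 3 * ln_plus (norm (g w))) (2 * s)"
  proof (rule circle_mean_mono)
    fix w :: complex assume w: "norm w = 2 * s"
    have p0: "0 \<le> poisson_kernel (2 * s) z w" using z s by (intro poisson_kernel_nonneg) auto
    have "poisson_kernel (2 * s) z w \<le> (2 * s + norm z) / (2 * s - norm z)"
      using z s w by (intro poisson_kernel_le) auto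
    also have "\<dots> \<le> 3" using z s by (simp add: field_simps)
    finally have p3: "poisson_kernel (2 * s) z w \<le> 3" .
    have "ln (norm (g w)) * poisson_kernel (2 * s) z w \<le> ln_plus (norm (g w)) * poisson_kernel (2 * s) z w"
      using p0 by (intro mult_right_mono) (auto simp: ln_plus_def)
    also have "\<dots> \<le> ln_plus (norm (g w)) * 3"
      using p3 by (intro mult_left_mono) (auto simp: ln_plus_def)
    finally show "ln (norm (g w)) * poisson_kernel (2 * s) z w \<le> 3 * ln_plus (norm (g w))" by simp
  qed (use s z nz cont in \<open>auto intro!: continuous_on_mult continuous_on_poisson_kernel
                        continuous_on_ln_norm g continuous_on_const\<close>)
  finally have "ln (norm (g z)) \<le> 3 * circle_mean (\<lambda>z. ln_plus (norm (g z))) (2 * s)"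
    by (simp add: circle_mean_cmult)
  thus ?thesis using False by (metis exp_le_cancel_iff exp_ln zero_less_norm_iff)
qed auto

subsection \<open>Logarithmic derivatives\<close>

text \<open>Jordan's inequality from the concavity of sine, weakened by \<open>pi < 4\<close>, and
  applied to \<open>norm (cis x - 1) = 2 * \<bar>sin (x / 2)\<bar>\<close>.\<close>

lemma norm_cis_minus_one_ge:
  assumes "\<bar>x\<bar> \<le> pi"
  shows "\<bar>x\<bar> / 2 \<le> norm (cis x - 1)"
proof -
  define y where "y = \<bar>x\<bar> / 2"
  have y: "y \<in> {0..pi/2}" using assms by (auto simp: y_def)
  have conc: "concave_on {0..pi/2} sin"
    by (rule f''_le0_imp_concave[where f' = cos and f'' = "\<lambda>x. - sin x"])
       (auto intro!: derivative_eq_intros sin_ge_zero)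
  define t where "t = y / (pi / 2)"
  have t: "0 \<le> t" "t \<le> 1" using y by (auto simp: t_def field_simps)
  have "(1 - t) * sin 0 + t * sin (pi / 2) \<le> sin ((1 - t) *\<^sub>R 0 + t *\<^sub>R (pi / 2))"
    using t by (intro concave_onD[OF conc]) auto
  hence "y * (2 / pi) \<le> sin y" by (simp add: t_def)
  moreover have "y * (1 / 2) \<le> y * (2 / pi)"
    using y pi_less_4 by (intro mult_left_mono) (auto simp: field_simps)
  ultimately have "y / 2 \<le> sin y" by simp
  also have "sin y \<le> \<bar>sin (x / 2)\<bar>"
    by (cases "x \<ge> 0") (auto simp: y_def)
  finally have "\<bar>x\<bar> / 2 \<le> 2 * \<bar>sin (x / 2)\<bar>" by (simp add: y_def)
  also have "\<dots> = norm (cis x - 1)"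
    using dist_exp_i_1[of x] by (simp add: cis_conv_exp)
  finally show ?thesis .
qed

text \<open>Moving \<open>b\<close> radially onto the circle costs at most the distance to be
  estimated, hence a factor 2. Two angles compete because \<open>Arg\<close> takes values in
  \<open>(-pi, pi]\<close> while \<open>t\<close> runs through \<open>[0, 2 * pi]\<close>.\<close>

lemma norm_circle_diff_ge:
  assumes r: "0 \<le> r" and t: "t \<in> {0..2*pi}"
  shows "r / 4 * min \<bar>t - Arg b\<bar> \<bar>t - (Arg b + 2 * pi)\<bar> \<le> norm (of_real r * cis t - b)"
proof -
  define \<theta> where "\<theta> = Arg b"
  have th: "- pi < \<theta>" "\<theta> \<le> pi" unfolding \<theta>_def using Arg_bounded by auto
  have b: "b = of_real (norm b) * cis \<theta>" unfolding \<theta>_def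
    by (metis rcis_cmod_Arg rcis_def)
  have "norm (of_real r * cis t - of_real r * cis \<theta>)
      \<le> norm (of_real r * cis t - b) + norm (b - of_real r * cis \<theta>)"
    using dist_triangle[of "of_real r * cis t" "of_real r * cis \<theta>" b] by (simp add: dist_norm)
  also have "b - of_real r * cis \<theta> = of_real (norm b - r) * cis \<theta>"
    by (subst b) (simp add: algebra_simps)
  also have "norm \<dots> = \<bar>norm b - r\<bar>"
    by (simp only: norm_mult norm_of_real norm_cis mult_1_right)
  also have "\<dots> = \<bar>norm (of_real r * cis t) - norm b\<bar>"
    using r by (simp add: norm_mult abs_minus_commute)
  also have "\<dots> \<le> norm (of_real r * cis t - b)" by (rule norm_triangle_ineq3)
  finally have "norm (of_real r * cis t - of_real r * cis \<theta>) \<le> 2 * norm (of_real r * cis t - b)"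
    by simp
  moreover have "norm (of_real r * cis t - of_real r * cis \<theta>) = r * norm (cis (t - \<theta>) - 1)"
  proof -
    have "of_real r * cis t - of_real r * cis \<theta> = of_real r * cis \<theta> * (cis (t - \<theta>) - 1)"
      by (simp add: algebra_simps cis_mult flip: cis_divide)
    thus ?thesis using r by (simp add: norm_mult)
  qed
  moreover have "min \<bar>t - \<theta>\<bar> \<bar>t - (\<theta> + 2 * pi)\<bar> / 2 \<le> norm (cis (t - \<theta>) - 1)"
  proof (cases "t - \<theta> \<le> pi")
    case True
    hence "\<bar>t - \<theta>\<bar> / 2 \<le> norm (cis (t - \<theta>) - 1)"
      using t th by (intro norm_cis_minus_one_ge) auto
    thus ?thesis by simp
  next
    case False
    hence "\<bar>t - (\<theta> + 2 * pi)\<bar> / 2 \<le> norm (cis (t - (\<theta> + 2 * pi)) - 1)"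
      using t th by (intro norm_cis_minus_one_ge) auto
    also have "cis (t - (\<theta> + 2 * pi)) = cis (t - \<theta>)"
      by (simp flip: cis_divide cis_mult)
    finally show ?thesis by simp
  qed
  hence "r * (min \<bar>t - \<theta>\<bar> \<bar>t - (\<theta> + 2 * pi)\<bar> / 2) \<le> r * norm (cis (t - \<theta>) - 1)"
    using r by (rule mult_left_mono)
  ultimately show ?thesis unfolding \<theta>_def[symmetric] by simp
qed

text \<open>The real square root is an odd function here, so \<open>2 * sqrt (t - c)\<close> is an
  antiderivative on both sides of \<open>c\<close> and continuous across it.\<close>

lemma has_integral_inverse_sqrt_abs:
  fixes a b c :: real
  assumes "a \<le> b"
  shows "((\<lambda>t. 1 / sqrt \<bar>t - c\<bar>) has_integral (2 * sqrt (b - c) - 2 * sqrt (a - c))) {a..b}"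
proof (rule fundamental_theorem_of_calculus_interior_strong[where S = "{c}"])
  show "((\<lambda>t. 2 * sqrt (t - c)) has_vector_derivative 1 / sqrt \<bar>x - c\<bar>) (at x)"
    if "x \<in> {a<..<b} - {c}" for x
  proof -
    define D where "D = 1 / (2 * sqrt \<bar>x - c\<bar>)"
    have "(sqrt has_real_derivative D) (at (x - c))"
    proof (rule DERIV_real_sqrt_generic)
      show "D = inverse (sqrt (x - c)) / 2" if "x - c > 0"
        using that by (simp add: D_def field_simps)
      show "D = - inverse (sqrt (x - c)) / 2" if "x - c < 0"
        unfolding D_def abs_of_neg[OF that] real_sqrt_minus by (simp add: field_simps)
    qed (use that in auto)
    moreover have "((\<lambda>t. t - c) has_real_derivative 1) (at x)"
      by (auto intro!: derivative_eq_intros)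
    ultimately have "((\<lambda>t. sqrt (t - c)) has_real_derivative D * 1) (at x)"
      by (rule DERIV_chain2)
    hence "((\<lambda>t. 2 * sqrt (t - c)) has_real_derivative 2 * (D * 1)) (at x)"
      by (rule DERIV_cmult)
    also have "2 * (D * 1) = 1 / sqrt \<bar>x - c\<bar>"
      by (simp add: D_def)
    finally show ?thesis by (simp add: has_real_derivative_iff_has_vector_derivative)
  qed
qed (use assms in \<open>auto intro!: continuous_intros\<close>)

text \<open>The comparison function depends on \<open>b\<close> only through its angle and its
  singularities are integrable, so the bound does not deteriorate as \<open>b\<close> approaches the
  circle.\<close>

lemma circle_mean_inverse_sqrt_le:
  assumes r: "1 \<le> r" and b: "norm b \<noteq> r"
  shows "circle_mean (\<lambda>z. 1 / sqrt (norm (z - b))) r \<le> 32"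
proof -
  define \<theta> where "\<theta> = Arg b"
  have th: "- pi < \<theta>" "\<theta> \<le> pi" unfolding \<theta>_def using Arg_bounded by auto
  define f where "f t = 1 / sqrt (norm (of_real r * cis t - b))" for t
  \<comment> \<open>At the singular angles division by zero would spoil the majorant; there
    \<open>w\<close> takes the value of \<open>f\<close>, which leaves the integral
    unchanged.\<close>
  define w where "w t = (if t \<in> {\<theta>, \<theta> + 2 * pi} then f t else
     2 * (1 / sqrt \<bar>t - \<theta>\<bar> + 1 / sqrt \<bar>t - (\<theta> + 2 * pi)\<bar>))" for t
  define J where "J c = 2 * sqrt (2 * pi - c) - 2 * sqrt (0 - c)" for c
  \<comment> \<open>The arguments of the roots have size at most \<open>3 * pi < 16\<close>, so each
    root is at most 4 in absolute value.\<close>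
  have J: "J c \<le> 16" if "- pi \<le> c" "c \<le> 3 * pi" for c
  proof -
    have s: "\<bar>sqrt x\<bar> \<le> 4" if "\<bar>x\<bar> \<le> 3 * pi" for x
    proof -
      have "\<bar>sqrt x\<bar> = sqrt \<bar>x\<bar>" by (simp add: real_sqrt_abs')
      also have "\<dots> \<le> sqrt 16" using that pi_less_4 by (intro real_sqrt_le_mono) linarith
      finally show ?thesis by simp
    qed
    have "\<bar>sqrt (2 * pi - c)\<bar> \<le> 4" "\<bar>sqrt (0 - c)\<bar> \<le> 4"
      using that pi_gt_zero by (intro s; linarith)+
    thus ?thesis unfolding J_def by linarith
  qed
  have "((\<lambda>t. 2 * (1 / sqrt \<bar>t - \<theta>\<bar> + 1 / sqrt \<bar>t - (\<theta> + 2 * pi)\<bar>)) has_integral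
       2 * (J \<theta> + J (\<theta> + 2 * pi))) {0..2*pi}"
    unfolding J_def by (intro has_integral_mult_right has_integral_add has_integral_inverse_sqrt_abs) auto
  hence iw: "(w has_integral 2 * (J \<theta> + J (\<theta> + 2 * pi))) {0..2*pi}"
    by (rule has_integral_spike_finite[rotated 2, of _ _ _ "{\<theta>, \<theta> + 2 * pi}"]) (auto simp: w_def)
  have "f integrable_on {0..2*pi}"
    unfolding f_def
    by (intro integrable_continuous_real continuous_intros) (use b r in \<open>auto simp: norm_mult\<close>)
  hence "integral {0..2*pi} f \<le> integral {0..2*pi} w"
  proof (rule integral_le)
    show "w integrable_on {0..2*pi}" using iw by blast
    fix t assume t: "t \<in> {0..2*pi}"
    show "f t \<le> w t"
    proof (cases "t \<in> {\<theta>, \<theta> + 2 * pi}")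
      case False
      define m where "m = min \<bar>t - \<theta>\<bar> \<bar>t - (\<theta> + 2 * pi)\<bar>"
      have m: "m > 0" using False by (auto simp: m_def)
      have "1 / 4 * m \<le> r / 4 * m" using r m by (intro mult_right_mono) auto
      also have "\<dots> \<le> norm (of_real r * cis t - b)"
        unfolding m_def \<theta>_def by (rule norm_circle_diff_ge) (use r t in auto)
      finally have "m / 4 \<le> norm (of_real r * cis t - b)" by simp
      hence "sqrt (m / 4) \<le> sqrt (norm (of_real r * cis t - b))" by (rule real_sqrt_le_mono)
      moreover have "sqrt (m / 4) > 0" using m by simp
      ultimately have "f t \<le> 1 / sqrt (m / 4)"
        unfolding f_def by (intro divide_left_mono mult_pos_pos) auto
      also have "\<dots> = 2 * (1 / sqrt m)" by (simp add: real_sqrt_divide)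
      also have "1 / sqrt m \<le> 1 / sqrt \<bar>t - \<theta>\<bar> + 1 / sqrt \<bar>t - (\<theta> + 2 * pi)\<bar>"
        unfolding m_def min_def by auto
      finally show ?thesis using False by (simp add: w_def)
    qed (auto simp: w_def)
  qed
  also have "\<dots> = 2 * (J \<theta> + J (\<theta> + 2 * pi))" using iw by (rule integral_unique)
  also have "\<dots> \<le> 2 * (16 + 16)"
    using th J[of \<theta>] J[of "\<theta> + 2 * pi"] by auto
  finally have "integral {0..2*pi} f \<le> 64" by simp
  hence "circle_mean (\<lambda>z. 1 / sqrt (norm (z - b))) r \<le> 64 / (2 * pi)"
    unfolding circle_mean_def f_def by (intro divide_right_mono) auto
  also have "\<dots> \<le> 32" using pi_ge_two by (simp add: field_simps)
  finally show ?thesis .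
qed

text \<open>The map \<open>x / (2 * A - x)\<close> sends the half plane \<open>Re x < A\<close> into
  the unit disc and fixes 0, so Schwarz's lemma applies. On the disc of radius
  \<open>3 / 2 * r\<close> it gives \<open>norm (l w) \<le> 3 / 4 * (2 * A + norm (l w))\<close>,
  hence the bound \<open>6 * A\<close>; Cauchy's inequality with radius \<open>r / 2\<close> doubles
  this to \<open>12 * A / r\<close>.\<close>

lemma borel_caratheodory_deriv:
  assumes holo: "l holomorphic_on ball 0 (2 * r)" and r: "0 < r" and l0: "l 0 = 0"
    and A: "0 < A" "\<And>z. norm z < 2 * r \<Longrightarrow> Re (l z) < A" and z: "norm z = r"
  shows "norm (deriv l z) \<le> 12 * A / r"
proof -
  have ne: "2 * of_real A - l w \<noteq> 0" if "norm w < 2 * r" for w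
  proof
    assume "2 * of_real A - l w = 0"
    hence "Re (2 * of_real A - l w) = 0" by simp
    thus False using A(2)[OF that] A(1) by simp
  qed
  define \<phi> where "\<phi> w = l (of_real (2 * r) * w) / (2 * of_real A - l (of_real (2 * r) * w))" for w
  have sc: "norm (of_real (2 * r) * w) < 2 * r" if "norm w < 1" for w :: complex
    using that r by (simp add: norm_mult)
  have "\<phi> holomorphic_on ball 0 1"
  proof -
    have "(\<lambda>w. l (of_real (2 * r) * w)) holomorphic_on ball 0 1"
      by (rule holomorphic_on_compose_gen[unfolded o_def, OF _ holo])
         (use sc in \<open>auto intro!: holomorphic_intros simp del: of_real_mult\<close>)
    thus ?thesis unfolding \<phi>_def
      by (intro holomorphic_intros) (use sc ne in \<open>auto simp del: of_real_mult\<close>)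
  qed
  moreover have "\<phi> 0 = 0" by (simp add: \<phi>_def l0)
  moreover have "norm (\<phi> w) < 1" if w: "norm w < 1" for w
  proof -
    define x where "x = l (of_real (2 * r) * w)"
    have x: "Re x < A" unfolding x_def using A(2) sc[OF w] by blast
    have xne: "2 * of_real A - x \<noteq> 0" unfolding x_def using ne sc[OF w] by blast
    have "(norm (2 * of_real A - x))\<^sup>2 = (norm x)\<^sup>2 + 4 * A * (A - Re x)"
      unfolding cmod_power2 by (simp add: power2_eq_square algebra_simps)
    moreover have "4 * A * (A - Re x) > 0" using A(1) x by simp
    ultimately have "(norm x)\<^sup>2 < (norm (2 * of_real A - x))\<^sup>2" by linarith
    hence "norm x < norm (2 * of_real A - x)" by (rule power2_less_imp_less) auto
    thus ?thesis unfolding \<phi>_def x_def[symmetric] using xne by (simp add: norm_divide)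
  qed
  ultimately have schw: "norm (\<phi> w) \<le> norm w" if "norm w < 1" for w
    using Schwarz_Lemma(1) that by blast
  have bd: "norm (l w) \<le> 6 * A" if w: "norm w \<le> 3 / 2 * r" for w
  proof -
    define v where "v = w / of_real (2 * r)"
    have wv: "w = of_real (2 * r) * v" using r by (simp add: v_def)
    have nv: "norm v \<le> 3 / 4" using w r by (simp add: v_def norm_divide norm_mult field_simps)
    have "norm (\<phi> v) \<le> 3 / 4" using schw[of v] nv by linarith
    moreover have "2 * of_real A - l w \<noteq> 0" using ne[of w] w r by simp
    ultimately have "norm (l w) \<le> 3 / 4 * norm (2 * of_real A - l w)"
      unfolding \<phi>_def wv[symmetric] by (simp add: norm_divide field_simps)
    also have "norm (2 * of_real A - l w) \<le> 2 * A + norm (l w)"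
      using norm_triangle_ineq4[of "2 * of_real A" "l w"] A(1) by (simp add: norm_mult)
    finally show ?thesis by simp
  qed
  have sub: "cball z (r / 2) \<subseteq> ball 0 (2 * r)"
  proof
    fix w assume "w \<in> cball z (r / 2)"
    hence "norm (w - z) \<le> r / 2" by (simp add: dist_norm norm_minus_commute)
    moreover have "norm w \<le> norm z + norm (w - z)" using norm_triangle_sub by blast
    ultimately show "w \<in> ball 0 (2 * r)" using z r by simp
  qed
  have "norm ((deriv ^^ 1) l z) \<le> fact 1 * (6 * A) / (r / 2) ^ 1"
  proof (rule Cauchy_inequality)
    show "l holomorphic_on ball z (r / 2)"
      using holo by (rule holomorphic_on_subset) (use sub ball_subset_cball in blast)
    show "continuous_on (cball z (r / 2)) l"
      by (rule holomorphic_on_imp_continuous_on[OF holomorphic_on_subset[OF holo sub]])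
    fix x assume "norm (z - x) = r / 2"
    hence "norm x \<le> 3 / 2 * r"
      using z norm_triangle_ineq4[of z "z - x"] by simp
    thus "norm (l x) \<le> 6 * A" by (rule bd)
  qed (use r in auto)
  thus ?thesis by simp
qed

text \<open>Derivatives are written as value times logarithmic derivative, so that the latter add
  under products without any division.\<close>

lemma has_logderiv_mult:
  assumes "(f has_field_derivative f z * a) (at z)" "(g has_field_derivative g z * b) (at z)"
  shows "((\<lambda>w. f w * g w) has_field_derivative (f z * g z) * (a + b)) (at z)"
  by (rule DERIV_cong[OF DERIV_mult[OF assms]]) (simp add: algebra_simps)

lemma has_logderiv_power_linear:
  assumes "z \<noteq> b"
  shows "((\<lambda>w. (w - b) ^ n) has_field_derivative (z - b) ^ n * (of_nat n / (z - b))) (at (z :: complex))"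
proof -
  have "((\<lambda>w. (w - b) ^ n) has_field_derivative of_nat n * (z - b) ^ (n - 1)) (at z)"
    by (auto intro!: derivative_eq_intros)
  also have "of_nat n * (z - b) ^ (n - 1) = (z - b) ^ n * (of_nat n / (z - b))"
    using assms by (cases n) auto
  finally show ?thesis .
qed

lemma has_logderiv_prod:
  assumes "finite Z" "\<And>b. b \<in> Z \<Longrightarrow> z \<noteq> b"
  shows "((\<lambda>w. \<Prod>b\<in>Z. (w - b) ^ m b) has_field_derivative
     (\<Prod>b\<in>Z. (z - b) ^ m b) * (\<Sum>b\<in>Z. of_nat (m b) / (z - b))) (at (z :: complex))"
  using assms
proof (induction Z)
  case (insert a Z)
  have "((\<lambda>w. (w - a) ^ m a * (\<Prod>b\<in>Z. (w - b) ^ m b)) has_field_derivative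
     ((z - a) ^ m a * (\<Prod>b\<in>Z. (z - b) ^ m b)) * (of_nat (m a) / (z - a) + (\<Sum>b\<in>Z. of_nat (m b) / (z - b)))) (at z)"
    by (rule has_logderiv_mult[OF has_logderiv_power_linear insert.IH]) (use insert in auto)
  thus ?case using insert by simp
qed auto

lemma sqrt_add_le: "0 \<le> x \<Longrightarrow> 0 \<le> y \<Longrightarrow> sqrt (x + y) \<le> sqrt x + sqrt y"
  by (rule real_le_lsqrt) (auto simp: power2_sum)

lemma sqrt_sum_le:
  assumes "finite Z" "\<And>b. b \<in> Z \<Longrightarrow> 0 \<le> f b"
  shows "sqrt (\<Sum>b\<in>Z. f b) \<le> (\<Sum>b\<in>Z. sqrt (f b))"
  using assms
proof (induction Z)
  case (insert a Z)
  have "sqrt (f a + (\<Sum>b\<in>Z. f b)) \<le> sqrt (f a) + sqrt (\<Sum>b\<in>Z. f b)"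
    using insert by (intro sqrt_add_le sum_nonneg) auto
  thus ?case using insert by fastforce
qed auto

lemma holomorphic_bound_cball:
  assumes "k holomorphic_on UNIV" "0 < R" "\<And>z. norm z = R \<Longrightarrow> norm (k z) \<le> B" "norm z \<le> R"
  shows "norm (k z) \<le> B"
proof (rule maximum_modulus_frontier[of k "cball 0 R"])
  show "k holomorphic_on interior (cball 0 R)"
    using assms(1) holomorphic_on_subset by blast
  show "continuous_on (closure (cball 0 R)) k"
    using assms(1) holomorphic_on_imp_continuous_on continuous_on_subset by blast
  show "norm (k w) \<le> B" if "w \<in> frontier (cball 0 R)" for w
    using that assms(2,3) by (simp add: frontier_cball)
qed (use assms in auto)

text \<open>Concavity of the logarithm in the form of its tangent at \<open>1 + c\<close>; thus an
  upper bound \<open>c\<close> for the mean suffices.\<close>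

lemma jensen_log_mean:
  assumes Y: "continuous_on (sphere 0 r) Y" "\<And>z. norm z = r \<Longrightarrow> 0 \<le> Y z" and r: "0 \<le> r"
    and c: "circle_mean Y r \<le> c" "0 \<le> c"
  shows "circle_mean (\<lambda>z. ln (1 + Y z)) r \<le> ln (1 + c)"
proof -
  have pos: "0 < 1 + c" using c by simp
  have "circle_mean (\<lambda>z. ln (1 + Y z)) r \<le> circle_mean (\<lambda>z. (ln (1 + c) + 1 / (1 + c) - 1) + 1 / (1 + c) * Y z) r"
  proof (rule circle_mean_mono)
    show "continuous_on (sphere 0 r) (\<lambda>z. ln (1 + Y z))"
      by (intro continuous_intros Y) (use Y(2) in \<open>force simp: add_eq_0_iff\<close>)
    show "continuous_on (sphere 0 r) (\<lambda>z. (ln (1 + c) + 1 / (1 + c) - 1) + 1 / (1 + c) * Y z)"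
      by (intro continuous_intros Y(1))
    fix z :: complex assume z: "norm z = r"
    have "ln ((1 + Y z) / (1 + c)) \<le> (1 + Y z) / (1 + c) - 1"
      using Y(2)[OF z] pos by (intro ln_le_minus_one divide_pos_pos) auto
    moreover have "ln ((1 + Y z) / (1 + c)) = ln (1 + Y z) - ln (1 + c)"
      using Y(2)[OF z] pos by (intro ln_divide_pos) auto
    ultimately show "ln (1 + Y z) \<le> (ln (1 + c) + 1 / (1 + c) - 1) + 1 / (1 + c) * Y z"
      by (simp add: add_divide_distrib)
  qed (use r in auto)
  also have "\<dots> = (ln (1 + c) + 1 / (1 + c) - 1) + circle_mean (\<lambda>z. 1 / (1 + c) * Y z) r"
  proof (subst circle_mean_add)
    show "continuous_on (sphere 0 r) (\<lambda>z. 1 / (1 + c) * Y z)"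
      by (intro continuous_intros Y(1))
  qed (use r in auto)
  also have "circle_mean (\<lambda>z. 1 / (1 + c) * Y z) r = 1 / (1 + c) * circle_mean Y r"
    by (rule circle_mean_cmult)
  also have "1 / (1 + c) * circle_mean Y r \<le> 1 / (1 + c) * c"
    using c pos by (intro mult_left_mono) auto
  also have "(ln (1 + c) + 1 / (1 + c) - 1) + 1 / (1 + c) * c = ln (1 + c)"
  proof -
    have "1 / (1 + c) + 1 / (1 + c) * c = (1 + c) / (1 + c)"
      by (simp only: add_divide_distrib times_divide_eq_left mult_1_left)
    also have "\<dots> = 1" using pos by simp
    finally show ?thesis by simp
  qed
  finally show ?thesis by simp
qed

lemma ln_plus_le_sqrt:
  assumes "0 \<le> x"
  shows "ln_plus x \<le> 2 * ln (1 + sqrt x)"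
proof -
  have "ln_plus x = ln (max 1 x)" using assms by (rule ln_plus_eq)
  also have "\<dots> \<le> ln ((1 + sqrt x)\<^sup>2)"
  proof (rule ln_mono)
    have "(1 + sqrt x)\<^sup>2 = 1 + x + 2 * sqrt x" using assms by (simp add: power2_sum)
    thus "max 1 x \<le> (1 + sqrt x)\<^sup>2" using assms by simp
  qed auto
  also have "\<dots> = 2 * ln (1 + sqrt x)" by (simp add: ln_realpow)
  finally show ?thesis .
qed

lemma continuous_on_ln_plus:
  assumes "continuous_on A u" "\<And>z. z \<in> A \<Longrightarrow> 0 \<le> u z"
  shows "continuous_on A (\<lambda>z. ln_plus (u z))"
proof -
  have "continuous_on A (\<lambda>z. ln (max 1 (u z)))"
    by (intro continuous_intros assms(1)) auto
  thus ?thesis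
    by (rule continuous_on_eq) (simp add: ln_plus_eq assms(2))
qed

text \<open>The zeros of size at most \<open>2 * r\<close> are split off as a polynomial; comparing with the modulus on
  the circle of radius \<open>6 * r\<close> bounds both their number and the real part of the logarithm of the
  zero-free cofactor.\<close>

lemma zero_free_factorization_bound:
  assumes q: "nonzero_entire q" "q 0 \<noteq> 0" and r: "0 < r"
    and bound: "\<And>z. norm z = 6 * r \<Longrightarrow> norm (q z) \<le> M"
  obtains Z m l where "finite Z" "\<And>b. b \<in> Z \<Longrightarrow> q b = 0" "l holomorphic_on ball 0 (2 * r)" "l 0 = 0"
    "\<And>z. norm z < 2 * r \<Longrightarrow> q z = (\<Prod>b\<in>Z. (z - b) ^ m b) * exp (l z) * (q 0 / (\<Prod>b\<in>Z. (0 - b) ^ m b))"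
    "\<And>z. norm z < 2 * r \<Longrightarrow> Re (l z) \<le> ln M - ln (norm (q 0))"
    "real (\<Sum>b\<in>Z. m b) \<le> 2 * (ln M - ln (norm (q 0)))"
proof -
  define Z where "Z = {b. norm b \<le> 2 * r \<and> q b = 0}"
  have fin: "finite Z" unfolding Z_def by (rule finite_zeros_cball[OF q(1)])
  define m where "m b = nat (zorder q b)" for b
  define n where "n = (\<Sum>b\<in>Z. m b)"
  obtain k where k: "nonzero_entire k" "\<And>z. q z = (\<Prod>b\<in>Z. (z - b) ^ nat (zorder q b)) * k z"
    "\<And>b. b \<in> Z \<Longrightarrow> k b \<noteq> 0"
    using entire_factor_zeros[OF q(1) fin] by blast
  have k2: "q z = (\<Prod>b\<in>Z. (z - b) ^ m b) * k z" for z unfolding m_def by (rule k(2))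
  have knz: "k z \<noteq> 0" if "norm z \<le> 2 * r" for z
  proof
    assume "k z = 0"
    hence "z \<in> Z" using that k(2)[of z] by (auto simp: Z_def)
    thus False using k(3) \<open>k z = 0\<close> by blast
  qed
  have "of_real (6 * r) \<in> {z :: complex. norm z = 6 * r}" using r by simp
  hence M0: "0 \<le> M" using bound[of "of_real (6 * r)"] norm_ge_zero order_trans by blast
  \<comment> \<open>On the circle of radius \<open>6 * r\<close> each factor is at least
    \<open>4 * r\<close>, at the origin at most \<open>2 * r\<close>. Every zero therefore gains a
    factor 2 in \<open>k z / k 0\<close>, whence \<open>2 ^ n \<le> B\<close> below.\<close>
  have kM: "norm (k z) \<le> M / (4 * r) ^ n" if "norm z \<le> 6 * r" for z
  proof (rule holomorphic_bound_cball[OF nonzero_entire_holomorphic[OF k(1)] _ _ that])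
    fix z :: complex assume z: "norm z = 6 * r"
    have "(4 * r) ^ n = (\<Prod>b\<in>Z. (4 * r) ^ m b)" by (simp add: n_def power_sum)
    also have "\<dots> \<le> (\<Prod>b\<in>Z. norm (z - b) ^ m b)"
    proof (intro prod_mono conjI power_mono)
      fix b assume "b \<in> Z"
      thus "4 * r \<le> norm (z - b)" using z norm_triangle_ineq2[of z b] by (simp add: Z_def)
    qed (use r in auto)
    finally have "(4 * r) ^ n * norm (k z) \<le> (\<Prod>b\<in>Z. norm (z - b) ^ m b) * norm (k z)"
      by (intro mult_right_mono) auto
    also have "\<dots> = norm (q z)" by (simp add: k2 norm_mult prod_norm[symmetric] norm_power)
    also have "\<dots> \<le> M" by (rule bound[OF z])
    finally show "norm (k z) \<le> M / (4 * r) ^ n" using r by (simp add: field_simps)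
  qed (use r in auto)
  have k0: "norm (q 0) \<le> (2 * r) ^ n * norm (k 0)"
  proof -
    have "(\<Prod>b\<in>Z. norm (0 - b) ^ m b) \<le> (\<Prod>b\<in>Z. (2 * r) ^ m b)"
      by (intro prod_mono conjI power_mono) (auto simp: Z_def)
    also have "\<dots> = (2 * r) ^ n" by (simp add: n_def power_sum)
    finally have "(\<Prod>b\<in>Z. norm (0 - b) ^ m b) * norm (k 0) \<le> (2 * r) ^ n * norm (k 0)"
      by (intro mult_right_mono) auto
    thus ?thesis by (simp add: k2 norm_mult prod_norm[symmetric] norm_power del: diff_0)
  qed
  define B where "B = M / norm (q 0)"
  have q0: "norm (q 0) > 0" using q by simp
  have quot: "norm (k z) / norm (k 0) \<le> B / 2 ^ n" if "norm z \<le> 6 * r" for z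
  proof -
    have k0p: "norm (k 0) > 0" using knz[of 0] r by simp
    have "norm (k z) * norm (q 0) \<le> M / (4 * r) ^ n * ((2 * r) ^ n * norm (k 0))"
      using kM[OF that] k0 M0 r by (intro mult_mono) auto
    also have "\<dots> = M / 2 ^ n * norm (k 0)"
    proof -
      have "(4 * r) ^ n = (2 * (2 * r)) ^ n" by simp
      hence "(4 * r) ^ n = 2 ^ n * (2 * r) ^ n" by (simp only: power_mult_distrib)
      thus ?thesis using r by simp
    qed
    finally show ?thesis using q0 k0p by (simp add: B_def field_simps)
  qed
  have n2: "2 ^ n \<le> B"
    using quot[of 0] knz[of 0] r by (simp add: field_simps)
  hence B1: "1 \<le> B" using one_le_power[of "2::real" n] by linarith
  hence Mp: "M > 0" using q0 M0 by (cases "M = 0") (auto simp: B_def)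
  have lnB: "ln B = ln M - ln (norm (q 0))" unfolding B_def by (rule ln_divide_pos[OF Mp q0])
  have nB: "real n \<le> 2 * ln B"
  proof -
    have "ln (2 ^ n) \<le> ln B" using n2 by (intro ln_mono) auto
    hence "real n * ln 2 \<le> ln B" by (simp add: ln_realpow)
    moreover have "real n * (1 / 2) \<le> real n * ln 2" using ln2_ge_two_thirds by (intro mult_left_mono) auto
    ultimately show ?thesis by simp
  qed
  obtain L where L: "L holomorphic_on ball 0 (2 * r)" "\<And>z. norm z < 2 * r \<Longrightarrow> k z = exp (L z)"
    by (rule holomorphic_log_ball[of k "2 * r"])
       (use nonzero_entire_holomorphic[OF k(1)] knz less_imp_le in blast)+
  \<comment> \<open>Normalised to vanish at 0, as the estimate of its derivative demands.\<close>
  define l where "l z = L z - L 0" for z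
  have l: "exp (l z) = k z / k 0" if "norm z < 2 * r" for z
    using L(2)[OF that] L(2)[of 0] r by (simp add: l_def exp_diff)
  show ?thesis
  proof (rule that[of Z l m])
    show "l holomorphic_on ball 0 (2 * r)" unfolding l_def by (intro holomorphic_intros L)
    show "q z = (\<Prod>b\<in>Z. (z - b) ^ m b) * exp (l z) * (q 0 / (\<Prod>b\<in>Z. (0 - b) ^ m b))"
      if "norm z < 2 * r" for z
    proof -
      have "(\<Prod>b\<in>Z. (0 - b) ^ m b) \<noteq> 0" using k2[of 0] q(2) by auto
      hence "q 0 / (\<Prod>b\<in>Z. (0 - b) ^ m b) = k 0" by (subst k2) simp
      thus ?thesis using l[OF that] knz[of 0] r by (subst k2) simp
    qed
    show "Re (l z) \<le> ln M - ln (norm (q 0))" if "norm z < 2 * r" for z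
    proof -
      have "exp (Re (l z)) = norm (k z) / norm (k 0)"
        using l[OF that] by (metis norm_divide norm_exp_eq_Re)
      also have "\<dots> \<le> B / 2 ^ n" using that r by (intro quot) auto
      also have "\<dots> \<le> B" using B1 by (simp add: field_simps)
      also have "\<dots> = exp (ln B)" using B1 by simp
      finally show ?thesis using lnB by simp
    qed
    show "real (\<Sum>b\<in>Z. m b) \<le> 2 * (ln M - ln (norm (q 0)))" using nB lnB by (simp add: n_def)
  qed (use fin in \<open>auto simp: Z_def l_def\<close>)
qed

text \<open>Taking square roots before averaging makes the simple poles of the logarithmic derivative
  integrable on the circle, uniformly in their position.\<close>

theorem logarithmic_derivative:
  assumes F: "nonzero_entire F"
  shows "\<exists>K\<ge>1. \<forall>r\<ge>1. \<forall>M\<ge>1. (\<forall>z. norm z = r \<longrightarrow> F z \<noteq> 0) \<longrightarrow> (\<forall>z. norm z \<le> 6 * r \<longrightarrow> norm (F z) \<le> M) \<longrightarrow>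
           circle_mean (\<lambda>z. ln_plus (norm (deriv F z / F z))) r \<le> 2 * ln (K * (1 + ln M))"
proof -
  define p where "p = nat (zorder F 0)"
  obtain q where q: "nonzero_entire q" "\<And>z. F z = (z - 0) ^ p * q z" "q 0 \<noteq> 0"
    using entire_factor_zero[OF F, of 0] unfolding p_def by blast
  \<comment> \<open>The zero at the origin contributes \<open>p + 1\<close>, the other zeros
    \<open>64 = 32 * 2\<close> (a mean of 32 each, at most \<open>2 * A\<close> of them), the
    zero-free factor 12.\<close>
  define K1 where "K1 = real p + 1 + 64 + 12"
  define K where "K = 1 + K1 * (2 + \<bar>ln (norm (q 0))\<bar>)"
  have K1: "K1 \<ge> 1" by (simp add: K1_def)
  hence K: "K \<ge> 1" by (simp add: K_def)
  have "circle_mean (\<lambda>z. ln_plus (norm (deriv F z / F z))) r \<le> 2 * ln (K * (1 + ln M))"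
    if r: "r \<ge> 1" and M: "M \<ge> 1" and nz: "\<And>z. norm z = r \<Longrightarrow> F z \<noteq> 0"
      and bound: "\<And>z. norm z \<le> 6 * r \<Longrightarrow> norm (F z) \<le> M" for r M
  proof -
    have r0: "r > 0" using r by simp
    have qM: "norm (q z) \<le> M" if z: "norm z = 6 * r" for z
    proof -
      have "1 * norm (q z) \<le> (6 * r) ^ p * norm (q z)"
        using r by (intro mult_right_mono one_le_power) auto
      also have "\<dots> = norm (F z)" using z by (simp add: q(2) norm_mult norm_power)
      also have "\<dots> \<le> M" using z by (intro bound) auto
      finally show ?thesis by simp
    qed
    obtain Z m l where Zl: "finite Z" "\<And>b. b \<in> Z \<Longrightarrow> q b = 0" "l holomorphic_on ball 0 (2 * r)" "l 0 = 0"
      "\<And>z. norm z < 2 * r \<Longrightarrow> q z = (\<Prod>b\<in>Z. (z - b) ^ m b) * exp (l z) * (q 0 / (\<Prod>b\<in>Z. (0 - b) ^ m b))"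
      "\<And>z. norm z < 2 * r \<Longrightarrow> Re (l z) \<le> ln M - ln (norm (q 0))"
      "real (\<Sum>b\<in>Z. m b) \<le> 2 * (ln M - ln (norm (q 0)))"
      by (rule zero_free_factorization_bound[OF q(1,3) r0 qM]) (assumption, (rule that; assumption))
    \<comment> \<open>The summand 1 makes \<open>Re (l z) < A\<close> strict; with
      \<open>l 0 = 0\<close> it also gives \<open>A \<ge> 1\<close>.\<close>
    define A where "A = ln M - ln (norm (q 0)) + 1"
    define c where "c = q 0 / (\<Prod>b\<in>Z. (0 - b) ^ m b)"
    have A: "A \<ge> 1" using Zl(6)[of 0] Zl(4) r0 by (simp add: A_def)
    have Znz: "norm b \<noteq> r" if "b \<in> Z" for b
      using Zl(2)[OF that] nz[of b] q(2)[of b] by auto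
    define D where "D z = of_nat p / z + ((\<Sum>b\<in>Z. of_nat (m b) / (z - b)) + deriv l z)" for z
    have D: "deriv F z / F z = D z" if z: "norm z = r" for z
    proof -
      have z0: "z \<noteq> 0" using z r by auto
      have dl: "(l has_field_derivative deriv l z) (at z)"
        using z r by (intro holomorphic_derivI[OF Zl(3)]) auto
      have 1: "((\<lambda>w. exp (l w)) has_field_derivative exp (l z) * deriv l z) (at z)"
        by (auto intro!: derivative_eq_intros dl)
      have 2: "((\<lambda>w. (\<Prod>b\<in>Z. (w - b) ^ m b) * exp (l w)) has_field_derivative
          ((\<Prod>b\<in>Z. (z - b) ^ m b) * exp (l z)) * ((\<Sum>b\<in>Z. of_nat (m b) / (z - b)) + deriv l z)) (at z)"
        by (rule has_logderiv_mult[OF has_logderiv_prod 1]) (use Zl(1) Znz z in auto)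
      have 3: "((\<lambda>w. (w - 0) ^ p * ((\<Prod>b\<in>Z. (w - b) ^ m b) * exp (l w))) has_field_derivative
          ((z - 0) ^ p * ((\<Prod>b\<in>Z. (z - b) ^ m b) * exp (l z))) *
            (of_nat p / (z - 0) + ((\<Sum>b\<in>Z. of_nat (m b) / (z - b)) + deriv l z))) (at z)"
        by (rule has_logderiv_mult[OF has_logderiv_power_linear 2]) (use z0 in auto)
      have Feq: "F w = c * ((w - 0) ^ p * ((\<Prod>b\<in>Z. (w - b) ^ m b) * exp (l w)))" if "norm w < 2 * r" for w
        unfolding q(2) Zl(5)[OF that] c_def by (simp add: mult_ac)
      have "(F has_field_derivative c * (((z - 0) ^ p * ((\<Prod>b\<in>Z. (z - b) ^ m b) * exp (l z))) *
            (of_nat p / (z - 0) + ((\<Sum>b\<in>Z. of_nat (m b) / (z - b)) + deriv l z)))) (at z)"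
        by (rule has_field_derivative_transform_within_open[OF DERIV_cmult[OF 3], of "ball 0 (2 * r)"])
           (use z r Feq in auto)
      hence "deriv F z = c * (((z - 0) ^ p * ((\<Prod>b\<in>Z. (z - b) ^ m b) * exp (l z))) *
            (of_nat p / (z - 0) + ((\<Sum>b\<in>Z. of_nat (m b) / (z - b)) + deriv l z)))"
        by (rule DERIV_imp_deriv)
      also have "\<dots> = F z * D z" using Feq[of z] z r by (simp add: D_def mult_ac)
      finally show ?thesis using nz[OF z] by simp
    qed
    \<comment> \<open>A majorant of \<open>sqrt (norm (D z))\<close>: the root is subadditive, and
      \<open>sqrt x \<le> x\<close> both for natural numbers and for \<open>12 * A\<close>.\<close>
    define Y where "Y z = real p + (\<Sum>b\<in>Z. real (m b) * (1 / sqrt (norm (z - b)))) + 12 * A" for z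
    have contY: "continuous_on (sphere 0 r) Y"
      unfolding Y_def by (intro continuous_intros) (use Znz in auto)
    have Y0: "Y z \<ge> 0" for z
      unfolding Y_def using A by (intro add_nonneg_nonneg sum_nonneg) auto
    have DY: "sqrt (norm (D z)) \<le> Y z" if z: "norm z = r" for z
    proof -
      have nat_sqrt: "sqrt (real k) \<le> real k" for k
        by (rule real_le_lsqrt) (auto simp: power2_eq_square simp flip: of_nat_mult)
      have "norm (D z) \<le> norm (of_nat p / z) + (norm (\<Sum>b\<in>Z. of_nat (m b) / (z - b)) + norm (deriv l z))"
        unfolding D_def by (intro norm_triangle_le add_mono norm_triangle_ineq order_refl)
      also have "\<dots> \<le> real p + ((\<Sum>b\<in>Z. real (m b) / norm (z - b)) + 12 * A)"
      proof (intro add_mono)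
        have "real p * 1 \<le> real p * r" using r by (intro mult_left_mono) auto
        thus "norm (of_nat p / z) \<le> real p"
          using z r by (simp add: norm_divide divide_le_eq)
        show "norm (\<Sum>b\<in>Z. of_nat (m b) / (z - b)) \<le> (\<Sum>b\<in>Z. real (m b) / norm (z - b))"
          by (rule order_trans[OF norm_sum]) (simp add: norm_divide)
        have "Re (l w) < A" if "norm w < 2 * r" for w
          using Zl(6)[OF that] by (simp add: A_def)
        hence "norm (deriv l z) \<le> 12 * A / r"
          by (intro borel_caratheodory_deriv[OF Zl(3) r0 Zl(4)]) (use A z in auto)
        also have "\<dots> \<le> 12 * A" using A r by (simp add: field_simps)
        finally show "norm (deriv l z) \<le> 12 * A" .
      qed
      finally have "sqrt (norm (D z)) \<le> sqrt (real p + ((\<Sum>b\<in>Z. real (m b) / norm (z - b)) + 12 * A))"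
        by (rule real_sqrt_le_mono)
      also have "\<dots> \<le> sqrt (real p) + (sqrt (\<Sum>b\<in>Z. real (m b) / norm (z - b)) + sqrt (12 * A))"
        using A by (intro order_trans[OF sqrt_add_le] add_mono sqrt_add_le order_refl add_nonneg_nonneg sum_nonneg) auto
      also have "\<dots> \<le> real p + ((\<Sum>b\<in>Z. real (m b) * (1 / sqrt (norm (z - b)))) + 12 * A)"
      proof (intro add_mono nat_sqrt)
        have "sqrt (\<Sum>b\<in>Z. real (m b) / norm (z - b)) \<le> (\<Sum>b\<in>Z. sqrt (real (m b) / norm (z - b)))"
          using Zl(1) by (intro sqrt_sum_le) auto
        also have "\<dots> \<le> (\<Sum>b\<in>Z. real (m b) * (1 / sqrt (norm (z - b))))"
          by (intro sum_mono) (auto simp: real_sqrt_divide intro!: divide_right_mono nat_sqrt)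
        finally show "sqrt (\<Sum>b\<in>Z. real (m b) / norm (z - b)) \<le> (\<Sum>b\<in>Z. real (m b) * (1 / sqrt (norm (z - b))))" .
        have "12 * A * 1 \<le> 12 * A * (12 * A)" using A by (intro mult_left_mono) auto
        thus "sqrt (12 * A) \<le> 12 * A"
          using A by (intro real_le_lsqrt) (auto simp: power2_eq_square)
      qed
      finally show ?thesis by (simp add: Y_def)
    qed
    have contS: "continuous_on (sphere 0 r) (\<lambda>z. \<Sum>b\<in>Z. real (m b) * (1 / sqrt (norm (z - b))))"
      by (intro continuous_intros) (use Znz in auto)
    have "circle_mean Y r = real p + circle_mean (\<lambda>z. \<Sum>b\<in>Z. real (m b) * (1 / sqrt (norm (z - b)))) r + 12 * A"
      unfolding Y_def using r0 contS
      by (subst circle_mean_add) (auto intro!: continuous_intros contS, subst circle_mean_add, auto)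
    also have "circle_mean (\<lambda>z. \<Sum>b\<in>Z. real (m b) * (1 / sqrt (norm (z - b)))) r =
        (\<Sum>b\<in>Z. circle_mean (\<lambda>z. real (m b) * (1 / sqrt (norm (z - b)))) r)"
      by (rule circle_mean_sum) (use Zl(1) r0 Znz in \<open>auto intro!: continuous_intros\<close>)
    also have "\<dots> = (\<Sum>b\<in>Z. real (m b) * circle_mean (\<lambda>z. 1 / sqrt (norm (z - b))) r)"
      by (simp only: circle_mean_cmult)
    also have "\<dots> \<le> (\<Sum>b\<in>Z. real (m b) * 32)"
      by (intro sum_mono mult_left_mono circle_mean_inverse_sqrt_le r Znz) auto
    also have "\<dots> = 32 * real (\<Sum>b\<in>Z. m b)" by (simp add: mult.commute flip: sum_distrib_right)
    also have "\<dots> \<le> 32 * (2 * A)" using Zl(7) by (simp add: A_def)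
    finally have "circle_mean Y r \<le> real p + 64 * A + 12 * A" by simp
    also have "\<dots> \<le> (real p + 1) * A + 64 * A + 12 * A"
    proof -
      have "real p * 1 \<le> (real p + 1) * A" using A by (intro mult_mono) auto
      thus ?thesis by simp
    qed
    also have "\<dots> = K1 * A" by (simp add: K1_def algebra_simps)
    finally have meanY: "circle_mean Y r \<le> K1 * A" .
    have "circle_mean (\<lambda>z. ln_plus (norm (deriv F z / F z))) r \<le> circle_mean (\<lambda>z. 2 * ln (1 + Y z)) r"
    proof (rule circle_mean_mono)
      have "continuous_on (sphere 0 r) (\<lambda>z. deriv F z / F z)"
        using nz nonzero_entire_continuous[OF F]
          holomorphic_on_imp_continuous_on[OF holomorphic_deriv[OF nonzero_entire_holomorphic[OF F, of UNIV] open_UNIV]]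
        by (intro continuous_intros) (auto intro: continuous_on_subset)
      thus "continuous_on (sphere 0 r) (\<lambda>z. ln_plus (norm (deriv F z / F z)))"
        by (intro continuous_on_ln_plus continuous_on_norm) auto
      have "1 + Y z \<noteq> 0" for z using Y0[of z] by linarith
      thus "continuous_on (sphere 0 r) (\<lambda>z. 2 * ln (1 + Y z))"
        by (intro continuous_intros contY) auto
      fix z :: complex assume z: "norm z = r"
      have "ln_plus (norm (deriv F z / F z)) \<le> 2 * ln (1 + sqrt (norm (D z)))"
        unfolding D[OF z] by (rule ln_plus_le_sqrt) auto
      also have "\<dots> \<le> 2 * ln (1 + Y z)"
        using DY[OF z] by (intro mult_left_mono ln_mono add_left_mono) (auto simp: add_pos_nonneg)
      finally show "ln_plus (norm (deriv F z / F z)) \<le> 2 * ln (1 + Y z)" .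
    qed (use r in auto)
    also have "\<dots> = 2 * circle_mean (\<lambda>z. ln (1 + Y z)) r" by (rule circle_mean_cmult)
    also have "circle_mean (\<lambda>z. ln (1 + Y z)) r \<le> ln (1 + K1 * A)"
      by (rule jensen_log_mean[OF contY Y0 _ meanY]) (use r K1 A in auto)
    also have "ln (1 + K1 * A) \<le> ln (K * (1 + ln M))"
    proof (rule ln_mono)
      have lM: "ln M \<ge> 0" using M by simp
      define s where "s = \<bar>ln (norm (q 0))\<bar>"
      have "A \<le> ln M + s + 1" unfolding A_def s_def by linarith
      also have "\<dots> \<le> (2 + s) * (1 + ln M)" using lM by (simp add: s_def algebra_simps)
      finally have "K1 * A \<le> K1 * ((2 + s) * (1 + ln M))" using K1 by (intro mult_left_mono) auto
      thus "1 + K1 * A \<le> K * (1 + ln M)" using lM by (simp add: K_def s_def algebra_simps)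
      show "0 < 1 + K1 * A" using K1 A by (intro add_pos_nonneg) auto
    qed
    finally show ?thesis by simp
  qed
  with K show ?thesis by blast
qed

subsection \<open>Transcendental entire functions and differential polynomials\<close>

text \<open>Otherwise the Taylor series at 0 would terminate.\<close>

lemma transcendental_higher_deriv:
  assumes "transcendental_entire g"
  shows "\<exists>m\<ge>n. (deriv ^^ m) g 0 \<noteq> 0"
proof (rule ccontr)
  assume "\<not> (\<exists>m\<ge>n. (deriv ^^ m) g 0 \<noteq> 0)"
  hence z: "(deriv ^^ m) g 0 = 0" if "m \<ge> n" for m using that by blast
  have holo: "g holomorphic_on UNIV" and np: "\<not> (\<exists>P. \<forall>z. g z = poly P z)"
    using assms by (auto simp: transcendental_entire_def)
  define P where "P = (\<Sum>m<n. monom ((deriv ^^ m) g 0 / fact m) m)"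
  have "g w = poly P w" for w
  proof -
    have "(\<lambda>m. (deriv ^^ m) g 0 / fact m * (w - 0) ^ m) sums g w"
      by (rule holomorphic_power_series[of g 0 "norm w + 1"])
         (use holo in \<open>auto intro: holomorphic_on_subset\<close>)
    moreover have "(\<lambda>m. (deriv ^^ m) g 0 / fact m * (w - 0) ^ m) sums
        (\<Sum>m<n. (deriv ^^ m) g 0 / fact m * (w - 0) ^ m)"
      by (rule sums_finite) (use z in auto)
    ultimately have "g w = (\<Sum>m<n. (deriv ^^ m) g 0 / fact m * (w - 0) ^ m)"
      by (rule sums_unique2)
    thus ?thesis by (simp add: P_def poly_sum poly_monom)
  qed
  with np show False by blast
qed

lemma transcendental_nonzero_deriv:
  assumes "transcendental_entire g"
  shows "nonzero_entire ((deriv ^^ j) g)"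
proof -
  have holo: "(deriv ^^ j) g holomorphic_on UNIV"
    using assms by (intro holomorphic_higher_deriv) (auto simp: transcendental_entire_def)
  obtain m where m: "m \<ge> j" "(deriv ^^ m) g 0 \<noteq> 0"
    using transcendental_higher_deriv[OF assms] by blast
  have "\<exists>z. (deriv ^^ j) g z \<noteq> 0"
  proof (rule ccontr)
    assume "\<not> (\<exists>z. (deriv ^^ j) g z \<noteq> 0)"
    hence "(deriv ^^ j) g = (\<lambda>_. 0)" by auto
    moreover have "(deriv ^^ m) g = (deriv ^^ (m - j)) ((deriv ^^ j) g)"
      using m(1) by (metis comp_apply funpow_add le_add_diff_inverse2)
    ultimately have "(deriv ^^ m) g 0 = 0" by simp
    with m(2) show False by simp
  qed
  with holo show ?thesis by (simp add: nonzero_entire_def)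
qed

lemma transcendental_nonconstant:
  assumes "transcendental_entire g"
  shows "\<exists>z. g z \<noteq> g a"
proof (rule ccontr)
  assume "\<not> (\<exists>z. g z \<noteq> g a)"
  hence "g z = poly [:g a:] z" for z by simp
  thus False using assms unfolding transcendental_entire_def by blast
qed

lemma max_modulus_upper:
  assumes g: "g holomorphic_on UNIV" and r: "0 < r" "norm z \<le> r"
  shows "norm (g z) \<le> max_modulus g r"
proof (rule holomorphic_bound_cball[OF g r(1) _ r(2)])
  fix w :: complex assume w: "norm w = r"
  have "compact ((\<lambda>z. norm (g z)) ` sphere 0 r)"
    using g by (intro compact_continuous_image continuous_intros)
      (auto intro: holomorphic_on_imp_continuous_on holomorphic_on_subset)
  hence "bdd_above ((\<lambda>z. norm (g z)) ` sphere 0 r)"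
    by (intro bounded_imp_bdd_above compact_imp_bounded)
  thus "norm (g w) \<le> max_modulus g r"
    unfolding max_modulus_def using w by (intro cSUP_upper) auto
qed

lemma max_modulus_least:
  assumes "0 < r" "\<And>z. norm z = r \<Longrightarrow> norm (g z) \<le> B"
  shows "max_modulus g r \<le> B"
  unfolding max_modulus_def using assms by (intro cSUP_least) auto

lemma max_modulus_mono:
  assumes "g holomorphic_on UNIV" "0 < r" "r \<le> s"
  shows "max_modulus g r \<le> max_modulus g s"
proof (rule max_modulus_least)
  show "norm (g z) \<le> max_modulus g s" if "norm z = r" for z
    by (rule max_modulus_upper) (use assms that in auto)
qed (use assms in auto)

text \<open>Cauchy's inequality for a nonzero Taylor coefficient of degree above \<open>n\<close>;
  the spare power of \<open>r\<close> absorbs the coefficient.\<close>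

lemma max_modulus_growth:
  assumes "transcendental_entire g"
  shows "eventually (\<lambda>r. r ^ n \<le> max_modulus g r) at_top"
proof -
  have g: "g holomorphic_on UNIV" using assms by (simp add: transcendental_entire_def)
  obtain m where m: "m \<ge> Suc n" "(deriv ^^ m) g 0 \<noteq> 0"
    using transcendental_higher_deriv[OF assms] by blast
  define a where "a = norm ((deriv ^^ m) g 0) / fact m"
  have a: "a > 0" using m by (simp add: a_def)
  have "r ^ n \<le> max_modulus g r" if r: "r \<ge> max 1 (1 / a)" for r
  proof -
    have r1: "r \<ge> 1" "1 \<le> r * a" using r a by (auto simp: field_simps)
    have "norm ((deriv ^^ m) g 0) \<le> fact m * max_modulus g r / r ^ m"
      by (rule Cauchy_inequality)
         (use g r1 in \<open>auto intro: holomorphic_on_imp_continuous_on holomorphic_on_subset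
             intro!: max_modulus_upper[OF g]\<close>)
    hence le: "a * r ^ m \<le> max_modulus g r"
      using r1 by (simp add: a_def field_simps)
    have "r ^ n * 1 \<le> r ^ n * (r * a)" using r1 by (intro mult_left_mono) auto
    also have "\<dots> = a * r ^ Suc n" by simp
    also have "\<dots> \<le> a * r ^ m" using r1 m(1) a by (intro mult_left_mono power_increasing) auto
    finally show ?thesis using le by simp
  qed
  thus ?thesis unfolding eventually_at_top_linorder by blast
qed

lemma le_exp_ln_plus: "0 \<le> x \<Longrightarrow> x \<le> exp (ln_plus x)"
  by (simp add: ln_plus_eq)

text \<open>A pointwise bound, in which \<open>N\<close> adds up the degrees of all monomials. The
  bound \<open>1 \<le> A\<close> makes \<open>ln A\<close> nonnegative.\<close>

lemma norm_diff_polynomial_le: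
  assumes Q: "is_diff_polynomial g Q"
  shows "\<exists>k A N. 1 \<le> A \<and> (\<forall>z D. 0 \<le> D \<longrightarrow> (\<forall>j\<le>k. norm ((deriv ^^ j) g z) \<le> exp D) \<longrightarrow>
      norm (Q z) \<le> A * exp (real N * D))"
proof -
  from Q obtain s a k n where Qd: "Q = (\<lambda>z. \<Sum>i=1..(s::nat). a i * diff_monomial (k i) (n i) g z)"
    unfolding is_diff_polynomial_def by blast
  define K where "K = (\<Sum>i=1..s. k i)"
  define N where "N = (\<Sum>i=1..s. \<Sum>j\<le>k i. n i j)"
  define A where "A = 1 + (\<Sum>i=1..s. norm (a i))"
  have A: "1 \<le> A" by (simp add: A_def sum_nonneg)
  have "norm (Q z) \<le> A * exp (real N * D)"
    if D: "0 \<le> D" and d: "\<And>j. j \<le> K \<Longrightarrow> norm ((deriv ^^ j) g z) \<le> exp D" for z D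
  proof -
    have mono: "norm (diff_monomial (k i) (n i) g z) \<le> exp (real N * D)" if i: "i \<in> {1..s}" for i
    proof -
      have ki: "k i \<le> K" unfolding K_def using i by (intro member_le_sum) auto
      have "norm (diff_monomial (k i) (n i) g z) = (\<Prod>j\<le>k i. norm ((deriv ^^ j) g z) ^ n i j)"
        by (simp add: diff_monomial_def prod_norm[symmetric] norm_power)
      also have "\<dots> \<le> (\<Prod>j\<le>k i. exp D ^ n i j)"
        using d ki by (intro prod_mono conjI power_mono) auto
      also have "\<dots> = exp (real (\<Sum>j\<le>k i. n i j) * D)"
        by (simp only: power_sum[symmetric] exp_of_nat_mult)
      also have "\<dots> \<le> exp (real N * D)"
      proof -
        have "(\<Sum>j\<le>k i. n i j) \<le> N" unfolding N_def using i by (intro member_le_sum) auto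
        thus ?thesis using D by (simp add: mult_right_mono del: of_nat_sum)
      qed
      finally show ?thesis .
    qed
    have "norm (Q z) \<le> (\<Sum>i=1..s. norm (a i * diff_monomial (k i) (n i) g z))"
      unfolding Qd by (rule norm_sum)
    also have "\<dots> \<le> (\<Sum>i=1..s. norm (a i) * exp (real N * D))"
      unfolding norm_mult by (intro sum_mono mult_left_mono mono) auto
    also have "\<dots> = (\<Sum>i=1..s. norm (a i)) * exp (real N * D)" by (simp add: sum_distrib_right)
    also have "\<dots> \<le> A * exp (real N * D)" by (intro mult_right_mono) (auto simp: A_def)
    finally show ?thesis .
  qed
  with A show ?thesis by blast
qed

lemma nevanlinna_T_entire:
  assumes "G holomorphic_on UNIV"
  shows "nevanlinna_T G r = circle_mean (\<lambda>z. ln_plus (norm (G z))) r"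
proof -
  have "\<not> is_pole G z" for z
    using assms not_is_pole_holomorphic[OF open_UNIV UNIV_I] by blast
  hence "pole_count G t = 0" for t by (simp add: pole_count_def)
  thus ?thesis by (simp add: nevanlinna_T_def integrated_count_def proximity_eq_circle_mean)
qed

text \<open>Where \<open>norm (g z) < 1\<close>, the size of \<open>Q\<close> is controlled by logarithmic derivatives, and elsewhere
  \<open>norm (G z) \<ge> norm (g z) * norm (Q z)\<close>; the mean of \<open>ln (norm (Q z))\<close> is bounded below.\<close>

theorem nevanlinna_T_diff_polynomial_ge:
  assumes g: "transcendental_entire g" and Q: "is_diff_polynomial g Q" "Q z0 \<noteq> 0"
    and \<alpha>: "1 \<le> \<alpha>" and G: "G = (\<lambda>z. g z ^ \<alpha> * Q z)"
  obtains B C N where "countable B" "0 \<le> N"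
    "\<And>r M. 1 \<le> r \<Longrightarrow> r \<notin> B \<Longrightarrow> 1 \<le> M \<Longrightarrow> \<forall>z. norm z \<le> 7 * r \<longrightarrow> norm (g z) \<le> M \<Longrightarrow>
       circle_mean (\<lambda>z. ln_plus (norm (g z))) r - C - N * ln (1 + ln M) \<le> nevanlinna_T G r"
proof -
  have gh: "g holomorphic_on UNIV" using g by (simp add: transcendental_entire_def)
  note ne = transcendental_nonzero_deriv[OF g]
  obtain k A N where bd: "\<And>z D. 0 \<le> D \<Longrightarrow> (\<And>j. j \<le> k \<Longrightarrow> norm ((deriv ^^ j) g z) \<le> exp D) \<Longrightarrow>
      norm (Q z) \<le> A * exp (real N * D)" and A: "1 \<le> A"
    using norm_diff_polynomial_le[OF Q(1)] by metis
  have Qh: "Q holomorphic_on UNIV"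
    using Q(1) gh unfolding is_diff_polynomial_def diff_monomial_def
    by (auto intro!: holomorphic_intros)
  have Qne: "nonzero_entire Q" using Qh Q(2) by (auto simp: nonzero_entire_def)
  have Gh: "G holomorphic_on UNIV" unfolding G by (intro holomorphic_intros gh Qh)
  obtain C1 where C1: "\<And>r. r \<ge> 1 \<Longrightarrow> (\<And>z. norm z = r \<Longrightarrow> Q z \<noteq> 0) \<Longrightarrow>
           (if Q 0 = 0 then ln r else 0) - C1 \<le> circle_mean (\<lambda>z. ln (norm (Q z))) r"
    using circle_mean_ln_norm_ge[OF Qne] by blast
  \<comment> \<open>Naming the property allows one choice of constants \<open>K i\<close> for all
    \<open>i\<close> at once.\<close>
  define P where "P i K \<longleftrightarrow> (\<forall>r\<ge>1. \<forall>M\<ge>1. (\<forall>z. norm z = r \<longrightarrow> (deriv ^^ i) g z \<noteq> 0) \<longrightarrow>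
       (\<forall>z. norm z \<le> 6 * r \<longrightarrow> norm ((deriv ^^ i) g z) \<le> M) \<longrightarrow>
       circle_mean (\<lambda>z. ln_plus (norm (deriv ((deriv ^^ i) g) z / (deriv ^^ i) g z))) r \<le> 2 * ln (K * (1 + ln M)))"
    for i and K :: real
  have "\<exists>K. K \<ge> 1 \<and> P i K" for i
    unfolding P_def by (rule logarithmic_derivative[OF ne])
  then obtain K where K1: "\<And>i. K i \<ge> 1" and KP: "\<And>i. P i (K i)"
    by metis
  have K: "circle_mean (\<lambda>z. ln_plus (norm (deriv ((deriv ^^ i) g) z / (deriv ^^ i) g z))) r \<le> 2 * ln (K i * (1 + ln M))"
    if "r \<ge> 1" "M \<ge> 1" "\<And>z. norm z = r \<Longrightarrow> (deriv ^^ i) g z \<noteq> 0"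
       "\<And>z. norm z \<le> 6 * r \<Longrightarrow> norm ((deriv ^^ i) g z) \<le> M" for i r M
    using KP[of i] that unfolding P_def by simp
  \<comment> \<open>Takes up the factor \<open>fact i\<close> of Cauchy's inequality, by way of
    \<open>1 + x + y \<le> (1 + x) * (1 + y)\<close> for nonnegative \<open>x\<close> and
    \<open>y\<close>.\<close>
  define c where "c i = 2 * ln (K i * (1 + ln (fact i)))" for i
  define L where "L i z = ln_plus (norm ((deriv ^^ Suc i) g z / (deriv ^^ i) g z))" for i z
  define D where "D z = (\<Sum>i<k. L i z)" for z
  define B where "B = norm ` ({z. Q z = 0} \<union> (\<Union>i. {z. (deriv ^^ i) g z = 0}))"
  have cB: "countable B"
    unfolding B_def by (intro countable_image countable_Un countable_UN countable_zeros Qne ne) auto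
  define C where "C = C1 + ln A + real N * (\<Sum>i<k. c i)"
  show ?thesis
  proof (rule that[OF cB, of "real N * (2 * real k)" C])
    fix r M assume r: "1 \<le> r" "r \<notin> B" and M: "1 \<le> M" and gM: "\<forall>z. norm z \<le> 7 * r \<longrightarrow> norm (g z) \<le> M"
    have r0: "0 \<le> r" using r by simp
    have nz: "(deriv ^^ i) g z \<noteq> 0" "Q z \<noteq> 0" if "norm z = r" for z i
      using that r(2) by (auto simp: B_def)
    have g0: "g z \<noteq> 0" if "norm z = r" for z using nz(1)[OF that, of 0] by simp
    have contL: "continuous_on (sphere 0 r) (L i)" for i
      unfolding L_def using nz
      by (intro continuous_on_ln_plus continuous_intros nonzero_entire_continuous ne) auto
    have contD: "continuous_on (sphere 0 r) D"
      unfolding D_def[abs_def] by (intro continuous_intros contL)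
    have lM: "ln M \<ge> 0" using M by simp
    have meanL: "circle_mean (L i) r \<le> c i + 2 * ln (1 + ln M)" for i
    proof -
      have fi: "(1 :: real) \<le> fact i" by (rule fact_ge_1)
      have "circle_mean (L i) r \<le> 2 * ln (K i * (1 + ln (fact i * M)))"
        unfolding L_def funpow.simps o_apply
      proof (rule K)
        show "1 \<le> fact i * M" using mult_mono[OF fi M] by simp
        fix z :: complex assume z: "norm z \<le> 6 * r"
        \<comment> \<open>Unit discs around points of modulus at most \<open>6 * r\<close> stay
          within \<open>7 * r\<close>, since \<open>r \<ge> 1\<close>.\<close>
        have "norm ((deriv ^^ i) g z) \<le> fact i * M / 1 ^ i"
        proof (rule Cauchy_inequality)
          fix x assume "norm (z - x) = 1"
          hence "norm x \<le> norm z + 1" using norm_triangle_ineq4[of z "z - x"] by simp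
          thus "norm (g x) \<le> M" using z r gM by auto
        qed (use gh in \<open>auto intro: holomorphic_on_imp_continuous_on holomorphic_on_subset\<close>)
        thus "norm ((deriv ^^ i) g z) \<le> fact i * M" by simp
      qed (use r nz in auto)
      also have "ln (K i * (1 + ln (fact i * M))) \<le> ln (K i * (1 + ln (fact i)) * (1 + ln M))"
      proof (rule ln_mono)
        have "ln (fact i * M) = ln (fact i) + ln M" using M by (intro ln_mult_pos) auto
        moreover have "0 \<le> ln (fact i :: real)" using fi by simp
        ultimately have "1 + ln (fact i * M) \<le> (1 + ln (fact i)) * (1 + ln M)"
          using lM by (simp add: algebra_simps)
        thus "K i * (1 + ln (fact i * M)) \<le> K i * (1 + ln (fact i)) * (1 + ln M)"
          using K1[of i] unfolding mult.assoc by (intro mult_left_mono) auto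
        have "0 \<le> ln (fact i * M)" using mult_mono[OF fi M] by simp
        thus "0 < K i * (1 + ln (fact i * M))" using K1[of i] by (intro mult_pos_pos add_pos_nonneg) auto
      qed
      also have "\<dots> = ln (K i * (1 + ln (fact i))) + ln (1 + ln M)"
      proof (rule ln_mult_pos)
        have "0 \<le> ln (fact i :: real)" using fi by simp
        thus "0 < K i * (1 + ln (fact i))" using K1[of i] by (intro mult_pos_pos add_pos_nonneg) auto
      qed (use lM in auto)
      finally show ?thesis by (simp add: c_def)
    qed
    have meanD: "circle_mean D r \<le> (\<Sum>i<k. c i) + 2 * real k * ln (1 + ln M)"
    proof -
      have "circle_mean D r = (\<Sum>i<k. circle_mean (L i) r)"
        unfolding D_def[abs_def] by (rule circle_mean_sum) (use contL r0 in auto)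
      also have "\<dots> \<le> (\<Sum>i<k. c i + 2 * ln (1 + ln M))" by (intro sum_mono meanL)
      finally show ?thesis by (simp add: sum.distrib)
    qed
    have L0: "0 \<le> L i z" for i z by (simp add: L_def ln_plus_def)
    have D0: "0 \<le> D z" for z unfolding D_def by (intro sum_nonneg L0)
    have contQ: "continuous_on (sphere 0 r) (\<lambda>z. ln (norm (Q z)))"
      using nz by (intro continuous_on_ln_norm Qne) auto
    have contg: "continuous_on (sphere 0 r) (\<lambda>z. ln_plus (norm (g z)))"
      using gh by (intro continuous_on_ln_plus continuous_intros holomorphic_on_imp_continuous_on)
        (auto intro: holomorphic_on_subset)
    have contG: "continuous_on (sphere 0 r) (\<lambda>z. ln_plus (norm (G z)))"
      using Gh by (intro continuous_on_ln_plus continuous_intros holomorphic_on_imp_continuous_on)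
        (auto intro: holomorphic_on_subset)
    have "circle_mean (\<lambda>z. (ln (norm (Q z)) + ln_plus (norm (g z))) - (ln A + real N * D z)) r
        \<le> circle_mean (\<lambda>z. ln_plus (norm (G z))) r"
    proof (rule circle_mean_mono)
      show "continuous_on (sphere 0 r) (\<lambda>z. (ln (norm (Q z)) + ln_plus (norm (g z))) - (ln A + real N * D z))"
        by (intro continuous_intros contQ contg contD)
      fix z :: complex assume z: "norm z = r"
      have lnA: "0 \<le> ln A" using A by simp
      show "(ln (norm (Q z)) + ln_plus (norm (g z))) - (ln A + real N * D z) \<le> ln_plus (norm (G z))"
      proof (cases "norm (g z) \<ge> 1")
        case True
        have "1 * ln (norm (g z)) \<le> real \<alpha> * ln (norm (g z))"
          using True g0[OF z] \<alpha> by (intro mult_right_mono) auto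
        moreover have "ln (norm (G z)) = real \<alpha> * ln (norm (g z)) + ln (norm (Q z))"
          using g0[OF z] nz(2)[OF z] by (simp add: G norm_mult norm_power ln_mult ln_realpow)
        moreover have "ln_plus (norm (g z)) = ln (norm (g z))"
          using True g0[OF z] by (simp add: ln_plus_def)
        moreover have "ln (norm (G z)) \<le> ln_plus (norm (G z))" by (simp add: ln_plus_def)
        moreover have "0 \<le> real N * D z" using D0 by simp
        ultimately show ?thesis using lnA by simp
      next
        case False
        \<comment> \<open>Telescoping: the \<open>j\<close>-th derivative is \<open>g\<close> times
          \<open>j\<close> successive logarithmic derivatives, and \<open>norm (g z) < 1\<close> in
          this case.\<close>
        have dj: "norm ((deriv ^^ j) g z) \<le> exp (\<Sum>i<j. L i z)" for j
        proof (induction j)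
          case (Suc j)
          have "norm ((deriv ^^ Suc j) g z) = norm ((deriv ^^ j) g z) * norm ((deriv ^^ Suc j) g z / (deriv ^^ j) g z)"
            using nz(1)[OF z, of j] by (simp add: norm_divide)
          also have "\<dots> \<le> exp (\<Sum>i<j. L i z) * exp (L j z)"
            unfolding L_def by (intro mult_mono Suc[unfolded L_def] le_exp_ln_plus) auto
          finally show ?case by (simp add: exp_add)
        qed (use False in auto)
        have "norm ((deriv ^^ j) g z) \<le> exp (D z)" if "j \<le> k" for j
        proof -
          have "(\<Sum>i<j. L i z) \<le> D z" unfolding D_def using that L0 by (intro sum_mono2) auto
          thus ?thesis using dj[of j] by (meson exp_le_cancel_iff order_trans)
        qed
        hence "norm (Q z) \<le> A * exp (real N * D z)" by (intro bd D0)
        hence "ln (norm (Q z)) \<le> ln (A * exp (real N * D z))"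
          using nz(2)[OF z] by (intro ln_mono) auto
        also have "\<dots> = ln A + real N * D z" using A by (subst ln_mult_pos) auto
        finally have "ln (norm (Q z)) \<le> ln A + real N * D z" .
        moreover have "ln_plus (norm (g z)) = 0"
          using False g0[OF z] by (simp add: ln_plus_def)
        moreover have "0 \<le> ln_plus (norm (G z))" by (simp add: ln_plus_def)
        ultimately show ?thesis by simp
      qed
    qed (use r0 contG in auto)
    also have "circle_mean (\<lambda>z. (ln (norm (Q z)) + ln_plus (norm (g z))) - (ln A + real N * D z)) r
       = (circle_mean (\<lambda>z. ln (norm (Q z))) r + circle_mean (\<lambda>z. ln_plus (norm (g z))) r)
         - (ln A + real N * circle_mean D r)"
      using r0 contQ contg contD
      by (simp add: circle_mean_diff circle_mean_add circle_mean_cmult continuous_on_add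
            continuous_on_mult continuous_on_const)
    also have "circle_mean (\<lambda>z. ln_plus (norm (G z))) r = nevanlinna_T G r"
      by (rule nevanlinna_T_entire[OF Gh, symmetric])
    finally have 1: "(circle_mean (\<lambda>z. ln (norm (Q z))) r + circle_mean (\<lambda>z. ln_plus (norm (g z))) r)
         - (ln A + real N * circle_mean D r) \<le> nevanlinna_T G r" .
    have "0 \<le> (if Q 0 = 0 then ln r else 0)" using r by simp
    hence 2: "- C1 \<le> circle_mean (\<lambda>z. ln (norm (Q z))) r" using C1[of r] r nz(2) by fastforce
    have 3: "real N * circle_mean D r \<le> real N * ((\<Sum>i<k. c i) + 2 * real k * ln (1 + ln M))"
      by (intro mult_left_mono meanD) auto
    show "circle_mean (\<lambda>z. ln_plus (norm (g z))) r - C - real N * (2 * real k) * ln (1 + ln M) \<le> nevanlinna_T G r"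
      using 1 2 3 unfolding C_def by (simp add: algebra_simps)
  qed simp
qed

subsection \<open>Iterated logarithms\<close>

lemma iter_ln_0 [simp]: "iter_ln 0 x = x"
  by (simp add: iter_ln_def)

lemma iter_ln_Suc: "iter_ln (Suc k) x = ln (iter_ln k x)"
  by (simp add: iter_ln_def)

lemma iter_ln_0_right [simp]: "iter_ln k 0 = 0"
  by (induction k) (simp_all add: iter_ln_Suc)

lemma iter_ln_add: "iter_ln (a + b) x = iter_ln a (iter_ln b x)"
  by (simp add: iter_ln_def funpow_add)

lemma iter_ln_Suc': "iter_ln (Suc k) x = iter_ln k (ln x)"
  using iter_ln_add[of k 1 x] iter_ln_Suc[of 0 x] by simp

lemma iter_ln_at_top: "filterlim (iter_ln k) at_top at_top"
proof (induction k)
  case 0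
  show ?case by (simp add: iter_ln_def filterlim_ident)
next
  case (Suc k)
  show ?case using filterlim_compose[OF ln_at_top Suc] by (simp add: iter_ln_Suc[abs_def])
qed

lemma eventually_iter_ln_gt: "eventually (\<lambda>x. c < iter_ln k x) at_top"
  using iter_ln_at_top filterlim_at_top_dense by blast

lemma eventually_iter_ln_mono: "eventually (\<lambda>x. \<forall>y\<ge>x. iter_ln k x \<le> iter_ln k y) at_top"
proof (induction k)
  case (Suc k)
  show ?case using Suc eventually_iter_ln_gt[of 0 k]
    by eventually_elim (auto simp: iter_ln_Suc intro!: ln_mono)
qed auto

text \<open>The first logarithm turns the factor \<open>K\<close> into a summand, and each further
  one only shrinks that summand. With no logarithm at all the factor would remain.\<close>

lemma eventually_iter_ln_affine_le:
  assumes "0 < K" "0 \<le> C"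
  shows "\<exists>c\<ge>0. eventually (\<lambda>x. iter_ln (Suc j) (K * x + C) \<le> iter_ln (Suc j) x + c) at_top"
proof (induction j)
  case 0
  have "eventually (\<lambda>x. iter_ln (Suc 0) (K * x + C) \<le> iter_ln (Suc 0) x + \<bar>ln (K + C)\<bar>) at_top"
    using eventually_ge_at_top[of 1]
  proof eventually_elim
    case (elim x)
    have "C * 1 \<le> C * x" using elim assms by (intro mult_left_mono) auto
    moreover have "0 < K * x + C" using assms elim by (intro add_pos_nonneg mult_pos_pos) auto
    ultimately have "ln (K * x + C) \<le> ln ((K + C) * x)"
      by (intro ln_mono) (simp_all add: algebra_simps)
    also have "\<dots> = ln (K + C) + ln x" using assms elim by (intro ln_mult_pos) auto
    finally show ?case by (simp add: iter_ln_Suc)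
  qed
  thus ?case by (intro exI[of _ "\<bar>ln (K + C)\<bar>"]) auto
next
  case (Suc j)
  then obtain c where c: "c \<ge> 0" "eventually (\<lambda>x. iter_ln (Suc j) (K * x + C) \<le> iter_ln (Suc j) x + c) at_top"
    by blast
  have "filterlim (\<lambda>x. K * x + C) at_top at_top" using assms by real_asymp
  hence pos: "eventually (\<lambda>x. 0 < iter_ln (Suc j) (K * x + C)) at_top"
    by (rule eventually_compose_filterlim[OF eventually_iter_ln_gt])
  have "eventually (\<lambda>x. iter_ln (Suc (Suc j)) (K * x + C) \<le> iter_ln (Suc (Suc j)) x + c) at_top"
    using c(2) pos eventually_iter_ln_gt[of 1 "Suc j"]
  proof eventually_elim
    case (elim x)
    define a where "a = iter_ln (Suc j) (K * x + C)"
    define b where "b = iter_ln (Suc j) x"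
    have ab: "a \<le> b + c" "0 < a" "1 < b" using elim by (auto simp: a_def b_def)
    have "b * (1 + c / b) = b + c" using ab by (simp add: field_simps)
    hence "ln a \<le> ln (b * (1 + c / b))" using ab by (intro ln_mono) auto
    also have "\<dots> = ln b + ln (1 + c / b)" using ab c(1) by (intro ln_mult_pos add_pos_nonneg) auto
    also have "ln (1 + c / b) \<le> c / b" using ab c(1) by (intro ln_add_one_self_le_self) auto
    also have "c / b \<le> c" using divide_left_mono[of 1 b c] ab c(1) by simp
    finally show ?case by (simp add: iter_ln_Suc[of "Suc j"] a_def b_def)
  qed
  with c(1) show ?case by blast
qed

lemma eventually_iter_ln_cmult_ge:
  assumes "0 < K"
  shows "\<exists>c\<ge>0. eventually (\<lambda>x. iter_ln (Suc j) x - c \<le> iter_ln (Suc j) (K * x)) at_top"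
proof -
  have "0 < 1 / K" using assms by simp
  then obtain c where c: "c \<ge> 0" "eventually (\<lambda>x. iter_ln (Suc j) (1 / K * x + 0) \<le> iter_ln (Suc j) x + c) at_top"
    using eventually_iter_ln_affine_le[of "1 / K" 0 j] by blast
  have "filterlim (\<lambda>x. K * x) at_top at_top" using assms by real_asymp
  from eventually_compose_filterlim[OF c(2) this]
  have "eventually (\<lambda>x. iter_ln (Suc j) x - c \<le> iter_ln (Suc j) (K * x)) at_top"
    by eventually_elim (use assms in simp)
  with c(1) show ?thesis by blast
qed

lemma eventually_iter_ln_antimono:
  assumes "m \<le> q"
  shows "eventually (\<lambda>x. iter_ln q x \<le> iter_ln m x) at_top"
  using assms
proof (induction q rule: dec_induct)
  case (step q)
  show ?case using step.IH eventually_iter_ln_gt[of 0 q]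
  proof eventually_elim
    case (elim x)
    have "ln (iter_ln q x) < iter_ln q x" using elim(2) by (rule ln_less_self)
    thus ?case using elim(1) unfolding iter_ln_Suc by linarith
  qed
qed auto

text \<open>Iterated logarithms commute with \<open>ln\<close>, so for \<open>j > 0\<close> and
  \<open>v = iter_ln j Y\<close> the claim reduces to \<open>K * ln v < v - c\<close>.\<close>

lemma eventually_iter_ln_ln_less:
  assumes "0 < K" "0 < e"
  shows "eventually (\<lambda>Y. K * iter_ln j (ln Y) < iter_ln j (e * Y)) at_top"
proof (cases j)
  case 0
  have "eventually (\<lambda>Y. K * ln Y < e * Y) at_top" using assms by real_asymp
  thus ?thesis by (simp add: 0)
next
  case (Suc i)
  obtain c where c: "eventually (\<lambda>x. iter_ln (Suc i) x - c \<le> iter_ln (Suc i) (e * x)) at_top"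
    using eventually_iter_ln_cmult_ge[OF assms(2)] by blast
  have "eventually (\<lambda>v. K * ln v < v - c) at_top" using assms by real_asymp
  from c eventually_compose_filterlim[OF this iter_ln_at_top[of "Suc i"]]
  show ?thesis
  proof eventually_elim
    case (elim Y)
    have "iter_ln (Suc i) (ln Y) = ln (iter_ln (Suc i) Y)"
      by (simp only: iter_ln_Suc[of "Suc i", symmetric] iter_ln_Suc'[of "Suc i"])
    thus ?case using elim by (simp add: Suc)
  qed
qed

text \<open>Meant for \<open>X\<close> and \<open>Y\<close> the logarithms of the maximum modulus at
  two radii: comparable iterated logarithms force \<open>ln X\<close> to be small against
  \<open>Y\<close>, because one extra logarithm beats any constant factor.\<close>

lemma eventually_ln_le_of_iter_ln_le:
  assumes "0 < K" "0 < e"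
  shows "eventually (\<lambda>Y. \<forall>X\<ge>Y. iter_ln n X \<le> K * iter_ln n Y \<longrightarrow> ln X \<le> e * Y) at_top"
proof (cases n)
  case 0
  have "eventually (\<lambda>Y. ln (K * Y) \<le> e * Y) at_top" using assms by real_asymp
  thus ?thesis using eventually_gt_at_top[of 0]
  proof eventually_elim
    case (elim Y)
    show ?case
    proof (intro allI impI)
      fix X assume X: "Y \<le> X" "iter_ln n X \<le> K * iter_ln n Y"
      hence "ln X \<le> ln (K * Y)" using elim by (intro ln_mono) (auto simp: 0)
      thus "ln X \<le> e * Y" using elim by simp
    qed
  qed
next
  case (Suc j)
  have "filterlim (\<lambda>Y. e * Y) at_top at_top" using assms by real_asymp
  from eventually_compose_filterlim[OF eventually_iter_ln_mono[of j] this] eventually_iter_ln_ln_less[OF assms, of j]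
  show ?thesis
  proof eventually_elim
    case (elim Y)
    show ?case
    proof (intro allI impI)
      fix X assume X: "Y \<le> X" "iter_ln n X \<le> K * iter_ln n Y"
      show "ln X \<le> e * Y"
      proof (rule ccontr)
        assume "\<not> ln X \<le> e * Y"
        hence "iter_ln j (e * Y) \<le> iter_ln j (ln X)" using elim by simp
        also have "\<dots> \<le> K * iter_ln j (ln Y)" using X(2) by (simp add: Suc iter_ln_Suc')
        finally show False using elim by simp
      qed
    qed
  qed
qed

subsection \<open>Peaks of sequences and limits\<close>

text \<open>Beyond a finite window all terms fall below its first one, so the maximum over the
  window is the maximum over the tail.\<close>

lemma frequently_peaks:
  fixes b :: "nat \<Rightarrow> real"
  assumes lim: "b \<longlonglongrightarrow> 0" and pos: "eventually (\<lambda>n. 0 < b n) sequentially"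
  shows "\<exists>n\<ge>N. \<forall>m\<ge>n. b m \<le> b n"
proof -
  obtain N0 where N0: "N0 \<ge> N" "0 < b N0"
    using eventually_conj[OF pos eventually_ge_at_top[of N]] by (auto simp: eventually_sequentially)
  obtain N1 where N1: "\<And>m. m \<ge> N1 \<Longrightarrow> b m < b N0"
    using order_tendstoD(2)[OF lim N0(2)] by (auto simp: eventually_sequentially)
  define S where "S = {N0..N0 + N1}"
  have "finite (b ` S)" "b ` S \<noteq> {}" by (auto simp: S_def)
  from Max_in[OF this] obtain n where n: "n \<in> S" "Max (b ` S) = b n" by auto
  have le: "b m \<le> b n" if "m \<in> S" for m
    unfolding n(2)[symmetric] using that by (intro Max_ge) (auto simp: S_def)
  have "b m \<le> b n" if "m \<ge> n" for m
  proof (cases "m \<in> S")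
    case False
    hence "m \<ge> N1" using that n(1) by (auto simp: S_def)
    hence "b m < b N0" by (rule N1)
    also have "\<dots> \<le> b n" by (rule le) (simp add: S_def)
    finally show ?thesis by simp
  qed (rule le)
  thus ?thesis using n(1) N0(1) by (intro exI[of _ n]) (auto simp: S_def)
qed

lemma Liminf_le_frequently:
  assumes "frequently (\<lambda>x. f x \<le> ereal B) F"
  shows "Liminf F (\<lambda>x. f x) \<le> ereal B"
proof (rule ccontr)
  assume "\<not> ?thesis"
  hence "eventually (\<lambda>x. ereal B < f x) F" by (intro less_LiminfD) auto
  hence "eventually (\<lambda>x. \<not> f x \<le> ereal B) F" by (rule eventually_mono) auto
  with assms show False unfolding frequently_def by blast
qed

lemma Limsup_ge_frequently:
  assumes "frequently (\<lambda>x. ereal B \<le> f x) F"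
  shows "ereal B \<le> Limsup F (\<lambda>x. f x)"
proof (rule ccontr)
  assume "\<not> ?thesis"
  hence "eventually (\<lambda>x. f x < ereal B) F" by (intro Limsup_lessD) auto
  hence "eventually (\<lambda>x. \<not> ereal B \<le> f x) F" by (rule eventually_mono) auto
  with assms show False unfolding frequently_def by blast
qed

lemma ereal_le_right_limit:
  fixes d :: real
  assumes "\<And>e. 0 < e \<Longrightarrow> e < d \<Longrightarrow> L \<le> ereal (F e)" "0 < d" "(F \<longlongrightarrow> l) (at_right 0)"
  shows "L \<le> ereal l"
proof (rule tendsto_lowerbound[of "\<lambda>e. ereal (F e)"])
  show "((\<lambda>e. ereal (F e)) \<longlongrightarrow> ereal l) (at_right 0)" using assms(3) by simp
  show "\<forall>\<^sub>F e in at_right 0. L \<le> ereal (F e)"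
    using assms(1,2) eventually_at_right_real[of 0 d] by (auto elim!: eventually_mono)
qed auto

text \<open>Each power of two rules out countably many scales, and an interval is
  uncountable.\<close>

lemma ex_scale_avoiding:
  assumes "countable (B :: real set)"
  shows "\<exists>r\<ge>1. \<forall>n. 2 ^ n * r \<notin> B"
proof -
  have "countable (\<Union>n. (\<lambda>x. x / 2 ^ n) ` B)" using assms by auto
  moreover have "uncountable {1<..<2 :: real}" by (simp add: uncountable_open_interval)
  ultimately have "\<not> {1<..<2} \<subseteq> (\<Union>n. (\<lambda>x. x / 2 ^ n) ` B)" using countable_subset by blast
  then obtain r where r: "r \<in> {1<..<2}" "r \<notin> (\<Union>n. (\<lambda>x. x / 2 ^ n) ` B)" by blast
  hence r1: "1 < r" by simp
  from r(2) have r2: "r \<notin> (\<lambda>x. x / 2 ^ n) ` B" for n by blast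
  have "2 ^ n * r \<notin> B" for n
  proof
    assume "2 ^ n * r \<in> B"
    hence "2 ^ n * r / 2 ^ n \<in> (\<lambda>x. x / 2 ^ n) ` B" by blast
    thus False using r2[of n] by simp
  qed
  thus ?thesis using r1 by (intro exI[of _ r]) auto
qed

subsection \<open>Growth along peaks of the maximum modulus\<close>

lemma max_modulus_at_top:
  assumes "transcendental_entire g"
  shows "filterlim (max_modulus g) at_top at_top"
  using max_modulus_growth[OF assms, of 1] by (intro filterlim_at_top_mono[OF filterlim_ident]) auto

lemma frequently_at_topI:
  fixes P :: "real \<Rightarrow> bool"
  assumes "\<And>x. \<exists>y\<ge>x. P y"
  shows "frequently P at_top"
  using assms unfolding frequently_def eventually_at_top_linorder by blast

text \<open>The radius is \<open>r = 2 * t\<close> with a peak at \<open>t = r / 2\<close>: the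
  Poisson bound doubles the radius, and the peak pays for this with \<open>2 powr \<sigma>\<close>.
  The share \<open>\<delta>\<close> of \<open>ln (max_modulus g t)\<close> covers all error
  terms.\<close>

lemma frequently_regular_growth:
  assumes g: "transcendental_entire g" and Q: "is_diff_polynomial g Q" "Q z0 \<noteq> 0"
    and \<alpha>: "1 \<le> \<alpha>" and G: "G = (\<lambda>z. g z ^ \<alpha> * Q z)"
    and l: "2 \<le> l" and order: "gen_order l g < ereal \<sigma>"
    and \<delta>: "0 < \<delta>" and B: "countable B"
  shows "frequently (\<lambda>r. r \<notin> B \<and>
     iter_ln (l - 1) (max_modulus g r) \<le> 2 powr \<sigma> * iter_ln (l - 1) (max_modulus g (r / 2)) \<and>
     (1 / 3 - \<delta>) * ln (max_modulus g (r / 2)) \<le> nevanlinna_T G r) at_top"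
proof -
  define M where "M = max_modulus g"
  define A where "A r = iter_ln (l - 1) (M r)" for r
  have gh: "g holomorphic_on UNIV" using g by (simp add: transcendental_entire_def)
  have gne: "nonzero_entire g" using transcendental_nonzero_deriv[OF g, of 0] by simp
  obtain BG C N where BG: "countable BG" and N: "0 \<le> N" and
    TG: "\<And>r M. 1 \<le> r \<Longrightarrow> r \<notin> BG \<Longrightarrow> 1 \<le> M \<Longrightarrow> \<forall>z. norm z \<le> 7 * r \<longrightarrow> norm (g z) \<le> M \<Longrightarrow>
       circle_mean (\<lambda>z. ln_plus (norm (g z))) r - C - N * ln (1 + ln M) \<le> nevanlinna_T G r"
    by (rule nevanlinna_T_diff_polynomial_ge[OF g Q \<alpha> G]) (rule that; assumption)
  have "countable (B \<union> BG \<union> norm ` {z. g z = 0})"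
    by (intro countable_Un countable_image countable_zeros B BG gne)
  from ex_scale_avoiding[OF this] obtain r0 where r0: "1 \<le> r0"
    "\<And>n. 2 ^ n * r0 \<notin> B \<union> BG \<union> norm ` {z. g z = 0}" by blast
  define s where "s n = 2 ^ n * r0" for n :: nat
  have s1: "1 \<le> s n" for n
    using r0(1) mult_mono[of 1 "2 ^ n" 1 r0] by (simp add: s_def)
  have s_top: "filterlim s at_top sequentially"
    unfolding s_def using r0(1) by real_asymp
  have M_top: "filterlim M at_top at_top" unfolding M_def by (rule max_modulus_at_top[OF g])
  have A_top: "filterlim A at_top at_top"
    unfolding A_def[abs_def] by (rule filterlim_compose[OF iter_ln_at_top M_top])
  have Y_top: "filterlim (\<lambda>n. ln (M (s n))) at_top sequentially"
    by (rule filterlim_compose[OF ln_at_top filterlim_compose[OF M_top s_top]])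
  define w where "w = 2 powr \<sigma>"
  have w: "w > 0" by (simp add: w_def)
  \<comment> \<open>With this normalisation a peak at \<open>n\<close> says that \<open>k\<close>
    doublings multiply \<open>A (s n)\<close> by at most \<open>w ^ k\<close>.\<close>
  define b where "b n = A (s n) / w ^ n" for n
  have b_pos: "eventually (\<lambda>n. 0 < b n) sequentially"
  proof -
    have "eventually (\<lambda>n. 0 < A (s n)) sequentially"
      using filterlim_compose[OF A_top s_top] unfolding filterlim_at_top_dense by (rule spec)
    thus ?thesis by eventually_elim (use w in \<open>auto simp: b_def\<close>)
  qed
  \<comment> \<open>An exponent strictly between the order and \<open>\<sigma>\<close> makes
    \<open>b\<close> decay geometrically.\<close>
  obtain \<sigma>' where \<sigma>': "gen_order l g < ereal \<sigma>'" "\<sigma>' < \<sigma>"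
    using ereal_dense2[OF order] by auto
  have b_le: "eventually (\<lambda>n. b n \<le> r0 powr \<sigma>' * (2 powr (\<sigma>' - \<sigma>)) ^ n) sequentially"
  proof -
    have "eventually (\<lambda>r. ereal (iter_ln l (M r) / ln r) < ereal \<sigma>') at_top"
      using Limsup_lessD[OF \<sigma>'(1)[unfolded gen_order_def]] by (simp add: M_def)
    hence "eventually (\<lambda>r. A r \<le> r powr \<sigma>') at_top"
      using filterlim_at_top_dense[THEN iffD1, OF A_top, rule_format, of 0] eventually_gt_at_top[of 1]
    proof eventually_elim
      case (elim r)
      have "iter_ln l (M r) = ln (A r)"
        using l iter_ln_Suc[of "l - 1" "M r"] by (simp add: A_def)
      hence "ln (A r) < \<sigma>' * ln r" using elim by (simp add: divide_less_eq)
      hence "exp (ln (A r)) \<le> exp (\<sigma>' * ln r)" by simp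
      thus ?case using elim by (simp add: powr_def)
    qed
    from eventually_compose_filterlim[OF this s_top] show ?thesis
    proof eventually_elim
      case (elim n)
      have "s n powr \<sigma>' = (2 powr \<sigma>') ^ n * r0 powr \<sigma>'"
        using r0(1) by (simp add: s_def powr_mult powr_powr mult.commute flip: powr_realpow)
      hence "b n \<le> (2 powr \<sigma>') ^ n * r0 powr \<sigma>' / w ^ n"
        using elim w unfolding b_def by (intro divide_right_mono) auto
      also have "\<dots> = r0 powr \<sigma>' * (2 powr \<sigma>' / w) ^ n" by (simp add: power_divide)
      also have "2 powr \<sigma>' / w = 2 powr (\<sigma>' - \<sigma>)" by (simp add: w_def powr_diff)
      finally show ?case .
    qed
  qed
  have b_lim: "b \<longlonglongrightarrow> 0"
  proof (rule tendsto_sandwich[OF _ b_le])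
    show "eventually (\<lambda>n. 0 \<le> b n) sequentially" using b_pos by eventually_elim auto
    have "2 powr (\<sigma>' - \<sigma>) < (1 :: real)"
      using \<sigma>'(2) powr_less_mono[of "\<sigma>' - \<sigma>" 0 2] by simp
    hence "(\<lambda>n. (2 powr (\<sigma>' - \<sigma>)) ^ n) \<longlonglongrightarrow> (0 :: real)" by (intro LIMSEQ_power_zero) auto
    from tendsto_mult_left[OF this, of "r0 powr \<sigma>'"]
    show "(\<lambda>n. r0 powr \<sigma>' * (2 powr (\<sigma>' - \<sigma>)) ^ n) \<longlonglongrightarrow> 0" by simp
  qed auto
  \<comment> \<open>The denominator uses \<open>N + 1\<close> because \<open>N\<close> may be
    0.\<close>
  define e where "e = \<delta> / (2 * (N + 1))"
  have e: "e > 0" "N * e \<le> \<delta> / 2" using \<delta> N by (auto simp: e_def field_simps)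
  \<comment> \<open>At radius \<open>2 * t\<close> the error term involves the maximum modulus at
    \<open>14 * t\<close>, which lies within four doublings of \<open>t\<close>.\<close>
  have "w ^ 4 > 0" using w by simp
  from eventually_compose_filterlim[OF eventually_ln_le_of_iter_ln_le[OF this e(1), of "l - 2"] Y_top]
  have ev1: "eventually (\<lambda>n. \<forall>X\<ge>ln (M (s n)). iter_ln (l - 2) X \<le> w ^ 4 * iter_ln (l - 2) (ln (M (s n))) \<longrightarrow>
      ln X \<le> e * ln (M (s n))) sequentially" .
  have "filterlim (\<lambda>n. \<delta> / 2 * ln (M (s n))) at_top sequentially"
    by (rule filterlim_tendsto_pos_mult_at_top[OF tendsto_const _ Y_top]) (use \<delta> in auto)
  hence ev2: "eventually (\<lambda>n. C + N * ln 2 \<le> \<delta> / 2 * ln (M (s n))) sequentially"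
    unfolding filterlim_at_top by (rule spec)
  have ev3: "eventually (\<lambda>n. 1 \<le> ln (M (s n))) sequentially"
    using Y_top by (simp add: filterlim_at_top)
  show ?thesis
  proof (rule frequently_at_topI)
    fix x :: real
    have "eventually (\<lambda>n. x \<le> s n) sequentially" using s_top by (simp add: filterlim_at_top)
    from eventually_conj[OF this eventually_conj[OF ev1 eventually_conj[OF ev2 ev3]]]
    obtain n0 where n0: "\<And>n. n \<ge> n0 \<Longrightarrow> x \<le> s n" "\<And>n X. n \<ge> n0 \<Longrightarrow> X \<ge> ln (M (s n)) \<Longrightarrow>
        iter_ln (l - 2) X \<le> w ^ 4 * iter_ln (l - 2) (ln (M (s n))) \<Longrightarrow> ln X \<le> e * ln (M (s n))"
      "\<And>n. n \<ge> n0 \<Longrightarrow> C + N * ln 2 \<le> \<delta> / 2 * ln (M (s n))" "\<And>n. n \<ge> n0 \<Longrightarrow> 1 \<le> ln (M (s n))"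
      unfolding eventually_sequentially by blast
    obtain n where n: "n \<ge> n0" "\<And>m. m \<ge> n \<Longrightarrow> b m \<le> b n"
      using frequently_peaks[OF b_lim b_pos, of n0] by blast
    have peak: "A (s (n + k)) \<le> w ^ k * A (s n)" for k
      using n(2)[of "n + k"] w by (simp add: b_def power_add field_simps)
    define t where "t = s n"
    have t1: "1 \<le> t" unfolding t_def by (rule s1)
    have s2: "s (n + 1) = 2 * t" and s4: "s (n + 4) = 16 * t" by (simp_all add: s_def t_def power_add)
    define X where "X = ln (M (16 * t))"
    define Y where "Y = ln (M t)"
    have Y1: "1 \<le> Y" unfolding Y_def t_def by (rule n0(4)[OF n(1)])
    have Mt: "1 \<le> M t" "0 < M t"
    proof -
      have "norm (g 0) \<le> M t" unfolding M_def using t1 by (intro max_modulus_upper[OF gh]) auto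
      hence "0 \<le> M t" by (rule order_trans[OF norm_ge_zero])
      moreover have "M t \<noteq> 0" using Y1 by (auto simp: Y_def)
      ultimately show pos: "0 < M t" by simp
      have "0 \<le> ln (M t)" using Y1 by (simp add: Y_def)
      thus "1 \<le> M t" using pos by (simp only: ln_ge_zero_iff)
    qed
    have MM: "M t \<le> M (16 * t)" unfolding M_def using t1 by (intro max_modulus_mono[OF gh]) auto
    have XY: "Y \<le> X" unfolding X_def Y_def using MM Mt by (intro ln_mono) auto
    have l2: "iter_ln (l - 2) (ln y) = iter_ln (l - 1) y" for y
    proof -
    have "l - 1 = Suc (l - 2)" using l by simp
    thus ?thesis by (simp only: iter_ln_Suc')
  qed
    have "iter_ln (l - 2) X \<le> w ^ 4 * iter_ln (l - 2) Y"
      using peak[of 4] unfolding s4 X_def Y_def l2 by (simp add: A_def t_def)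
    hence lnX: "ln X \<le> e * Y" using n0(2)[OF n(1), of X] XY by (simp add: Y_def t_def)
    have nB: "2 * t \<notin> B \<union> BG \<union> norm ` {z. g z = 0}"
      using r0(2)[of "n + 1"] by (simp add: t_def s_def mult.assoc)
    have "M t \<le> exp (3 * circle_mean (\<lambda>z. ln_plus (norm (g z))) (2 * t))"
      unfolding M_def
    proof (rule max_modulus_least)
      fix z :: complex assume z: "norm z = t"
      have "g w \<noteq> 0" if "norm w = 2 * t" for w using nB that by (auto simp: image_iff)
      thus "norm (g z) \<le> exp (3 * circle_mean (\<lambda>z. ln_plus (norm (g z))) (2 * t))"
        by (intro ln_norm_le_mean_ln_plus gne) (use t1 z in auto)
    qed (use t1 in auto)
    hence "ln (M t) \<le> ln (exp (3 * circle_mean (\<lambda>z. ln_plus (norm (g z))) (2 * t)))"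
      using Mt by (intro ln_mono) auto
    hence 1: "Y / 3 \<le> circle_mean (\<lambda>z. ln_plus (norm (g z))) (2 * t)" by (simp add: Y_def)
    have 2: "circle_mean (\<lambda>z. ln_plus (norm (g z))) (2 * t) - C - N * ln (1 + ln (M (16 * t))) \<le> nevanlinna_T G (2 * t)"
    proof (rule TG)
      show "\<forall>z. norm z \<le> 7 * (2 * t) \<longrightarrow> norm (g z) \<le> M (16 * t)"
        unfolding M_def using t1 by (auto intro!: max_modulus_upper[OF gh])
    qed (use t1 nB Mt MM in auto)
    have "ln (1 + X) \<le> ln (2 * X)" using XY Y1 by (intro ln_mono) auto
    also have "\<dots> = ln 2 + ln X" using XY Y1 by (intro ln_mult_pos) auto
    also have "\<dots> \<le> ln 2 + e * Y" using lnX by simp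
    finally have "N * ln (1 + X) \<le> N * (ln 2 + e * Y)" using N by (rule mult_left_mono)
    moreover have "N * e * Y \<le> \<delta> / 2 * Y" using e(2) Y1 by (intro mult_right_mono) auto
    moreover have "C + N * ln 2 \<le> \<delta> / 2 * Y" using n0(3)[OF n(1)] by (simp add: Y_def t_def)
    ultimately have "C + N * ln (1 + X) \<le> \<delta> * Y" by (simp add: algebra_simps)
    hence 3: "(1 / 3 - \<delta>) * Y \<le> nevanlinna_T G (2 * t)"
      using 1 2 unfolding X_def[symmetric] by (simp add: algebra_simps)
    have 4: "A (2 * t) \<le> w * A t" using peak[of 1] unfolding s2 by (simp add: t_def)
    have "x \<le> 2 * t" using n0(1)[OF n(1)] t1 by (simp add: t_def)
    thus "\<exists>r\<ge>x. r \<notin> B \<and>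
       iter_ln (l - 1) (max_modulus g r) \<le> 2 powr \<sigma> * iter_ln (l - 1) (max_modulus g (r / 2)) \<and>
       (1 / 3 - \<delta>) * ln (max_modulus g (r / 2)) \<le> nevanlinna_T G r"
      using 3 4 nB by (intro exI[of _ "2 * t"]) (simp add: A_def M_def w_def Y_def)
  qed
qed

text \<open>From \<open>1 \<le> q < p\<close> both sides carry at least one logarithm, so all
  factors and constants of the comparison end up in \<open>c\<close>. The last conclusion later
  provides the range where further logarithms are monotone.\<close>

lemma iter_ln_nevanlinna_T_compose_le:
  assumes rep: "quotient_rep f h1 h2" and nc: "\<And>c. \<exists>z. h1 z \<noteq> c * h2 z"
    and g: "transcendental_entire g" and pq: "1 \<le> q" "q < p"
    and order: "pq_order p q f < ereal \<tau>" and \<tau>: "0 < \<tau>"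
  obtains B c where "countable B"
    "eventually (\<lambda>r. r \<notin> B \<longrightarrow> iter_ln (p - 1) (nevanlinna_T (f \<circ> g) r) \<le> \<tau> * iter_ln q (max_modulus g r) + c) at_top"
    "\<And>x. eventually (\<lambda>r. r \<notin> B \<longrightarrow> x \<le> nevanlinna_T (f \<circ> g) r) at_top"
proof -
  define M where "M = max_modulus g"
  have gh: "g holomorphic_on UNIV" using g by (simp add: transcendental_entire_def)
  obtain B C where B: "countable B" and
    le: "\<And>r R. r \<ge> 1 \<Longrightarrow> r \<notin> B \<Longrightarrow> R \<notin> B \<Longrightarrow> \<forall>z. norm z \<le> r \<longrightarrow> norm (g z) < R \<Longrightarrow>
       2 * norm (g 0) + 1 < R \<Longrightarrow> nevanlinna_T (f \<circ> g) r \<le> 3 * nevanlinna_T f R + C" and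
    ge: "\<And>r. r \<ge> 1 \<Longrightarrow> r \<notin> B \<Longrightarrow> ln r - C \<le> nevanlinna_T (f \<circ> g) r"
    "\<And>r. r \<ge> 1 \<Longrightarrow> r \<notin> B \<Longrightarrow> ln r - C \<le> nevanlinna_T f r"
    by (rule nevanlinna_T_compose_le[OF rep nc gh transcendental_nonconstant[OF g]]) (rule that; assumption)
  define K0 where "K0 = 2 * norm (g 0) + 1"
  obtain j where j: "p - 1 = Suc j" using pq by (cases "p - 1") auto
  obtain i where i: "q = Suc i" using pq by (cases q) auto
  obtain c1 x1 where x1: "\<And>x. x \<ge> x1 \<Longrightarrow> iter_ln (p - 1) (3 * x + \<bar>C\<bar>) \<le> iter_ln (p - 1) x + c1"
    using eventually_iter_ln_affine_le[of 3 "\<bar>C\<bar>" j] unfolding j eventually_at_top_linorder by auto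
  obtain c2 m0 where m0: "\<And>x. x \<ge> m0 \<Longrightarrow> iter_ln q (3 * x + K0) \<le> iter_ln q x + c2"
    using eventually_iter_ln_affine_le[of 3 K0 i] unfolding i eventually_at_top_linorder by (auto simp: K0_def)
  obtain x2 where x2: "\<And>x y. x \<ge> x2 \<Longrightarrow> x \<le> y \<Longrightarrow> iter_ln (p - 1) x \<le> iter_ln (p - 1) y"
    using eventually_iter_ln_mono[of "p - 1"] unfolding eventually_at_top_linorder by auto
  have "eventually (\<lambda>R. iter_ln (p - 1) (nevanlinna_T f R) \<le> \<tau> * iter_ln q R) at_top"
    using Limsup_lessD[OF order[unfolded pq_order_def]] eventually_iter_ln_gt[of 0 q]
    by eventually_elim (auto simp: divide_less_eq)
  moreover have "eventually (\<lambda>R. x1 + C \<le> ln R) at_top"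
    using ln_at_top by (simp add: filterlim_at_top)
  ultimately have "eventually (\<lambda>R. iter_ln (p - 1) (nevanlinna_T f R) \<le> \<tau> * iter_ln q R \<and>
      (\<forall>y\<ge>R. iter_ln q R \<le> iter_ln q y) \<and> x1 + C \<le> ln R) at_top"
    using eventually_iter_ln_mono[of q] by eventually_elim auto
  then obtain R0 where R0: "\<And>R. R \<ge> R0 \<Longrightarrow> iter_ln (p - 1) (nevanlinna_T f R) \<le> \<tau> * iter_ln q R"
    "\<And>R y. R \<ge> R0 \<Longrightarrow> R \<le> y \<Longrightarrow> iter_ln q R \<le> iter_ln q y" "\<And>R. R \<ge> R0 \<Longrightarrow> x1 + C \<le> ln R"
    unfolding eventually_at_top_linorder by blast
  have large: "eventually (\<lambda>r. r \<notin> B \<longrightarrow> x \<le> nevanlinna_T (f \<circ> g) r) at_top" for x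
  proof -
    have "eventually (\<lambda>r. x + C \<le> ln r) at_top" using ln_at_top by (simp add: filterlim_at_top)
    thus ?thesis using eventually_ge_at_top[of 1]
    proof eventually_elim
      case (elim r)
      thus ?case using ge(1)[of r] by auto
    qed
  qed
  have "eventually (\<lambda>r. max 1 (max m0 R0) \<le> M r) at_top"
    using max_modulus_at_top[OF g] unfolding M_def filterlim_at_top by (rule spec)
  hence "eventually (\<lambda>r. r \<notin> B \<longrightarrow> iter_ln (p - 1) (nevanlinna_T (f \<circ> g) r) \<le> \<tau> * iter_ln q (M r) + (\<tau> * c2 + c1)) at_top"
    using large[of x2] eventually_ge_at_top[of 1]
  proof eventually_elim
    case (elim r)
    show ?case
    proof
      assume r: "r \<notin> B"
      have Mr: "1 \<le> M r" "m0 \<le> M r" "R0 \<le> M r" using elim by auto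
      \<comment> \<open>An uncountable choice of radii lets \<open>R\<close> escape
        \<open>B\<close>; the affine upper end costs only a constant after \<open>q\<close>
        logarithms.\<close>
      have "uncountable {2 * M r + K0<..<3 * M r + K0}" using Mr by (simp add: uncountable_open_interval)
      then obtain R where R: "2 * M r + K0 < R" "R < 3 * M r + K0" "R \<notin> B"
        using countable_subset[OF _ B] by (metis greaterThanLessThan_iff subsetI)
      have K0: "1 \<le> K0" by (simp add: K0_def)
      have RM: "M r \<le> R" using R(1) Mr(1) K0 by linarith
      have TfR: "x1 \<le> nevanlinna_T f R" using ge(2)[of R] R0(3)[of R] R RM Mr by auto
      have "nevanlinna_T (f \<circ> g) r \<le> 3 * nevanlinna_T f R + C"
      proof (rule le)
        have "norm (g z) \<le> M r" if "norm z \<le> r" for z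
          unfolding M_def using elim that by (intro max_modulus_upper[OF gh]) auto
        moreover have "M r < R" using R(1) Mr(1) K0 by linarith
        ultimately show "\<forall>z. norm z \<le> r \<longrightarrow> norm (g z) < R" by (meson le_less_trans)
      qed (use elim r R Mr in \<open>auto simp: K0_def\<close>)
      hence "iter_ln (p - 1) (nevanlinna_T (f \<circ> g) r) \<le> iter_ln (p - 1) (3 * nevanlinna_T f R + \<bar>C\<bar>)"
        using elim r by (intro x2) auto
      also have "\<dots> \<le> iter_ln (p - 1) (nevanlinna_T f R) + c1" by (rule x1[OF TfR])
      also have "iter_ln (p - 1) (nevanlinna_T f R) \<le> \<tau> * iter_ln q R" using RM Mr by (intro R0(1)) auto
      also have "iter_ln q R \<le> iter_ln q (3 * M r + K0)" using RM Mr R by (intro R0(2)) auto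
      also have "\<dots> \<le> iter_ln q (M r) + c2" by (rule m0[OF Mr(2)])
      finally show "iter_ln (p - 1) (nevanlinna_T (f \<circ> g) r) \<le> \<tau> * iter_ln q (M r) + (\<tau> * c2 + c1)"
        using \<tau> by (simp add: algebra_simps)
    qed
  qed
  thus ?thesis using that[OF B _ large] unfolding M_def by blast
qed

section \<open>From growth bounds to the limit inferior\<close>

text \<open>Numerator and denominator are compared with one function \<open>a\<close> tending to
  infinity, against which the additive constants are negligible.\<close>

lemma Liminf_quotient_le:
  fixes num den a :: "real \<Rightarrow> real"
  assumes fr: "frequently (\<lambda>r. num r \<le> \<mu> * a r + c \<and> \<kappa> * a r - c' \<le> den r) at_top"
    and a: "filterlim a at_top at_top" and \<kappa>: "0 < \<kappa>" and \<mu>: "0 \<le> \<mu>"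
  shows "Liminf at_top (\<lambda>r. ereal (num r / den r)) \<le> ereal (\<mu> / \<kappa>)"
proof (rule ereal_le_right_limit[where F = "\<lambda>e. \<mu> / \<kappa> + e" and d = 1])
  fix e :: real assume e: "0 < e" "e < 1"
  \<comment> \<open>Beyond the first threshold the slack \<open>e * \<kappa> * a r\<close> absorbs
    the constants; beyond the second the denominator is at least 1.\<close>
  define x where "x = max ((c + (\<mu> / \<kappa> + e) * c') / (e * \<kappa>)) ((c' + 1) / \<kappa>)"
  have "eventually (\<lambda>r. x \<le> a r) at_top" using a by (simp add: filterlim_at_top)
  from frequently_eventually_frequently[OF fr this]
  have "frequently (\<lambda>r. ereal (num r / den r) \<le> ereal (\<mu> / \<kappa> + e)) at_top"
  proof (rule frequently_elim1)
    fix r assume r: "(num r \<le> \<mu> * a r + c \<and> \<kappa> * a r - c' \<le> den r) \<and> x \<le> a r"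
    have "(c' + 1) / \<kappa> \<le> a r" using r by (simp add: x_def)
    hence d: "1 \<le> \<kappa> * a r - c'" using \<kappa> by (simp add: field_simps)
    have "(c + (\<mu> / \<kappa> + e) * c') / (e * \<kappa>) \<le> a r" using r by (simp add: x_def)
    hence "c + (\<mu> / \<kappa> + e) * c' \<le> e * \<kappa> * a r"
      using \<kappa> e by (simp add: pos_divide_le_eq mult_ac)
    moreover have "(\<mu> / \<kappa> + e) * (\<kappa> * a r - c') = \<mu> * a r + e * \<kappa> * a r - (\<mu> / \<kappa> + e) * c'"
      using \<kappa> by (simp add: algebra_simps)
    ultimately have "num r \<le> (\<mu> / \<kappa> + e) * (\<kappa> * a r - c')" using r by linarith
    also have "\<dots> \<le> (\<mu> / \<kappa> + e) * den r" using r e \<kappa> \<mu> by (intro mult_left_mono) auto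
    finally show "ereal (num r / den r) \<le> ereal (\<mu> / \<kappa> + e)"
      using d r by (simp add: pos_divide_le_eq)
  qed
  thus "Liminf at_top (\<lambda>r. ereal (num r / den r)) \<le> ereal (\<mu> / \<kappa> + e)"
    by (rule Liminf_le_frequently)
qed (use \<kappa> in \<open>auto intro!: tendsto_eq_intros\<close>)

text \<open>The factor \<open>\<kappa>\<close> survives only when no logarithm is taken. Here the
  cases \<open>l = 2\<close> and \<open>l > 2\<close> separate.\<close>

lemma eventually_iter_ln_ge:
  assumes \<kappa>: "0 < \<kappa>"
  obtains c where "eventually (\<lambda>Y. \<forall>T\<ge>\<kappa> * Y. (if n = 0 then \<kappa> else 1) * iter_ln n Y - c \<le> iter_ln n T) at_top"
proof (cases n)
  case 0
  show ?thesis by (rule that[of 0]) (simp add: 0)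
next
  case (Suc j)
  obtain c where c: "eventually (\<lambda>x. iter_ln n x - c \<le> iter_ln n (\<kappa> * x)) at_top"
    using eventually_iter_ln_cmult_ge[OF \<kappa>, of j] unfolding Suc by blast
  have "filterlim (\<lambda>x. \<kappa> * x) at_top at_top" using \<kappa> by real_asymp
  from c eventually_compose_filterlim[OF eventually_iter_ln_mono[of n] this]
  have "eventually (\<lambda>Y. \<forall>T\<ge>\<kappa> * Y. (if n = 0 then \<kappa> else 1) * iter_ln n Y - c \<le> iter_ln n T) at_top"
  proof eventually_elim
    case (elim Y)
    thus ?case using Suc by (auto intro: order_trans)
  qed
  thus ?thesis by (rule that)
qed

text \<open>The set \<open>B\<close> is quantified after \<open>a\<close> and \<open>c\<close>, so
  that these can be fixed before the exceptional radii of \<open>f \<circ> g\<close> are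
  known.\<close>

lemma frequently_growth_bounds:
  assumes g: "transcendental_entire g" and Q: "is_diff_polynomial g Q" "Q z0 \<noteq> 0"
    and \<alpha>: "1 \<le> \<alpha>" and G: "G = (\<lambda>z. g z ^ \<alpha> * Q z)"
    and l: "2 \<le> l" and order: "gen_order l g < ereal \<sigma>"
    and \<delta>: "0 < \<delta>" "\<delta> < 1 / 3"
  obtains c a where "filterlim a at_top at_top"
    "\<And>B. countable B \<Longrightarrow> frequently (\<lambda>r. r \<notin> B \<and> iter_ln (l - 1) (max_modulus g r) \<le> 2 powr \<sigma> * a r \<and>
       (if l = 2 then 1 / 3 - \<delta> else 1) * a r - c \<le> iter_ln (l - 2) (nevanlinna_T G r)) at_top"
proof -
  define a where "a r = iter_ln (l - 1) (max_modulus g (r / 2))" for r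
  have half: "filterlim (\<lambda>r :: real. r / 2) at_top at_top" by real_asymp
  have Mh: "filterlim (\<lambda>r. max_modulus g (r / 2)) at_top at_top"
    by (rule filterlim_compose[OF max_modulus_at_top[OF g] half])
  have a: "filterlim a at_top at_top"
    unfolding a_def[abs_def] by (rule filterlim_compose[OF iter_ln_at_top Mh])
  have l2: "iter_ln (l - 2) (ln y) = iter_ln (l - 1) y" for y
  proof -
    have "l - 1 = Suc (l - 2)" using l by simp
    thus ?thesis by (simp only: iter_ln_Suc')
  qed
  have "0 < 1 / 3 - \<delta>" using \<delta> by simp
  then obtain c where c: "eventually (\<lambda>Y. \<forall>T\<ge>(1 / 3 - \<delta>) * Y.
      (if l - 2 = 0 then 1 / 3 - \<delta> else 1) * iter_ln (l - 2) Y - c \<le> iter_ln (l - 2) T) at_top"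
    by (rule eventually_iter_ln_ge)
  have l0: "l - 2 = 0 \<longleftrightarrow> l = 2" using l by auto
  from eventually_compose_filterlim[OF c filterlim_compose[OF ln_at_top Mh]]
  have ev: "eventually (\<lambda>r. \<forall>T\<ge>(1 / 3 - \<delta>) * ln (max_modulus g (r / 2)).
      (if l = 2 then 1 / 3 - \<delta> else 1) * a r - c \<le> iter_ln (l - 2) T) at_top"
    by (simp only: l2 l0 a_def)
  show ?thesis
  proof (rule that[OF a, of c])
    fix B :: "real set" assume B: "countable B"
    from frequently_eventually_frequently[OF frequently_regular_growth[OF g Q \<alpha> G l order \<delta>(1) B] ev]
    show "frequently (\<lambda>r. r \<notin> B \<and> iter_ln (l - 1) (max_modulus g r) \<le> 2 powr \<sigma> * a r \<and>
       (if l = 2 then 1 / 3 - \<delta> else 1) * a r - c \<le> iter_ln (l - 2) (nevanlinna_T G r)) at_top"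
      by (rule frequently_elim1) (auto simp: a_def)
  qed
qed

section \<open>Almost constant functions and the sign of the order\<close>

lemma nevanlinna_T_almost_constant:
  assumes "\<And>z. eventually (\<lambda>w. F w = c) (at z)"
  obtains B where "countable B" "\<And>r. 0 \<le> r \<Longrightarrow> r \<notin> B \<Longrightarrow> nevanlinna_T F r = ln_plus (norm c)"
proof -
  define B where "B = norm ` {z. F z \<noteq> c}"
  have B: "countable B" unfolding B_def by (intro countable_image countable_exceptions assms)
  have "is_pole F z \<longleftrightarrow> is_pole (\<lambda>_ :: complex. c) z" for z
    by (rule is_pole_cong[OF assms refl])
  hence "pole_count F t = 0" for t by (simp add: pole_count_def)
  hence T: "nevanlinna_T F r = circle_mean (\<lambda>z. ln_plus (norm (F z))) r" for r
    by (simp add: nevanlinna_T_def integrated_count_def proximity_eq_circle_mean)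
  have "nevanlinna_T F r = ln_plus (norm c)" if "0 \<le> r" "r \<notin> B" for r
  proof -
    have "nevanlinna_T F r = circle_mean (\<lambda>_. ln_plus (norm c)) r"
      unfolding T by (rule circle_mean_cong) (use that in \<open>auto simp: B_def\<close>)
    thus ?thesis by simp
  qed
  with B show ?thesis by (rule that)
qed

lemma frequently_not_in_countable:
  assumes "countable (B :: real set)"
  shows "frequently (\<lambda>r. r \<notin> B) at_top"
proof (rule frequently_at_topI)
  fix x :: real
  have "uncountable {x<..<x + 1}" by (simp add: uncountable_open_interval)
  hence "\<not> {x<..<x + 1} \<subseteq> B" using countable_subset[OF _ assms] by blast
  then obtain y where "y \<in> {x<..<x + 1}" "y \<notin> B" by blast
  thus "\<exists>y\<ge>x. y \<notin> B" by (intro exI[of _ y]) auto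
qed

text \<open>Inequalities are later multiplied by numbers above the order, which have to be positive.
  For an almost constant \<open>f\<close> the quotient tends to 0 off a countable set, whatever the
  sign of the fixed iterated logarithm; otherwise the characteristic tends to infinity off such a
  set.\<close>

lemma pq_order_nonneg:
  assumes f: "f meromorphic_on UNIV"
  shows "0 \<le> pq_order p q f"
  using f
proof (cases rule: meromorphic_quotient_rep)
  case (const c)
  obtain B where B: "countable B" "\<And>r. 0 \<le> r \<Longrightarrow> r \<notin> B \<Longrightarrow> nevanlinna_T f r = ln_plus (norm c)"
    using nevanlinna_T_almost_constant[OF const] by blast
  define v where "v = iter_ln (p - 1) (ln_plus (norm c))"
  have "((\<lambda>r. v / iter_ln q r) \<longlongrightarrow> 0) at_top"
    by (rule real_tendsto_divide_at_top[OF tendsto_const iter_ln_at_top])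
  show ?thesis
  proof (rule ereal_le_epsilon2)
    fix e :: real assume e: "0 < e"
    show "0 \<le> pq_order p q f + ereal e"
    proof -
      have "eventually (\<lambda>r. - e < v / iter_ln q r) at_top"
        using order_tendstoD(1)[OF \<open>((\<lambda>r. v / iter_ln q r) \<longlongrightarrow> 0) at_top\<close>, of "- e"] e by simp
      hence "eventually (\<lambda>r. - e < v / iter_ln q r \<and> 0 \<le> r) at_top"
        using eventually_ge_at_top[of 0] by eventually_elim auto
      from frequently_eventually_frequently[OF frequently_not_in_countable[OF B(1)] this]
      have "frequently (\<lambda>r. ereal (- e) \<le> ereal (iter_ln (p - 1) (nevanlinna_T f r) / iter_ln q r)) at_top"
        by (rule frequently_elim1) (auto simp: B(2) v_def)
      hence "ereal (- e) \<le> pq_order p q f"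
        unfolding pq_order_def by (rule Limsup_ge_frequently)
      hence "ereal (- e) + ereal e \<le> pq_order p q f + ereal e" by (rule add_right_mono)
      thus "0 \<le> pq_order p q f + ereal e" by (simp add: zero_ereal_def)
    qed
  qed
next
  case (rep h1 h2)
  obtain B c C where B: "countable B" "\<And>r. r \<ge> 1 \<Longrightarrow> r \<notin> B \<Longrightarrow> nevanlinna_T f r = circle_mean (log_max h1 h2) r - c"
    and ge: "\<And>r. r \<ge> 1 \<Longrightarrow> r \<notin> B \<Longrightarrow> ln r - C \<le> nevanlinna_T f r"
    and "\<And>z. norm z \<notin> B \<Longrightarrow> h1 z \<noteq> 0 \<and> h2 z \<noteq> 0"
    by (rule quotient_rep_growth[OF rep]) (rule that; assumption)
  obtain x0 where x0: "\<And>x. x \<ge> x0 \<Longrightarrow> 0 < iter_ln (p - 1) x"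
    using eventually_iter_ln_gt[of 0 "p - 1"] unfolding eventually_at_top_linorder by blast
  have "eventually (\<lambda>r. x0 + C \<le> ln r) at_top" using ln_at_top by (simp add: filterlim_at_top)
  hence "eventually (\<lambda>r. x0 + C \<le> ln r \<and> 1 \<le> r \<and> 0 < iter_ln q r) at_top"
    using eventually_ge_at_top[of 1] eventually_iter_ln_gt[of 0 q] by eventually_elim auto
  from frequently_eventually_frequently[OF frequently_not_in_countable[OF B(1)] this]
  have "frequently (\<lambda>r. ereal 0 \<le> ereal (iter_ln (p - 1) (nevanlinna_T f r) / iter_ln q r)) at_top"
  proof (rule frequently_elim1)
    fix r assume r: "r \<notin> B \<and> x0 + C \<le> ln r \<and> 1 \<le> r \<and> 0 < iter_ln q r"
    hence "x0 \<le> nevanlinna_T f r" using ge[of r] by auto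
    hence "0 < iter_ln (p - 1) (nevanlinna_T f r)" by (rule x0)
    thus "ereal 0 \<le> ereal (iter_ln (p - 1) (nevanlinna_T f r) / iter_ln q r)" using r by simp
  qed
  thus ?thesis unfolding pq_order_def zero_ereal_def by (rule Limsup_ge_frequently)
qed

text \<open>If \<open>l - 1 \<le> q\<close>, the \<open>q\<close>-fold logarithm of the maximum
  modulus is eventually at most the \<open>(l - 1)\<close>-fold one. If \<open>q < l - 1\<close>,
  then \<open>l - 1 - q\<close> further logarithms of the numerator lead to the
  \<open>(l - 1)\<close>-fold one and turn \<open>\<tau>\<close> into an additive constant.\<close>

theorem Liminf_nevanlinna_T_ratio_le:
  assumes f: "f meromorphic_on UNIV" and g: "transcendental_entire g"
    and pq: "1 \<le> q" "q < p" and l: "2 \<le> l"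
    and \<tau>: "pq_order p q f < ereal \<tau>" and \<sigma>: "gen_order l g < ereal \<sigma>"
    and \<delta>: "0 < \<delta>" "\<delta> < 1 / 3"
    and Q: "is_diff_polynomial g Q" and \<alpha>: "1 \<le> \<alpha>" and G: "G = (\<lambda>z. g z ^ \<alpha> * Q z)"
  shows "l - 1 \<le> q \<Longrightarrow> Liminf at_top (\<lambda>r::real. ereal
            (iter_ln (p - 1) (nevanlinna_T (f \<circ> g) r) / iter_ln (l - 2) (nevanlinna_T G r)))
            \<le> ereal (\<tau> * 2 powr \<sigma> / (if l = 2 then 1 / 3 - \<delta> else 1))"
    and "q < l - 1 \<Longrightarrow> Liminf at_top (\<lambda>r::real. ereal
            (iter_ln (p + l - q - 2) (nevanlinna_T (f \<circ> g) r) / iter_ln (l - 2) (nevanlinna_T G r)))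
            \<le> ereal (2 powr \<sigma>)"
proof -
  define \<kappa> where "\<kappa> = (if l = 2 then 1 / 3 - \<delta> else 1)"
  define L where "L k = Liminf at_top (\<lambda>r::real. ereal
      (iter_ln k (nevanlinna_T (f \<circ> g) r) / iter_ln (l - 2) (nevanlinna_T G r)))" for k
  have \<kappa>: "0 < \<kappa>" using \<delta> by (simp add: \<kappa>_def)
  have "0 < ereal \<tau>" using pq_order_nonneg[OF f] \<tau> by (rule le_less_trans)
  hence \<tau>0: "0 < \<tau>" by simp
  have gh: "g holomorphic_on UNIV" using g by (simp add: transcendental_entire_def)
  have "(l - 1 \<le> q \<longrightarrow> L (p - 1) \<le> ereal (\<tau> * 2 powr \<sigma> / \<kappa>)) \<and>
        (q < l - 1 \<longrightarrow> L (p + l - q - 2) \<le> ereal (2 powr \<sigma>))"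
  proof (cases "\<exists>z. Q z \<noteq> 0")
    case False
    \<comment> \<open>A differential polynomial may vanish identically. Then the denominator is 0
      and the quotient is 0 by convention.\<close>
    hence "nevanlinna_T G r = 0" for r
      by (subst nevanlinna_T_entire) (auto simp: G ln_plus_def)
    hence "L k = ereal 0" for k unfolding L_def by (simp add: Liminf_const zero_ereal_def)
    thus ?thesis using \<tau>0 \<kappa> by simp
  next
    case True
    then obtain z0 where Q0: "Q z0 \<noteq> 0" by blast
    obtain c a where a: "filterlim a at_top at_top" and
      fr: "\<And>B. countable B \<Longrightarrow> frequently (\<lambda>r. r \<notin> B \<and> iter_ln (l - 1) (max_modulus g r) \<le> 2 powr \<sigma> * a r \<and>
         (if l = 2 then 1 / 3 - \<delta> else 1) * a r - c \<le> iter_ln (l - 2) (nevanlinna_T G r)) at_top"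
      by (rule frequently_growth_bounds[OF g Q Q0 \<alpha> G l \<sigma> \<delta>]) (rule that; assumption)
    from f show ?thesis
    proof (cases rule: meromorphic_quotient_rep)
      case (const c0)
      have "eventually (\<lambda>w. (f \<circ> g) w = c0) (at z)" for z
        unfolding o_def
        by (rule eventually_compose_filterlim[OF const entire_filterlim_at[OF gh transcendental_nonconstant[OF g]]])
      then obtain B where B: "countable B" "\<And>r. 0 \<le> r \<Longrightarrow> r \<notin> B \<Longrightarrow> nevanlinna_T (f \<circ> g) r = ln_plus (norm c0)"
        by (rule nevanlinna_T_almost_constant) (rule that; assumption)
      \<comment> \<open>Along the chosen radii the numerator is a fixed real number, so the
        comparison holds with \<open>\<mu> = 0\<close>.\<close>
      have L0: "L k \<le> ereal (0 / \<kappa>)" for k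
        unfolding L_def
      proof (rule Liminf_quotient_le[OF _ a \<kappa> order_refl])
        from frequently_eventually_frequently[OF fr[OF B(1)] eventually_ge_at_top[of 0]]
        show "frequently (\<lambda>r. iter_ln k (nevanlinna_T (f \<circ> g) r) \<le> 0 * a r + iter_ln k (ln_plus (norm c0)) \<and>
            \<kappa> * a r - c \<le> iter_ln (l - 2) (nevanlinna_T G r)) at_top"
          by (rule frequently_elim1) (auto simp: B(2) \<kappa>_def)
      qed
      have "ereal (0 / \<kappa>) \<le> ereal (\<tau> * 2 powr \<sigma> / \<kappa>)" "ereal (0 / \<kappa>) \<le> ereal (2 powr \<sigma>)"
        using \<tau>0 \<kappa> by simp_all
      thus ?thesis using L0 order_trans by blast
    next
      case (rep h1 h2)
      obtain B c2 where B: "countable B" and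
        num: "eventually (\<lambda>r. r \<notin> B \<longrightarrow> iter_ln (p - 1) (nevanlinna_T (f \<circ> g) r) \<le> \<tau> * iter_ln q (max_modulus g r) + c2) at_top" and
        large: "\<And>x. eventually (\<lambda>r. r \<notin> B \<longrightarrow> x \<le> nevanlinna_T (f \<circ> g) r) at_top"
        by (rule iter_ln_nevanlinna_T_compose_le[OF rep g pq \<tau> \<tau>0]) (rule that; assumption)
      note M_top = max_modulus_at_top[OF g]
      have "L (p - 1) \<le> ereal (\<tau> * 2 powr \<sigma> / \<kappa>)" if ql: "l - 1 \<le> q"
        unfolding L_def
      proof (rule Liminf_quotient_le[OF _ a \<kappa>])
        have "eventually (\<lambda>r. (r \<notin> B \<longrightarrow> iter_ln (p - 1) (nevanlinna_T (f \<circ> g) r) \<le> \<tau> * iter_ln q (max_modulus g r) + c2) \<and>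
            iter_ln q (max_modulus g r) \<le> iter_ln (l - 1) (max_modulus g r)) at_top"
          by (rule eventually_conj[OF num eventually_compose_filterlim[OF eventually_iter_ln_antimono[OF ql] M_top]])
        from frequently_eventually_frequently[OF fr[OF B] this]
        show "frequently (\<lambda>r. iter_ln (p - 1) (nevanlinna_T (f \<circ> g) r) \<le> \<tau> * 2 powr \<sigma> * a r + c2 \<and>
            \<kappa> * a r - c \<le> iter_ln (l - 2) (nevanlinna_T G r)) at_top"
        proof (rule frequently_elim1, goal_cases)
          case (1 r)
          hence "iter_ln q (max_modulus g r) \<le> 2 powr \<sigma> * a r" by linarith
          hence "\<tau> * iter_ln q (max_modulus g r) \<le> \<tau> * (2 powr \<sigma> * a r)"
            using \<tau>0 by (intro mult_left_mono) auto
          moreover have "iter_ln (p - 1) (nevanlinna_T (f \<circ> g) r) \<le> \<tau> * iter_ln q (max_modulus g r) + c2"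
            using 1 by blast
          ultimately show ?case using 1 unfolding \<kappa>_def mult.assoc by linarith
        qed
      qed (use \<tau>0 in simp)
      moreover have "L (p + l - q - 2) \<le> ereal (2 powr \<sigma> / \<kappa>)" if ql: "q < l - 1"
        unfolding L_def
      proof -
        obtain j where j: "l - 1 - q = Suc j" using ql by (cases "l - 1 - q") auto
        have k1: "p + l - q - 2 = Suc j + (p - 1)" and k2: "l - 1 = Suc j + q"
          using ql pq j by auto
        obtain c3 where c3: "eventually (\<lambda>x. iter_ln (Suc j) (\<tau> * x + \<bar>c2\<bar>) \<le> iter_ln (Suc j) x + c3) at_top"
          using eventually_iter_ln_affine_le[OF \<tau>0, of "\<bar>c2\<bar>" j] by auto
        obtain x0 where x0: "\<And>x y. x \<ge> x0 \<Longrightarrow> x \<le> y \<Longrightarrow> iter_ln (Suc j) x \<le> iter_ln (Suc j) y"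
          using eventually_iter_ln_mono[of "Suc j"] unfolding eventually_at_top_linorder by auto
        obtain x1 where x1: "\<And>x. x \<ge> x1 \<Longrightarrow> x0 < iter_ln (p - 1) x"
          using eventually_iter_ln_gt[of x0 "p - 1"] unfolding eventually_at_top_linorder by auto
        have ev: "eventually (\<lambda>r. iter_ln (Suc j) (\<tau> * iter_ln q (max_modulus g r) + \<bar>c2\<bar>)
            \<le> iter_ln (l - 1) (max_modulus g r) + c3) at_top"
          using eventually_compose_filterlim[OF c3 filterlim_compose[OF iter_ln_at_top[of q] M_top]]
          unfolding k2 iter_ln_add .
        show "Liminf at_top (\<lambda>r::real. ereal
            (iter_ln (p + l - q - 2) (nevanlinna_T (f \<circ> g) r) / iter_ln (l - 2) (nevanlinna_T G r)))
            \<le> ereal (2 powr \<sigma> / \<kappa>)"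
        proof (rule Liminf_quotient_le[OF _ a \<kappa>])
          from frequently_eventually_frequently[OF fr[OF B] eventually_conj[OF eventually_conj[OF num large[of x1]] ev]]
          show "frequently (\<lambda>r. iter_ln (p + l - q - 2) (nevanlinna_T (f \<circ> g) r) \<le> 2 powr \<sigma> * a r + c3 \<and>
            \<kappa> * a r - c \<le> iter_ln (l - 2) (nevanlinna_T G r)) at_top"
          proof (rule frequently_elim1, goal_cases)
            case (1 r)
            hence "x0 < iter_ln (p - 1) (nevanlinna_T (f \<circ> g) r)" by (intro x1) auto
            moreover have "iter_ln (p - 1) (nevanlinna_T (f \<circ> g) r) \<le> \<tau> * iter_ln q (max_modulus g r) + \<bar>c2\<bar>"
              using 1 by auto
            ultimately have "iter_ln (p + l - q - 2) (nevanlinna_T (f \<circ> g) r) \<le>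
                iter_ln (Suc j) (\<tau> * iter_ln q (max_modulus g r) + \<bar>c2\<bar>)"
              unfolding k1 iter_ln_add by (intro x0) auto
            thus ?case using 1 by (simp add: \<kappa>_def)
          qed
        qed simp
      qed
      \<comment> \<open>From \<open>1 \<le> q < l - 1\<close> it follows that
        \<open>l > 2\<close>.\<close>
      moreover have "\<kappa> = 1" if "q < l - 1" using that pq by (simp add: \<kappa>_def)
      ultimately show ?thesis by auto
    qed
  qed
  thus "l - 1 \<le> q \<Longrightarrow> Liminf at_top (\<lambda>r::real. ereal
            (iter_ln (p - 1) (nevanlinna_T (f \<circ> g) r) / iter_ln (l - 2) (nevanlinna_T G r)))
            \<le> ereal (\<tau> * 2 powr \<sigma> / (if l = 2 then 1 / 3 - \<delta> else 1))"
    and "q < l - 1 \<Longrightarrow> Liminf at_top (\<lambda>r::real. ereal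
            (iter_ln (p + l - q - 2) (nevanlinna_T (f \<circ> g) r) / iter_ln (l - 2) (nevanlinna_T G r)))
            \<le> ereal (2 powr \<sigma>)"
    unfolding L_def \<kappa>_def by blast+
qed

theorem theorem6:
  fixes f g Q G :: "complex \<Rightarrow> complex" and p q l \<alpha> :: nat
  assumes "f meromorphic_on UNIV"
    and "transcendental_entire g"
    and "1 \<le> q" and "q < p" and "2 \<le> l"
    and "\<bar>pq_order p q f\<bar> \<noteq> \<infinity>"
    and "\<bar>gen_order l g\<bar> \<noteq> \<infinity>"
    and "is_diff_polynomial g Q"
    and "1 \<le> \<alpha>"
    and "G = (\<lambda>z. g z ^ \<alpha> * Q z)"
  shows "(q \<ge> l - 1 \<and> l - 1 > 1 \<longrightarrow>
            Liminf at_top (\<lambda>r::real. ereal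
              (iter_ln (p - 1) (nevanlinna_T (f \<circ> g) r) / iter_ln (l - 2) (nevanlinna_T G r)))
            \<le> ereal (real_of_ereal (pq_order p q f) * 2 powr real_of_ereal (gen_order l g))) \<and>
         (q < l - 1 \<longrightarrow>
            Liminf at_top (\<lambda>r::real. ereal
              (iter_ln (p + l - q - 2) (nevanlinna_T (f \<circ> g) r) / iter_ln (l - 2) (nevanlinna_T G r)))
            \<le> ereal (2 powr real_of_ereal (gen_order l g))) \<and>
         (q \<ge> l - 1 \<and> l - 1 = 1 \<longrightarrow>
            (\<forall>\<beta>::real. \<beta> > 1 \<longrightarrow>
              Liminf at_top (\<lambda>r::real. ereal
                (iter_ln (p - 1) (nevanlinna_T (f \<circ> g) r) / nevanlinna_T G r))
              \<le> ereal (3 * \<beta> * real_of_ereal (pq_order p q f) * 2 powr real_of_ereal (gen_order 2 g))))"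
proof -
  define \<rho>f where "\<rho>f = real_of_ereal (pq_order p q f)"
  define \<rho> where "\<rho> = real_of_ereal (gen_order l g)"
  have \<rho>f: "pq_order p q f = ereal \<rho>f" and \<rho>: "gen_order l g = ereal \<rho>"
    using assms(6,7) by (simp_all add: \<rho>f_def \<rho>_def ereal_real)
  have "0 \<le> \<rho>f" using pq_order_nonneg[OF assms(1), of p q] by (simp add: \<rho>f)
  have lt: "pq_order p q f < ereal (\<rho>f + e)" "gen_order l g < ereal (\<rho> + e)" if "0 < e" for e
    using that by (simp_all add: \<rho>f \<rho>)
  note ratio = Liminf_nevanlinna_T_ratio_le[OF assms(1-5) lt _ _ assms(8-10)]
  have shift: "((\<lambda>e. x + e) \<longlongrightarrow> x) (at_right 0)" for x :: real
    using tendsto_add[OF tendsto_const[of x] tendsto_ident_at[of 0 "{0<..}"]] by simp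
  have lim2: "((\<lambda>e. 2 powr (\<rho> + e)) \<longlongrightarrow> 2 powr \<rho>) (at_right 0)"
    by (intro tendsto_powr tendsto_const shift) auto
  have "((\<lambda>e. if l = 2 then 1 / 3 - e else 1) \<longlongrightarrow> (if l = 2 then 1 / 3 - 0 else 1)) (at_right (0 :: real))"
    using tendsto_diff[OF tendsto_const tendsto_ident_at, of "1 / 3 :: real" 0 "{0<..}"] by (cases "l = 2") simp_all
  hence lim: "((\<lambda>e. (\<rho>f + e) * 2 powr (\<rho> + e) / (if l = 2 then 1 / 3 - e else 1)) \<longlongrightarrow>
      \<rho>f * 2 powr \<rho> / (if l = 2 then 1 / 3 - 0 else 1)) (at_right 0)"
    by (intro tendsto_divide tendsto_mult shift lim2) auto
  \<comment> \<open>A single \<open>e\<close> below \<open>1 / 3\<close> is the excess over both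
    orders and also the loss \<open>\<delta>\<close>; it tends to 0.\<close>
  have I: "Liminf at_top (\<lambda>r::real. ereal
          (iter_ln (p - 1) (nevanlinna_T (f \<circ> g) r) / iter_ln (l - 2) (nevanlinna_T G r)))
          \<le> ereal (\<rho>f * 2 powr \<rho> / (if l = 2 then 1 / 3 - 0 else 1))" if "l - 1 \<le> q"
    by (rule ereal_le_right_limit[of "1 / 3", OF _ _ lim], rule ratio(1)) (use that in auto)
  have II: "Liminf at_top (\<lambda>r::real. ereal
          (iter_ln (p + l - q - 2) (nevanlinna_T (f \<circ> g) r) / iter_ln (l - 2) (nevanlinna_T G r)))
          \<le> ereal (2 powr \<rho>)" if "q < l - 1"
    by (rule ereal_le_right_limit[of "1 / 3", OF _ _ lim2], rule ratio(2)) (use that in auto)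
  show ?thesis
  proof (intro conjI impI allI)
    assume "q \<ge> l - 1 \<and> l - 1 > 1"
    hence "l - 1 \<le> q" "l \<noteq> 2" by auto
    thus "Liminf at_top (\<lambda>r::real. ereal
              (iter_ln (p - 1) (nevanlinna_T (f \<circ> g) r) / iter_ln (l - 2) (nevanlinna_T G r)))
            \<le> ereal (real_of_ereal (pq_order p q f) * 2 powr real_of_ereal (gen_order l g))"
      using I by (simp add: \<rho>f_def \<rho>_def)
  next
    assume "q < l - 1"
    thus "Liminf at_top (\<lambda>r::real. ereal
              (iter_ln (p + l - q - 2) (nevanlinna_T (f \<circ> g) r) / iter_ln (l - 2) (nevanlinna_T G r)))
            \<le> ereal (2 powr real_of_ereal (gen_order l g))"
      using II by (simp add: \<rho>_def)
  next
    fix \<beta> :: real assume l: "q \<ge> l - 1 \<and> l - 1 = 1" and \<beta>: "\<beta> > 1"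
    hence l2: "l = 2" by linarith
    have "Liminf at_top (\<lambda>r::real. ereal
              (iter_ln (p - 1) (nevanlinna_T (f \<circ> g) r) / nevanlinna_T G r))
          \<le> ereal (3 * (\<rho>f * 2 powr \<rho>))"
      using I l l2 by (simp add: mult_ac)
    \<comment> \<open>The order of \<open>f\<close> is nonnegative, so the factor
      \<open>\<beta>\<close> only increases the bound.\<close>
    also have "3 * (\<rho>f * 2 powr \<rho>) \<le> 3 * \<beta> * \<rho>f * 2 powr \<rho>"
      using \<open>0 \<le> \<rho>f\<close> \<beta> mult_right_mono[of 1 \<beta> "3 * (\<rho>f * 2 powr \<rho>)"] by (simp add: mult_ac)
    finally show "Liminf at_top (\<lambda>r::real. ereal
              (iter_ln (p - 1) (nevanlinna_T (f \<circ> g) r) / nevanlinna_T G r))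
          \<le> ereal (3 * \<beta> * real_of_ereal (pq_order p q f) * 2 powr real_of_ereal (gen_order 2 g))"
      by (simp add: \<rho>f_def \<rho>_def l2)
  qed
qed

end
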